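(* Let $G$ be an amenable locally compact group and let $\Phi$ be an $N$-function. Then the convolution $f*g$ of every two functions $f,g\in A_\Phi(G)$ exists if and only if $G$ is compact. In particular, $A_\Phi(G)$ is a Banach algebra under the convolution product if and only if $G$ is compact.
   Context: $G$ is a locally compact group with a fixed left Haar measure $\lambda$; measurable functions equal $\lambda$-a.e. are identified. $N$-functions. An $N$-function is a convex even function $\Phi:\mathbb R\to[0,\infty)$ with $\Phi(x)=0$ if and only if $x=0$, $\lim_{x\to0}\Phi(x)/x=0$ and $\lim_{x\to\infty}\Phi(x)/x=\infty$. Its complementary $N$-function is $\Psi(y)=\sup\{x|y|-\Phi(x):x\ge0\}$. Orlicz spaces. For measurable $f:G\to\mathbb C$ put $\rho_\Phi(f)=\int_G\Phi(|f(x)|)\,d\lambda(x)$. Let $M^\Phi(G)=\{f:\rho_\Phi(af)<\infty\text{ for all }a>0\}$ (and similarly $M^\Psi(G)$), $N_\Phi(f)=\inf\{k>0:\rho_\Phi(f/k)\le1\}$ (Luxemburg norm), and $\|g\|_\Psi=\sup\{\int_G|fg|\,d\lambda: f\text{ measurable},\ N_\Phi(f)\le1\}$ (Orlicz norm). Convolution. $(f*g)(x)=\int_G f(y)g(y^{-1}x)\,d\lambda(y)$; the convolution $f*g$ is said to exist if $y\mapsto f(y)g(y^{-1}x)$ is $\lambda$-integrable for $\lambda$-almost all $x\in G$. Write $\check g(x)=g(x^{-1})$. The space $A_\Phi(G)$. It consists of all $u\in C_0(G)$ (continuous complex functions vanishing at infinity) for which there are sequences $(f_n)\subseteq M^\Phi(G)$,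 $(g_n)\subseteq M^\Psi(G)$ with $\sum_{n=1}^\infty N_\Phi(f_n)\|g_n\|_\Psi<\infty$ and $u=\sum_{n=1}^\infty f_n*\check g_n$. It is a Banach space under the norm $\|u\|_{A_\Phi}=\inf\sum_{n=1}^\infty N_\Phi(f_n)\|g_n\|_\Psi$, the infimum being over all such representations of $u$. Convention: "$A_\Phi(G)$ is a Banach algebra under convolution" means that $u*v$ exists and belongs to $A_\Phi(G)$ for all $u,v\in A_\Phi(G)$, and there is a constant $C>0$ with $\|u*v\|_{A_\Phi}\le C\|u\|_{A_\Phi}\|v\|_{A_\Phi}$ for all $u,v\in A_\Phi(G)$. *)

theory Defs
  imports "HOL-Analysis.Analysis"
begin

text \<open>
  Groups are written additively, using the class \<^class>\<open>topological_group_add\<close>. Its algebraic part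
  \<^class>\<open>group_add\<close> is \<^emph>\<open>not\<close> assumed commutative, so \<open>x + y\<close>, \<open>- x\<close> and \<open>- y + x\<close> stand for
  \<open>xy\<close>, \<open>x\<inverse>\<close> and \<open>y\<inverse>x\<close>.
\<close>

text \<open>
  A left Haar measure is a nonzero left-invariant Radon measure on the Borel sets. No
  \<open>\<sigma>\<close>-compactness is assumed, so inner regularity is required on open sets only.
\<close>

definition left_haar_measure :: "'a::{topological_group_add, t2_space} measure \<Rightarrow> bool" where
  "left_haar_measure M \<longleftrightarrow>
     sets M = sets borel \<and>
     emeasure M UNIV \<noteq> 0 \<and>
     (\<forall>K. compact K \<longrightarrow> emeasure M K < \<infinity>) \<and>
     (\<forall>a. \<forall>A\<in>sets borel. emeasure M ((\<lambda>x. a + x) ` A) = emeasure M A) \<and>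
     (\<forall>A\<in>sets borel. emeasure M A = (INF U\<in>{U. open U \<and> A \<subseteq> U}. emeasure M U)) \<and>
     (\<forall>U. open U \<longrightarrow> emeasure M U = (SUP K\<in>{K. compact K \<and> K \<subseteq> U}. emeasure M K))"

definition ess_bounded :: "'a measure \<Rightarrow> ('a \<Rightarrow> complex) set" where
  "ess_bounded M = {f \<in> borel_measurable M. \<exists>C. AE x in M. norm (f x) \<le> C}"

text \<open>
  Amenability: there is a left-invariant mean \<open>m\<close> on \<open>L\<^sup>\<infinity>(G)\<close>, i.e. a linear functional with
  \<open>m 1 = \<parallel>m\<parallel> = 1\<close> invariant under left translation. The norm condition is stated through
  essential bounds of \<open>f\<close>; together with linearity it makes \<open>m\<close> constant on classes of
  almost everywhere equal functions.
\<close>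

definition amenable :: "'a::group_add measure \<Rightarrow> bool" where
  "amenable M \<longleftrightarrow> (\<exists>m :: ('a \<Rightarrow> complex) \<Rightarrow> complex.
     (\<forall>f\<in>ess_bounded M. \<forall>g\<in>ess_bounded M. m (\<lambda>x. f x + g x) = m f + m g) \<and>
     (\<forall>c. \<forall>f\<in>ess_bounded M. m (\<lambda>x. c * f x) = c * m f) \<and>
     (\<forall>f\<in>ess_bounded M. \<forall>C. (AE x in M. norm (f x) \<le> C) \<longrightarrow> norm (m f) \<le> C) \<and>
     m (\<lambda>x. 1) = 1 \<and>
     (\<forall>a. \<forall>f\<in>ess_bounded M. m (\<lambda>x. f (a + x)) = m f))"

definition N_function :: "(real \<Rightarrow> real) \<Rightarrow> bool" where
  "N_function \<Phi> \<longleftrightarrow>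
     convex_on UNIV \<Phi> \<and>
     (\<forall>x. \<Phi> (- x) = \<Phi> x) \<and>
     (\<forall>x. 0 \<le> \<Phi> x) \<and>
     (\<forall>x. \<Phi> x = 0 \<longleftrightarrow> x = 0) \<and>
     ((\<lambda>x. \<Phi> x / x) \<longlongrightarrow> 0) (at 0) \<and>
     filterlim (\<lambda>x. \<Phi> x / x) at_top at_top"

definition complementary :: "(real \<Rightarrow> real) \<Rightarrow> real \<Rightarrow> real" where
  "complementary \<Phi> y = (SUP x\<in>{0..}. x * \<bar>y\<bar> - \<Phi> x)"

definition modular :: "'a measure \<Rightarrow> (real \<Rightarrow> real) \<Rightarrow> ('a \<Rightarrow> complex) \<Rightarrow> ennreal" where
  "modular M \<Phi> f = (\<integral>\<^sup>+x. ennreal (\<Phi> (norm (f x))) \<partial>M)"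

definition M_space :: "'a measure \<Rightarrow> (real \<Rightarrow> real) \<Rightarrow> ('a \<Rightarrow> complex) set" where
  "M_space M \<Phi> =
     {f \<in> borel_measurable M. \<forall>a>0. modular M \<Phi> (\<lambda>x. complex_of_real a * f x) < \<infinity>}"

text \<open>
  Extended values are essential here: a function with no admissible \<open>k\<close> gets norm \<open>\<infinity>\<close>, hence is
  excluded from the supremum in the Orlicz norm below.
\<close>

definition luxemburg_norm :: "'a measure \<Rightarrow> (real \<Rightarrow> real) \<Rightarrow> ('a \<Rightarrow> complex) \<Rightarrow> ennreal" where
  "luxemburg_norm M \<Phi> f =
     (INF k\<in>{k::real. 0 < k \<and> modular M \<Phi> (\<lambda>x. f x / complex_of_real k) \<le> 1}. ennreal k)"

text \<open>
  The argument is \<open>\<Phi>\<close>, not \<open>\<Psi>\<close>: \<open>orlicz_norm M \<Phi> g\<close> is the norm \<open>\<parallel>g\<parallel>\<^sub>\<Psi>\<close> for the complementary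
  function \<open>\<Psi>\<close> of \<open>\<Phi>\<close>.
\<close>

definition orlicz_norm :: "'a measure \<Rightarrow> (real \<Rightarrow> real) \<Rightarrow> ('a \<Rightarrow> complex) \<Rightarrow> ennreal" where
  "orlicz_norm M \<Phi> g =
     (SUP f\<in>{f \<in> borel_measurable M. luxemburg_norm M \<Phi> f \<le> 1}.
        \<integral>\<^sup>+x. ennreal (norm (f x * g x)) \<partial>M)"

definition conv_exists :: "'a::group_add measure \<Rightarrow> ('a \<Rightarrow> complex) \<Rightarrow> ('a \<Rightarrow> complex) \<Rightarrow> bool" where
  "conv_exists M f g \<longleftrightarrow> (AE x in M. integrable M (\<lambda>y. f y * g (- y + x)))"

definition conv :: "'a::group_add measure \<Rightarrow> ('a \<Rightarrow> complex) \<Rightarrow> ('a \<Rightarrow> complex) \<Rightarrow> 'a \<Rightarrow> complex" where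
  "conv M f g x = (\<integral>y. f y * g (- y + x) \<partial>M)"

definition check :: "('a::group_add \<Rightarrow> complex) \<Rightarrow> 'a \<Rightarrow> complex" where
  "check g x = g (- x)"

definition C0_space :: "('a::topological_space \<Rightarrow> complex) set" where
  "C0_space = {u. continuous_on UNIV u \<and>
     (\<forall>e>0. \<exists>K. compact K \<and> (\<forall>x. x \<notin> K \<longrightarrow> norm (u x) < e))}"

text \<open>
  The sum is taken pointwise. By the Hoelder inequality every \<open>f\<^sub>n * g\<^sub>n\<close>-check is defined at every
  point and bounded by \<open>N\<^sub>\<Phi>(f\<^sub>n) \<parallel>g\<^sub>n\<parallel>\<^sub>\<Psi>\<close>, so the convergence is automatically uniform.
\<close>

definition A_representation ::
  "'a::group_add measure \<Rightarrow> (real \<Rightarrow> real) \<Rightarrow> ('a \<Rightarrow> complex) \<Rightarrow>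
   (nat \<Rightarrow> 'a \<Rightarrow> complex) \<Rightarrow> (nat \<Rightarrow> 'a \<Rightarrow> complex) \<Rightarrow> bool" where
  "A_representation M \<Phi> u f g \<longleftrightarrow>
     (\<forall>n. f n \<in> M_space M \<Phi>) \<and>
     (\<forall>n. g n \<in> M_space M (complementary \<Phi>)) \<and>
     (\<Sum>n. luxemburg_norm M \<Phi> (f n) * orlicz_norm M \<Phi> (g n)) < \<infinity> \<and>
     (\<forall>x. (\<lambda>n. conv M (f n) (check (g n)) x) sums u x)"

definition A_space ::
  "'a::topological_group_add measure \<Rightarrow> (real \<Rightarrow> real) \<Rightarrow> ('a \<Rightarrow> complex) set" where
  "A_space M \<Phi> = {u \<in> C0_space. \<exists>f g. A_representation M \<Phi> u f g}"

definition A_norm ::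
  "'a::group_add measure \<Rightarrow> (real \<Rightarrow> real) \<Rightarrow> ('a \<Rightarrow> complex) \<Rightarrow> ennreal" where
  "A_norm M \<Phi> u =
     (INF (f, g)\<in>{(f, g). A_representation M \<Phi> u f g}.
        \<Sum>n. luxemburg_norm M \<Phi> (f n) * orlicz_norm M \<Phi> (g n))"

text \<open>
  The convolution of \<open>u\<close> and \<open>v\<close> is only determined almost everywhere; it belongs to \<open>A\<^sub>\<Phi>(G)\<close> if it
  agrees almost everywhere with an element \<open>w\<close>, which is unique since \<open>w\<close> is continuous and Haar
  measure has full support.
\<close>

definition conv_banach_algebra ::
  "'a::topological_group_add measure \<Rightarrow> (real \<Rightarrow> real) \<Rightarrow> bool" where
  "conv_banach_algebra M \<Phi> \<longleftrightarrow>
     (\<forall>u\<in>A_space M \<Phi>. \<forall>v\<in>A_space M \<Phi>.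
        conv_exists M u v \<and> (\<exists>w\<in>A_space M \<Phi>. AE x in M. conv M u v x = w x)) \<and>
     (\<exists>C::real. 0 < C \<and>
        (\<forall>u\<in>A_space M \<Phi>. \<forall>v\<in>A_space M \<Phi>. \<forall>w\<in>A_space M \<Phi>.
           (AE x in M. conv M u v x = w x) \<longrightarrow>
           A_norm M \<Phi> w \<le> ennreal C * A_norm M \<Phi> u * A_norm M \<Phi> v))"

end

theory Submission
  imports Defs
begin

text \<open>
  On a compact group elements of \<open>A\<^sub>\<Phi>(G)\<close> are bounded and bounded functions lie in \<open>M\<^sup>\<Phi>(G)\<close> and
  \<open>M\<^sup>\<Psi>(G)\<close>, so \<open>u * v\<close> has a one-term representation
  with factors \<open>u\<close> and the reflection of \<open>v\<close>.

  On a noncompact amenable group, Hahn-Banach separation turns the invariant mean into almost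
  invariant densities, first for finite and then for compact sets of translations. Their level sets
  yield nonnegative elements of \<open>A\<^sub>\<Phi>(G)\<close> of bounded norm that are at least \<open>1/2\<close> on any prescribed
  compact set. Haar measure is infinite, so there are compact sets \<open>K\<^sub>n\<close> of measure at least \<open>16\<^sup>n\<close>; summing
  such elements for \<open>K\<^sub>n \<union> K\<^sub>n\<inverse>V\<close> with weights \<open>2\<^sup>-\<^sup>n\<close> gives \<open>u\<close> for which \<open>u * u\<close> diverges on the
  neighbourhood \<open>V\<close> of the identity.
\<close>

subsection \<open>The Hahn-Banach theorem on spaces of functions\<close>

text \<open>The layers answer the question of how to bound \<open>luxemburg_norm\<close> times
  \<open>orlicz_norm\<close> for a general \<Phi>. For L^p one would factor a density into two
  powers; for \<Phi> no such factorization is at hand. But if both factors are bounded and vanish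
  off the same set E, the bounds for the two norms contain reciprocal quantities depending on
  \<Phi>, so their product is at most a constant times the measure of E. Neither
  \<sigma>-compactness nor a countable base is assumed: Haar measure may fail to be \<sigma>-finite,
  and limits along sequences do not suffice. Hence densities are continuous with compact support,
  Fubini is applied to such kernels only, and continuity of integrals in a parameter comes from
  compactness. The separating functional enters only through its values on translates of one bump;
  these are bounded continuous functions of the translation, and the mean acts on them. The n-th
  summand is at least 2^-n/2 on its compact set, so the integrand of u * u is at least 4^-n/4 on
  K_n; measure 16^n then makes the integral over K_n at least 4^n/4.\<close>

definition function_space :: "('b \<Rightarrow> real) set \<Rightarrow> bool" where
  "function_space W \<longleftrightarrow> (\<lambda>_. 0) \<in> W \<and> (\<forall>u\<in>W. \<forall>v\<in>W. (\<lambda>x. u x + v x) \<in> W) \<and>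
     (\<forall>a. \<forall>v\<in>W. (\<lambda>x. a * v x) \<in> W)"

text \<open>Homogeneity is asked as an inequality and for a > 0, which is all that has to be checked
  for the infima below. Equality and the value at 0 follow in \<open>sublinear_on_scale\<close> and
  \<open>sublinear_on_zero\<close>.\<close>

definition sublinear_on :: "('b \<Rightarrow> real) set \<Rightarrow> (('b \<Rightarrow> real) \<Rightarrow> real) \<Rightarrow> bool" where
  "sublinear_on W q \<longleftrightarrow> (\<forall>u\<in>W. \<forall>v\<in>W. q (\<lambda>x. u x + v x) \<le> q u + q v) \<and>
     (\<forall>a>0. \<forall>v\<in>W. q (\<lambda>x. a * v x) \<le> a * q v)"

definition linear_functional_on :: "('b \<Rightarrow> real) set \<Rightarrow> (('b \<Rightarrow> real) \<Rightarrow> real) \<Rightarrow> bool" where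
  "linear_functional_on W l \<longleftrightarrow> (\<forall>u\<in>W. \<forall>v\<in>W. l (\<lambda>x. u x + v x) = l u + l v) \<and>
     (\<forall>a. \<forall>v\<in>W. l (\<lambda>x. a * v x) = a * l v)"

lemma function_spaceD:
  assumes "function_space W"
  shows "(\<lambda>_. 0) \<in> W" "u \<in> W \<Longrightarrow> v \<in> W \<Longrightarrow> (\<lambda>x. u x + v x) \<in> W"
    "v \<in> W \<Longrightarrow> (\<lambda>x. a * v x) \<in> W" "v \<in> W \<Longrightarrow> (\<lambda>x. - v x) \<in> W"
    "u \<in> W \<Longrightarrow> v \<in> W \<Longrightarrow> (\<lambda>x. u x - v x) \<in> W"
proof -
  show *: "(\<lambda>_. 0) \<in> W" "u \<in> W \<Longrightarrow> v \<in> W \<Longrightarrow> (\<lambda>x. u x + v x) \<in> W"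
    "v \<in> W \<Longrightarrow> (\<lambda>x. a * v x) \<in> W" for u v a
    using assms by (auto simp: function_space_def)
  show **: "v \<in> W \<Longrightarrow> (\<lambda>x. - v x) \<in> W" for v
    using *(3)[of v "-1"] by simp
  show "u \<in> W \<Longrightarrow> v \<in> W \<Longrightarrow> (\<lambda>x. u x - v x) \<in> W"
    using *(2)[of u "\<lambda>x. - v x"] ** by simp
qed

lemma sublinear_onD:
  assumes "sublinear_on W q"
  shows "u \<in> W \<Longrightarrow> v \<in> W \<Longrightarrow> q (\<lambda>x. u x + v x) \<le> q u + q v"
    "a > 0 \<Longrightarrow> v \<in> W \<Longrightarrow> q (\<lambda>x. a * v x) \<le> a * q v"
  using assms by (auto simp: sublinear_on_def)

lemma sublinear_on_zero:
  assumes "function_space W" "sublinear_on W q"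
  shows "q (\<lambda>_. 0) = 0"
proof -
  have "q (\<lambda>_. 0) \<le> a * q (\<lambda>_. 0)" if "a > 0" for a
    using assms that function_spaceD(1)[OF assms(1)] unfolding sublinear_on_def by fastforce
  from this[of 2] this[of "1/2"] show ?thesis by simp
qed

lemma sublinear_on_scale:
  assumes W: "function_space W" and q: "sublinear_on W q" and "a \<ge> 0" "v \<in> W"
  shows "q (\<lambda>x. a * v x) = a * q v"
proof (cases "a = 0")
  case True
  then show ?thesis using sublinear_on_zero[OF W q] by simp
next
  case False
  then have a: "a > 0" using assms by simp
  have "q (\<lambda>x. inverse a * (a * v x)) \<le> inverse a * q (\<lambda>x. a * v x)"
    using q a function_spaceD(3)[OF W \<open>v \<in> W\<close>, of a] unfolding sublinear_on_def by fastforce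
  then have "q v \<le> inverse a * q (\<lambda>x. a * v x)"
    using a by (simp add: mult.assoc[symmetric])
  then have "a * q v \<le> q (\<lambda>x. a * v x)"
    using a by (simp add: field_simps)
  moreover have "q (\<lambda>x. a * v x) \<le> a * q v"
    using q a \<open>v \<in> W\<close> unfolding sublinear_on_def by blast
  ultimately show ?thesis by simp
qed

lemma sublinear_on_lower:
  assumes W: "function_space W" and q: "sublinear_on W q" and v: "v \<in> W"
  shows "- q (\<lambda>x. - v x) \<le> q v"
proof -
  have "q (\<lambda>x. v x + - v x) \<le> q v + q (\<lambda>x. - v x)"
    by (rule sublinear_onD(1)[OF q v function_spaceD(4)[OF W v]])
  then show ?thesis using sublinear_on_zero[OF W q] by simp
qed

text \<open>The linear functionals are the minimal sublinear ones.\<close>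

lemma minimal_sublinear_additive:
  assumes W: "function_space W" and r: "sublinear_on W r"
    and minimal: "\<And>r'. sublinear_on W r' \<Longrightarrow> (\<And>v. v \<in> W \<Longrightarrow> r' v \<le> r v) \<Longrightarrow>
      (\<And>v. v \<in> W \<Longrightarrow> r' v = r v)"
    and w: "w \<in> W" and v: "v \<in> W"
  shows "r (\<lambda>x. v x + w x) = r v + r w"
proof -
  \<comment> \<open>This lowers r just enough to split off the direction w. The choice t = 0 shows
    that r' is below r, so minimality gives r' = r, and t = 1 then yields r v + r w \<le> r (v +
    w).\<close>
  define r' where "r' v = (INF t\<in>{0..}. r (\<lambda>x. v x + t * w x) - t * r w)" for v
  have tw: "(\<lambda>x. v x + t * w x) \<in> W" if "v \<in> W" for v t
    using function_spaceD(2)[OF W that function_spaceD(3)[OF W w]] .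
  have lower: "- r (\<lambda>x. - v x) \<le> r (\<lambda>x. v x + t * w x) - t * r w" if "v \<in> W" "t \<ge> 0" for v t
  proof -
    have "r (\<lambda>x. (v x + t * w x) + - v x) \<le> r (\<lambda>x. v x + t * w x) + r (\<lambda>x. - v x)"
      by (rule sublinear_onD(1)[OF r tw[OF that(1)] function_spaceD(4)[OF W that(1)]])
    then show ?thesis using sublinear_on_scale[OF W r that(2) w] by simp
  qed
  have bdd: "bdd_below ((\<lambda>t. r (\<lambda>x. v x + t * w x) - t * r w) ` {0..})" if "v \<in> W" for v
    using lower[OF that] by (intro bdd_belowI2[where m = "- r (\<lambda>x. - v x)"]) auto
  have le: "r' v \<le> r (\<lambda>x. v x + t * w x) - t * r w" if "v \<in> W" "t \<ge> 0" for v t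
    unfolding r'_def using bdd[OF that(1)] that(2) by (intro cINF_lower) auto
  have "sublinear_on W r'"
    unfolding sublinear_on_def
  proof (intro conjI ballI allI impI)
    fix u v assume u: "u \<in> W" and v: "v \<in> W"
    have uv: "(\<lambda>x. u x + v x) \<in> W" using function_spaceD(2)[OF W u v] .
    have *: "r' (\<lambda>x. u x + v x) \<le> (r (\<lambda>x. u x + s * w x) - s * r w) + (r (\<lambda>x. v x + t * w x) - t * r w)"
      if "s \<ge> 0" "t \<ge> 0" for s t
    proof -
      have "r' (\<lambda>x. u x + v x) \<le> r (\<lambda>x. (u x + v x) + (s + t) * w x) - (s + t) * r w"
        using le[OF uv, of "s + t"] that by simp
      also have "(\<lambda>x. (u x + v x) + (s + t) * w x) = (\<lambda>x. (u x + s * w x) + (v x + t * w x))"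
        by (auto simp: algebra_simps)
      also have "r \<dots> \<le> r (\<lambda>x. u x + s * w x) + r (\<lambda>x. v x + t * w x)"
        by (rule sublinear_onD(1)[OF r tw[OF u] tw[OF v]])
      finally show ?thesis by (simp add: algebra_simps)
    qed
    have "r' (\<lambda>x. u x + v x) - (r (\<lambda>x. u x + s * w x) - s * r w) \<le> r' v" if "s \<ge> 0" for s
      unfolding r'_def[of v] using *[OF that] by (intro cINF_greatest) (auto simp: algebra_simps)
    then have "r' (\<lambda>x. u x + v x) - r' v \<le> r (\<lambda>x. u x + s * w x) - s * r w" if "s \<ge> 0" for s
      using that by (fastforce simp: algebra_simps)
    then have "r' (\<lambda>x. u x + v x) - r' v \<le> r' u"
      unfolding r'_def[of u] by (intro cINF_greatest) auto
    then show "r' (\<lambda>x. u x + v x) \<le> r' u + r' v" by simp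
  next
    fix a :: real and v assume a: "a > 0" and v: "v \<in> W"
    have "r' (\<lambda>x. a * v x) / a \<le> r (\<lambda>x. v x + t * w x) - t * r w" if "t \<ge> 0" for t
    proof -
      have "r' (\<lambda>x. a * v x) \<le> r (\<lambda>x. a * v x + (a * t) * w x) - (a * t) * r w"
        using le[OF function_spaceD(3)[OF W v], of "a * t"] a that by simp
      also have "(\<lambda>x. a * v x + (a * t) * w x) = (\<lambda>x. a * (v x + t * w x))"
        by (auto simp: algebra_simps)
      also have "r \<dots> = a * r (\<lambda>x. v x + t * w x)"
        using sublinear_on_scale[OF W r _ tw[OF v]] a by simp
      finally show ?thesis using a by (simp add: field_simps)
    qed
    then have "r' (\<lambda>x. a * v x) / a \<le> r' v"
      unfolding r'_def[of v] by (intro cINF_greatest) auto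
    then show "r' (\<lambda>x. a * v x) \<le> a * r' v" using a by (simp add: field_simps)
  qed
  moreover have "r' v \<le> r v" if "v \<in> W" for v
    using le[OF that, of 0] by simp
  ultimately have "r' v = r v" using minimal v by blast
  then have "r v + r w \<le> r (\<lambda>x. v x + w x)"
    using le[OF v, of 1] by simp
  moreover have "r (\<lambda>x. v x + w x) \<le> r v + r w"
    using r v w unfolding sublinear_on_def by blast
  ultimately show ?thesis by simp
qed

theorem Hahn_Banach_dominated:
  assumes W: "function_space W" and q: "sublinear_on W q"
  obtains l where "linear_functional_on W l" "\<And>v. v \<in> W \<Longrightarrow> l v \<le> q v"
proof -
  \<comment> \<open>Fixing the value 0 outside W makes \<open>P\<close>, which compares at all
    functions, antisymmetric without further identification. \<open>P\<close> points downwards, so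
    an element maximal for Zorn is a minimal sublinear functional.\<close>
  define Q where "Q = {r. sublinear_on W r \<and> (\<forall>v\<in>W. r v \<le> q v) \<and> (\<forall>v. v \<notin> W \<longrightarrow> r v = 0)}"
  define P where "P r r' \<longleftrightarrow> (\<forall>v. r' v \<le> r v)" for r r' :: "('a \<Rightarrow> real) \<Rightarrow> real"
  have po: "partial_order_on Q (relation_of P Q)"
    unfolding partial_order_on_def preorder_on_def relation_of_def refl_on_def trans_def antisym_def P_def
    by (auto intro: order_trans simp: fun_eq_iff order_class.order_eq_iff)
  have "\<exists>r\<in>Q. \<forall>a\<in>C. P a r" if C: "C \<in> Chains (relation_of P Q)" for C
  proof (cases "C = {}")
    case True
    define r where "r v = (if v \<in> W then q v else 0)" for v
    have "r \<in> Q"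
      using q function_spaceD(2,3)[OF W] unfolding Q_def r_def sublinear_on_def by auto
    then show ?thesis using True by blast
  next
    case False
    have CQ: "C \<subseteq> Q" and tot: "\<And>a b. a \<in> C \<Longrightarrow> b \<in> C \<Longrightarrow> P a b \<or> P b a"
      using C unfolding Chains_def relation_of_def by auto
    define r where "r v = (INF a\<in>C. a v)" for v
    have lower: "- q (\<lambda>x. - v x) \<le> a v" if "a \<in> C" "v \<in> W" for a v
    proof -
      have "a (\<lambda>x. - v x) \<le> q (\<lambda>x. - v x)"
        using CQ that function_spaceD(4)[OF W] unfolding Q_def by auto
      moreover have "- a (\<lambda>x. - v x) \<le> a v"
        using CQ that sublinear_on_lower[OF W] unfolding Q_def by auto
      ultimately show ?thesis by simp
    qed
    have bdd: "bdd_below ((\<lambda>a. a v) ` C)" for v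
    proof (cases "v \<in> W")
      case True
      then show ?thesis using lower by (intro bdd_belowI2[where m = "- q (\<lambda>x. - v x)"]) auto
    next
      case False
      then show ?thesis using CQ by (intro bdd_belowI2[where m = 0]) (auto simp: Q_def)
    qed
    have le: "r v \<le> a v" if "a \<in> C" for a v
      unfolding r_def using bdd that by (intro cINF_lower) auto
    have "sublinear_on W r"
      unfolding sublinear_on_def
    proof (intro conjI ballI allI impI)
      fix u v assume u: "u \<in> W" and v: "v \<in> W"
      \<comment> \<open>Of two members of a chain one is the smaller, and its subadditivity serves
        both.\<close>
      have *: "r (\<lambda>x. u x + v x) \<le> a u + b v" if "a \<in> C" "b \<in> C" for a b
      proof -
        have "\<exists>c\<in>C. P a c \<and> P b c"
          using tot[OF that] that by (auto simp: P_def)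
        then obtain c where c: "c \<in> C" "P a c" "P b c" by blast
        have "r (\<lambda>x. u x + v x) \<le> c (\<lambda>x. u x + v x)" using le[OF c(1)] .
        also have "\<dots> \<le> c u + c v"
          using CQ c(1) u v unfolding Q_def sublinear_on_def by blast
        also have "\<dots> \<le> a u + b v" using c unfolding P_def by (simp add: add_mono)
        finally show ?thesis .
      qed
      have "r (\<lambda>x. u x + v x) - a u \<le> r v" if "a \<in> C" for a
        unfolding r_def[of v] using *[OF that] False by (intro cINF_greatest) (auto simp: algebra_simps)
      then have "r (\<lambda>x. u x + v x) - r v \<le> a u" if "a \<in> C" for a
        using that by (fastforce simp: algebra_simps)
      then have "r (\<lambda>x. u x + v x) - r v \<le> r u"
        unfolding r_def[of u] using False by (intro cINF_greatest) auto
      then show "r (\<lambda>x. u x + v x) \<le> r u + r v" by simp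
    next
      fix a :: real and v assume a: "a > 0" and v: "v \<in> W"
      have "r (\<lambda>x. a * v x) / a \<le> b v" if "b \<in> C" for b
      proof -
        have "b (\<lambda>x. a * v x) \<le> a * b v"
          using CQ that a v unfolding Q_def sublinear_on_def by blast
        then show ?thesis using le[OF that, of "\<lambda>x. a * v x"] a by (simp add: field_simps)
      qed
      then have "r (\<lambda>x. a * v x) / a \<le> r v"
        unfolding r_def[of v] using False by (intro cINF_greatest) auto
      then show "r (\<lambda>x. a * v x) \<le> a * r v" using a by (simp add: field_simps)
    qed
    moreover have "r v \<le> q v" if "v \<in> W" for v
      using False le CQ that unfolding Q_def by (smt (verit) ex_in_conv mem_Collect_eq subsetD)
    moreover have "r v = 0" if "v \<notin> W" for v
    proof -
      have "(\<lambda>a. a v) ` C = (\<lambda>a. 0) ` C" using CQ that by (intro image_cong) (auto simp: Q_def)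
      then show ?thesis unfolding r_def using False by simp
    qed
    ultimately have "r \<in> Q" unfolding Q_def by blast
    then show ?thesis using le unfolding P_def by blast
  qed
  from predicate_Zorn[OF po this] obtain l where l: "l \<in> Q" and min: "\<And>a. a \<in> Q \<Longrightarrow> P l a \<Longrightarrow> a = l"
    by blast
  have sl: "sublinear_on W l" and lq: "\<And>v. v \<in> W \<Longrightarrow> l v \<le> q v" and l0: "\<And>v. v \<notin> W \<Longrightarrow> l v = 0"
    using l unfolding Q_def by auto
  have minimal: "r' v = l v" if "sublinear_on W r'" "\<And>v. v \<in> W \<Longrightarrow> r' v \<le> l v" "v \<in> W" for r' v
  proof -
    define r where "r v = (if v \<in> W then r' v else 0)" for v
    have "sublinear_on W r"
      using that(1) function_spaceD(2,3)[OF W] unfolding r_def sublinear_on_def by auto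
    moreover have "r v \<le> q v" if "v \<in> W" for v
      using \<open>\<And>v. v \<in> W \<Longrightarrow> r' v \<le> l v\<close>[OF that] lq[OF that] that by (simp add: r_def)
    ultimately have "r \<in> Q" unfolding Q_def by (auto simp: r_def)
    moreover have "P l r"
      using that(2) l0 unfolding P_def r_def by auto
    ultimately have "r = l" using min by blast
    then have "r v = l v" by simp
    then show ?thesis using that(3) by (simp add: r_def)
  qed
  have add: "l (\<lambda>x. u x + v x) = l u + l v" if "u \<in> W" "v \<in> W" for u v
    by (rule minimal_sublinear_additive[OF W sl _ that(2,1)]) (rule minimal)
  have neg: "l (\<lambda>x. - v x) = - l v" if "v \<in> W" for v
    using add[OF that function_spaceD(4)[OF W that]] sublinear_on_zero[OF W sl] by simp
  have "l (\<lambda>x. a * v x) = a * l v" if "v \<in> W" for a v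
  proof (cases "a \<ge> 0")
    case True
    then show ?thesis using sublinear_on_scale[OF W sl _ that] by blast
  next
    case False
    then have "l (\<lambda>x. (- a) * v x) = (- a) * l v"
      using sublinear_on_scale[OF W sl _ that, of "- a"] by simp
    then show ?thesis
      using neg[OF function_spaceD(3)[OF W that, of "- a"]] by simp
  qed
  then have "linear_functional_on W l"
    using add unfolding linear_functional_on_def by blast
  then show ?thesis using that lq by blast
qed

subsection \<open>Continuous functions of compact support and Haar measure\<close>

definition Cc :: "('a::topological_space \<Rightarrow> real) set" where
  "Cc = {f. continuous_on UNIV f \<and> (\<exists>K. compact K \<and> (\<forall>x. x \<notin> K \<longrightarrow> f x = 0))}"

lemma CcI: "continuous_on UNIV f \<Longrightarrow> compact K \<Longrightarrow> (\<And>x. x \<notin> K \<Longrightarrow> f x = 0) \<Longrightarrow> f \<in> Cc"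
  unfolding Cc_def by blast

lemma CcD:
  assumes "f \<in> Cc"
  shows "\<exists>K. compact K \<and> (\<forall>x. x \<notin> K \<longrightarrow> f x = 0)"
  using assms unfolding Cc_def by blast

lemma Cc_continuous: "f \<in> Cc \<Longrightarrow> continuous_on UNIV f"
  unfolding Cc_def by blast

lemma continuous_on_Cc:
  "f \<in> Cc \<Longrightarrow> continuous_on S g \<Longrightarrow> continuous_on S (\<lambda>x. f (g x))"
  using continuous_on_compose2[OF Cc_continuous] by blast

lemma Cc_add:
  assumes "f \<in> Cc" "g \<in> Cc"
  shows "(\<lambda>x. f x + g x) \<in> Cc"
proof -
  obtain K where "compact K" "\<forall>x. x \<notin> K \<longrightarrow> f x = 0"
    using CcD[OF assms(1)] by blast
  moreover obtain L where "compact L" "\<forall>x. x \<notin> L \<longrightarrow> g x = 0"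
    using CcD[OF assms(2)] by blast
  ultimately show ?thesis
    using continuous_on_add[OF Cc_continuous[OF assms(1)] Cc_continuous[OF assms(2)]]
    by (intro CcI[where K = "K \<union> L"]) auto
qed

lemma Cc_compose:
  assumes "f \<in> Cc" "continuous_on UNIV h" "h 0 = 0"
  shows "(\<lambda>x. h (f x)) \<in> Cc"
proof -
  obtain K where K: "compact K" "\<forall>x. x \<notin> K \<longrightarrow> f x = 0"
    using CcD[OF assms(1)] by blast
  show ?thesis
    using K assms(3) continuous_on_compose2[OF assms(2) Cc_continuous[OF assms(1)]]
    by (intro CcI[OF _ K(1)]) auto
qed

lemma Cc_scale: "f \<in> Cc \<Longrightarrow> (\<lambda>x. a * f x) \<in> Cc" for f :: "'a::topological_space \<Rightarrow> real"
  by (rule Cc_compose[where h = "\<lambda>t. a * t"]) (auto intro!: continuous_intros)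

lemma Cc_minus: "f \<in> Cc \<Longrightarrow> g \<in> Cc \<Longrightarrow> (\<lambda>x. f x - g x) \<in> Cc"
  using Cc_add[OF _ Cc_scale[of g "-1"], of f] by simp

lemma Cc_abs: "f \<in> Cc \<Longrightarrow> (\<lambda>x. \<bar>f x\<bar>) \<in> Cc"
  by (rule Cc_compose[where h = abs]) (auto intro!: continuous_intros)

lemma compact_plus:
  fixes K L :: "'a::topological_group_add set"
  assumes "compact K" "compact L"
  shows "compact ((\<lambda>(x, y). x + y) ` (K \<times> L))"
  using assms by (intro compact_continuous_image compact_Times)
    (auto intro!: continuous_intros simp: case_prod_beta)

lemma compact_uminus:
  fixes K :: "'a::topological_group_add set"
  assumes "compact K"
  shows "compact (uminus ` K)"
  using assms by (intro compact_continuous_image) (auto intro!: continuous_intros)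

lemma Cc_translate:
  fixes f :: "'a::topological_group_add \<Rightarrow> real"
  assumes "f \<in> Cc"
  shows "(\<lambda>x. f (a + x)) \<in> Cc"
proof -
  obtain K where K: "compact K" "\<forall>x. x \<notin> K \<longrightarrow> f x = 0"
    using CcD[OF assms] by blast
  show ?thesis
  proof (rule CcI)
    show "continuous_on UNIV (\<lambda>x. f (a + x))" by (intro continuous_on_Cc[OF assms] continuous_intros)
    show "compact ((\<lambda>x. - a + x) ` K)" using K(1)
      by (intro compact_continuous_image continuous_intros)
    show "f (a + x) = 0" if "x \<notin> (\<lambda>x. - a + x) ` K" for x
    proof -
      have "a + x \<notin> K"
      proof
        assume "a + x \<in> K"
        then have "- a + (a + x) \<in> (\<lambda>x. - a + x) ` K" by blast
        with that show False by simp
      qed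
      then show ?thesis using K(2) by blast
    qed
  qed
qed

text \<open>Each point of C has an open rectangle inside W, and compactness leaves finitely many of
  them. Their union lies in the product \<sigma>-algebra even if W does not.\<close>

lemma compact_rectangle_cover:
  fixes C :: "('a::topological_space \<times> 'b::topological_space) set"
  assumes "compact C" "open W" "C \<subseteq> W"
  obtains R where "C \<subseteq> R" "R \<subseteq> W" "R \<in> sets (borel \<Otimes>\<^sub>M borel)"
proof -
  define \<R> where "\<R> = {A \<times> B | A B. open A \<and> open B \<and> A \<times> B \<subseteq> W}"
  have op: "open r" if "r \<in> \<R>" for r using that unfolding \<R>_def by (auto intro: open_Times)
  have "C \<subseteq> \<Union>\<R>"
  proof
    fix p assume "p \<in> C"
    then have "p \<in> W" using assms by blast
    then obtain A B where AB: "open A" "open B" "p \<in> A \<times> B" "A \<times> B \<subseteq> W"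
      by (rule open_prod_elim[OF \<open>open W\<close>])
    then have "A \<times> B \<in> \<R>" unfolding \<R>_def by auto
    then show "p \<in> \<Union>\<R>" using AB(3) by (rule UnionI)
  qed
  then obtain D where D: "D \<subseteq> \<R>" "finite D" "C \<subseteq> \<Union>D"
    by (rule compactE[OF \<open>compact C\<close> _ op])
  have meas: "\<Union>D \<in> sets (borel \<Otimes>\<^sub>M borel)"
  proof (rule sets.finite_Union[OF D(2)])
    show "D \<subseteq> sets (borel \<Otimes>\<^sub>M borel)"
      using D(1) unfolding \<R>_def by (auto intro!: pair_measureI)
  qed
  have "\<Union>D \<subseteq> W" using D(1) unfolding \<R>_def by auto
  then show ?thesis by (rule that[OF D(3) _ meas])
qed

text \<open>For spaces without a countable base the Borel sets of the product need not lie in the product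
  of the Borel \<open>\<sigma>\<close>-algebras; continuous functions of compact support are nevertheless measurable.\<close>

lemma borel_measurable_pair_compact_support:
  fixes F :: "'a::t2_space \<Rightarrow> 'b::t2_space \<Rightarrow> real"
  assumes F: "continuous_on UNIV (\<lambda>p. F (fst p) (snd p))"
    and K: "compact K" and L: "compact L"
    and supp: "\<And>x y. x \<notin> K \<or> y \<notin> L \<Longrightarrow> F x y = 0"
  shows "(\<lambda>p. F (fst p) (snd p)) \<in> borel_measurable (borel \<Otimes>\<^sub>M borel)"
proof -
  have KL: "K \<times> L \<in> sets (borel \<Otimes>\<^sub>M borel)"
    using K L by (auto intro!: pair_measureI borel_closed compact_imp_closed)
  have "{p. c < F (fst p) (snd p)} \<in> sets (borel \<Otimes>\<^sub>M borel)" for c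
  proof -
    define W where "W = {p. c < F (fst p) (snd p)}"
    \<comment> \<open>These compact superlevel sets exhaust W inside K \<times> L, so there W is the
      countable union of measurable sets squeezed between C n and W.\<close>
    define C where "C n = {p. c + inverse (real (Suc n)) \<le> F (fst p) (snd p)} \<inter> (K \<times> L)" for n
    have W: "open W" unfolding W_def using F by (intro open_Collect_less continuous_intros)
    have "compact (C n)" for n
      unfolding C_def using F K L
      by (intro closed_Int_compact closed_Collect_le continuous_intros compact_Times)
    moreover have CW: "C n \<subseteq> W" for n
    proof
      fix p assume "p \<in> C n"
      then have "c + inverse (real (Suc n)) \<le> F (fst p) (snd p)" by (simp add: C_def)
      moreover have "0 < inverse (real (Suc n))" by simp
      ultimately have "c < F (fst p) (snd p)" by linarith
      then show "p \<in> W" unfolding W_def by simp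
    qed
    ultimately have "\<exists>R. C n \<subseteq> R \<and> R \<subseteq> W \<and> R \<in> sets (borel \<Otimes>\<^sub>M borel)" for n
      by (metis compact_rectangle_cover W)
    then obtain R where R: "\<And>n. C n \<subseteq> R n" "\<And>n. R n \<subseteq> W" "\<And>n. R n \<in> sets (borel \<Otimes>\<^sub>M borel)"
      by metis
    have "W \<inter> (K \<times> L) \<subseteq> (\<Union>n. C n)"
    proof
      fix p assume p: "p \<in> W \<inter> (K \<times> L)"
      then have "0 < F (fst p) (snd p) - c" by (auto simp: W_def)
      then obtain n where "inverse (real (Suc n)) < F (fst p) (snd p) - c"
        using reals_Archimedean by blast
      then have "p \<in> C n" using p by (auto simp: C_def)
      then show "p \<in> (\<Union>n. C n)" by blast
    qed
    also have "\<dots> \<subseteq> (\<Union>n. R n)" using R(1) by (intro UN_mono) auto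
    finally have "W \<inter> (K \<times> L) \<subseteq> (\<Union>n. R n)" .
    moreover have "(\<Union>n. R n) \<subseteq> W" using R(2) by (intro UN_least) auto
    ultimately have eq: "W \<inter> (K \<times> L) = (\<Union>n. R n) \<inter> (K \<times> L)" by auto
    have zero: "F (fst p) (snd p) = 0" if "p \<notin> K \<times> L" for p
      using supp[of "fst p" "snd p"] that by (simp add: mem_Times_iff)
    \<comment> \<open>Off K \<times> L the function is 0, so that part belongs to W entirely or not
      at all, according to the sign of c.\<close>
    have "p \<in> W \<longleftrightarrow> p \<in> (W \<inter> (K \<times> L)) \<union> (if c < 0 then - (K \<times> L) else {})" for p
      using zero[of p] by (cases "p \<in> K \<times> L") (simp_all add: W_def del: mem_Sigma_iff)
    then have split: "W = (W \<inter> (K \<times> L)) \<union> (if c < 0 then - (K \<times> L) else {})" by (rule set_eqI)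
    have "W \<inter> (K \<times> L) \<in> sets (borel \<Otimes>\<^sub>M borel)"
      unfolding eq using R(3) KL by auto
    moreover have "- (K \<times> L) \<in> sets (borel \<Otimes>\<^sub>M borel)"
      using sets.compl_sets[OF KL] by (simp add: space_pair_measure Compl_eq_Diff_UNIV)
    ultimately have "W \<in> sets (borel \<Otimes>\<^sub>M borel)"
      by (subst split) (simp add: sets.Un)
    then show ?thesis unfolding W_def .
  qed
  then show ?thesis
    unfolding borel_measurable_iff_greater space_pair_measure by simp
qed

lemma continuous_on_sections:
  assumes "continuous_on UNIV (\<lambda>p. F (fst p) (snd p))"
  shows "continuous_on UNIV (\<lambda>y. F x y)" "continuous_on UNIV (\<lambda>x. F x y)"
    "continuous_on UNIV (\<lambda>p. F (snd p) (fst p))"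
  using continuous_on_compose2[OF assms continuous_on_Pair[OF continuous_on_const continuous_on_id]]
    continuous_on_compose2[OF assms continuous_on_Pair[OF continuous_on_id continuous_on_const]]
    continuous_on_compose2[OF assms continuous_on_swap]
  by (simp_all add: prod.swap_def)

section \<open>Haar measure: parameter integrals and Fubini's theorem\<close>

locale haar_group =
  fixes M :: "'a::{topological_group_add, t2_space} measure"
  assumes locally_compact: "locally compact (UNIV :: 'a set)"
    and haar: "left_haar_measure M"
begin

lemmas haar_unfolded = haar[unfolded left_haar_measure_def]

lemma sets_M [measurable_cong]: "sets M = sets borel"
  using haar_unfolded[THEN conjunct1] .

lemma space_M [simp]: "space M = UNIV"
  using sets_eq_imp_space_eq[OF sets_M] by simp

lemma emeasure_compact: "compact K \<Longrightarrow> emeasure M K < \<infinity>"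
  using haar_unfolded[THEN conjunct2, THEN conjunct2, THEN conjunct1] by simp

lemma emeasure_translate:
  "A \<in> sets borel \<Longrightarrow> emeasure M ((\<lambda>x. a + x) ` A) = emeasure M A"
  using haar_unfolded[THEN conjunct2, THEN conjunct2, THEN conjunct2, THEN conjunct1] by simp

lemma compact_sets: "compact K \<Longrightarrow> K \<in> sets M"
  by (simp add: sets_M borel_closed compact_imp_closed)

lemma measurable_continuous: "continuous_on UNIV f \<Longrightarrow> f \<in> borel_measurable M"
  by (subst measurable_cong_sets[OF sets_M refl]) (rule borel_measurable_continuous_onI)

lemma measurable_translate: "(\<lambda>x. a + x) \<in> measurable M M"
  by (subst measurable_cong_sets[OF sets_M sets_M])
    (intro borel_measurable_continuous_onI continuous_intros)

lemma distr_translate: "distr M M (\<lambda>x. a + x) = M"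
proof (rule measure_eqI)
  fix A assume A: "A \<in> sets (distr M M (\<lambda>x. a + x))"
  have "(\<lambda>x. a + x) -` A = (\<lambda>x. - a + x) ` A"
  proof
    show "(\<lambda>x. a + x) -` A \<subseteq> (\<lambda>x. - a + x) ` A"
    proof
      fix x assume "x \<in> (\<lambda>x. a + x) -` A"
      then show "x \<in> (\<lambda>x. - a + x) ` A"
        by (intro image_eqI[where x = "a + x"]) auto
    qed
  qed auto
  then show "emeasure (distr M M (\<lambda>x. a + x)) A = emeasure M A"
    using A emeasure_translate[of A "- a"]
    by (simp add: emeasure_distr[OF measurable_translate] sets_M)
qed simp

lemma nn_integral_translate:
  assumes "f \<in> borel_measurable M"
  shows "(\<integral>\<^sup>+x. f (a + x) \<partial>M) = (\<integral>\<^sup>+x. f x \<partial>M)"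
  using nn_integral_distr[OF measurable_translate[of a], of f] assms by (simp add: distr_translate)

lemma integral_translate:
  fixes f :: "'a \<Rightarrow> 'b::{banach, second_countable_topology}"
  assumes "f \<in> borel_measurable M"
  shows "(\<integral>x. f (a + x) \<partial>M) = (\<integral>x. f x \<partial>M)"
  using integral_distr[OF measurable_translate[of a] assms] unfolding distr_translate by simp

lemma integrable_bounded_compact:
  fixes f :: "'a \<Rightarrow> 'b::{banach, second_countable_topology}"
  assumes "continuous_on UNIV f" "compact K" "\<And>x. x \<notin> K \<Longrightarrow> f x = 0"
  shows "integrable M f"
proof -
  have "bounded (f ` K)"
    using assms by (intro compact_imp_bounded compact_continuous_image) (auto intro: continuous_on_subset)
  then obtain B where "\<And>x. x \<in> K \<Longrightarrow> norm (f x) \<le> B" unfolding bounded_iff by blast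
  then show ?thesis
    using assms emeasure_compact[OF assms(2)]
    by (intro integrableI_bounded_set[where A = K and B = B])
      (auto intro: compact_sets measurable_continuous)
qed

lemma norm_integral_le_compact:
  fixes f :: "'a \<Rightarrow> 'b::{banach, second_countable_topology}"
  assumes "continuous_on UNIV f" "compact K" "\<And>x. x \<notin> K \<Longrightarrow> f x = 0"
    and "\<And>x. x \<in> K \<Longrightarrow> norm (f x) \<le> e"
  shows "norm (\<integral>x. f x \<partial>M) \<le> e * measure M K"
proof -
  have int: "integrable M f" using integrable_bounded_compact[OF assms(1-3)] .
  have "norm (\<integral>x. f x \<partial>M) \<le> (\<integral>x. norm (f x) \<partial>M)" by (rule integral_norm_bound)
  also have "\<dots> \<le> (\<integral>x. e * indicator K x \<partial>M)"
  proof (rule integral_mono)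
    have "integrable M (indicator K :: 'a \<Rightarrow> real)"
      using emeasure_compact[OF assms(2)] compact_sets[OF assms(2)] by simp
    then show "integrable M (\<lambda>x. e * indicator K x)" by simp
    show "norm (f x) \<le> e * indicator K x" for x
      using assms(3,4)[of x] by (cases "x \<in> K") auto
  qed (use int in simp)
  also have "\<dots> = e * measure M K"
    using compact_sets[OF assms(2)] by simp
  finally show ?thesis .
qed

text \<open>Dominated convergence handles sequences, but the parameter space need not be first
  countable. Instead, compactness of K makes F t uniformly close to F t0 on K for t near t0. The
  support condition is imposed on T only, because in \<open>translation_continuous\<close> a common
  compact support exists only for translations near 0.\<close>

lemma continuous_on_integral:
  fixes F :: "'t::topological_space \<Rightarrow> 'a \<Rightarrow> 'b::{banach, second_countable_topology}"
  assumes F: "continuous_on UNIV (\<lambda>p. F (fst p) (snd p))" and T: "open T" and K: "compact K"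
    and supp: "\<And>t y. t \<in> T \<Longrightarrow> y \<notin> K \<Longrightarrow> F t y = 0"
  shows "continuous_on T (\<lambda>t. \<integral>y. F t y \<partial>M)"
proof -
  have Ft: "continuous_on UNIV (F t)" for t
    by (rule continuous_on_sections(1)[OF F])
  have "((\<lambda>t. \<integral>y. F t y \<partial>M) \<longlongrightarrow> (\<integral>y. F t0 y \<partial>M)) (at t0 within T)" if t0: "t0 \<in> T" for t0
  proof (rule tendstoI)
    fix e :: real assume e: "e > 0"
    \<comment> \<open>The summand 1 covers a null set K and provides the strict inequality at the
      end.\<close>
    define d where "d = e / (measure M K + 1)"
    have d: "d > 0" using e by (simp add: d_def add_nonneg_pos)
    obtain X where X: "t0 \<in> X" "open X" "\<forall>t\<in>X \<inter> UNIV. \<forall>y\<in>K. dist (F t y) (F t0 y) \<le> d"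
      using continuous_on_prod_compactE[of UNIV K "\<lambda>p. F (fst p) (snd p)" t0 d] K d
        continuous_on_subset[OF F] by auto
    have "dist (\<integral>y. F t y \<partial>M) (\<integral>y. F t0 y \<partial>M) < e" if t: "t \<in> X \<inter> T" for t
    proof -
      have int: "integrable M (F s)" if "s \<in> T" for s
        using integrable_bounded_compact[OF Ft K] supp[OF that] by blast
      have "(\<integral>y. F t y \<partial>M) - (\<integral>y. F t0 y \<partial>M) = (\<integral>y. F t y - F t0 y \<partial>M)"
        using int t t0 by simp
      moreover have "norm (\<integral>y. F t y - F t0 y \<partial>M) \<le> d * measure M K"
        using t t0 X(3) Ft supp
        by (intro norm_integral_le_compact[OF _ K]) (auto intro!: continuous_intros simp: dist_norm)
      moreover have "d * measure M K < d * (measure M K + 1)" using d by simp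
      moreover have "d * (measure M K + 1) = e"
        unfolding d_def by (simp add: add_nonneg_eq_0_iff)
      ultimately show ?thesis by (simp add: dist_norm)
    qed
    then show "eventually (\<lambda>t. dist (\<integral>y. F t y \<partial>M) (\<integral>y. F t0 y \<partial>M) < e) (at t0 within T)"
      unfolding eventually_at_topological using X by blast
  qed
  then show ?thesis unfolding continuous_on_def by blast
qed

text \<open>M may fail to be \<sigma>-finite, so it is replaced by its restrictions
  \<open>R K\<close> and \<open>R L\<close>, which are finite and leave all integrals unchanged.
  Joint measurability is \<open>borel_measurable_pair_compact_support\<close>.\<close>

lemma Fubini_compact_support:
  fixes F :: "'a \<Rightarrow> 'a \<Rightarrow> real"
  assumes F: "continuous_on UNIV (\<lambda>p. F (fst p) (snd p))" and K: "compact K" and L: "compact L"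
    and supp: "\<And>x y. x \<notin> K \<or> y \<notin> L \<Longrightarrow> F x y = 0"
  shows "(\<integral>y. (\<integral>x. F x y \<partial>M) \<partial>M) = (\<integral>x. (\<integral>y. F x y \<partial>M) \<partial>M)"
proof -
  define R where "R S = density M (\<lambda>x. ennreal (indicator S x))" for S
  have fin: "finite_measure (R S)" if "compact S" for S
  proof
    show "emeasure (R S) (space (R S)) \<noteq> \<infinity>"
      unfolding R_def using emeasure_compact[OF that] compact_sets[OF that]
      by (subst emeasure_density) (auto simp: ennreal_indicator)
  qed
  have integral_R: "(\<integral>x. f x \<partial>R S) = (\<integral>x. f x \<partial>M)"
    if "compact S" "f \<in> borel_measurable M" "\<And>x. x \<notin> S \<Longrightarrow> f x = 0" for S and f :: "'a \<Rightarrow> real"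
    unfolding R_def using compact_sets[OF that(1)] that(2,3)
    by (subst integral_density) (auto intro!: Bochner_Integration.integral_cong simp: indicator_def)
  have sets_R: "sets (R S) = sets borel" for S
    unfolding R_def by (simp add: sets_M)
  have meas_R: "f \<in> borel_measurable M \<Longrightarrow> f \<in> borel_measurable (R S)" for f :: "'a \<Rightarrow> real" and S
    by (simp add: R_def)
  interpret pair_sigma_finite "R K" "R L"
    using fin[OF K] fin[OF L] by (simp add: pair_sigma_finite_def finite_measure_def)
  interpret pair: finite_measure "R K \<Otimes>\<^sub>M R L"
    using fin[OF L] fin[OF K] by (rule finite_measure_pair_measure)
  have meas: "(\<lambda>p. F (fst p) (snd p)) \<in> borel_measurable (R K \<Otimes>\<^sub>M R L)"
    using borel_measurable_pair_compact_support[OF F K L supp]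
    by (subst measurable_cong_sets[OF sets_pair_measure_cong[OF sets_R sets_R] refl])
  have "bounded ((\<lambda>p. F (fst p) (snd p)) ` (K \<times> L))"
    using F K L by (intro compact_imp_bounded compact_continuous_image compact_Times)
      (auto intro: continuous_on_subset)
  then obtain B where B: "\<And>p. p \<in> K \<times> L \<Longrightarrow> norm (F (fst p) (snd p)) \<le> B"
    unfolding bounded_iff by blast
  have "norm (F (fst p) (snd p)) \<le> max B 0" for p
  proof (cases "p \<in> K \<times> L")
    case False
    then have "F (fst p) (snd p) = 0" using supp by (metis mem_Times_iff)
    then show ?thesis by simp
  qed (use B in \<open>auto simp: le_max_iff_disj\<close>)
  then have int: "integrable (R K \<Otimes>\<^sub>M R L) (\<lambda>p. F (fst p) (snd p))"
    by (intro pair.integrable_const_bound[OF _ meas, of "max B 0"]) (simp del: split_paired_All)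
  have Fx: "F x \<in> borel_measurable M" for x
    by (intro measurable_continuous continuous_on_sections(1)[OF F])
  have Fy: "(\<lambda>x. F x y) \<in> borel_measurable M" for y
    by (intro measurable_continuous continuous_on_sections(2)[OF F])
  have cx: "(\<lambda>x. \<integral>y. F x y \<partial>M) \<in> borel_measurable M"
    using supp by (intro measurable_continuous continuous_on_integral[OF F _ L]) auto
  have F': "continuous_on UNIV (\<lambda>p. F (snd p) (fst p))"
    by (rule continuous_on_sections(3)[OF F])
  have cy: "(\<lambda>y. \<integral>x. F x y \<partial>M) \<in> borel_measurable M"
    using supp by (intro measurable_continuous continuous_on_integral[OF F' _ K]) auto
  have "(\<integral>y. (\<integral>x. F x y \<partial>M) \<partial>M) = (\<integral>y. (\<integral>x. F x y \<partial>M) \<partial>R L)"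
    using supp cy by (intro integral_R[OF L, symmetric]) auto
  also have "\<dots> = (\<integral>y. (\<integral>x. F x y \<partial>R K) \<partial>R L)"
    using supp by (intro Bochner_Integration.integral_cong refl integral_R[OF K Fy, symmetric]) auto
  also have "\<dots> = (\<integral>x. (\<integral>y. F x y \<partial>R L) \<partial>R K)"
    using Fubini_integral[of F] int by (simp add: case_prod_beta')
  also have "\<dots> = (\<integral>x. (\<integral>y. F x y \<partial>M) \<partial>R K)"
    using supp by (intro Bochner_Integration.integral_cong refl integral_R[OF L Fx]) auto
  also have "\<dots> = (\<integral>x. (\<integral>y. F x y \<partial>M) \<partial>M)"
    using supp cx by (intro integral_R[OF K]) auto
  finally show ?thesis .
qed

subsection \<open>Translations and kernels in \<open>L\<^sup>1\<close>\<close>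


definition l1 :: "('a \<Rightarrow> real) \<Rightarrow> real" where
  "l1 f = (\<integral>x. \<bar>f x\<bar> \<partial>M)"

lemma integrable_Cc: "f \<in> Cc \<Longrightarrow> integrable M f"
  using CcD[of f] integrable_bounded_compact[OF Cc_continuous, of f] by auto

lemma l1_nonneg: "0 \<le> l1 f"
  unfolding l1_def by simp

lemma l1_translate: "f \<in> Cc \<Longrightarrow> l1 (\<lambda>x. f (a + x)) = l1 f"
  unfolding l1_def
  by (rule integral_translate) (intro measurable_continuous Cc_continuous Cc_abs)

lemma l1_scale: "l1 (\<lambda>x. a * f x) = \<bar>a\<bar> * l1 f"
  unfolding l1_def by (simp add: abs_mult)

lemma l1_triangle:
  assumes "f \<in> Cc" "g \<in> Cc"
  shows "l1 (\<lambda>x. f x + g x) \<le> l1 f + l1 g"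
proof -
  have "l1 (\<lambda>x. f x + g x) \<le> (\<integral>x. \<bar>f x\<bar> + \<bar>g x\<bar> \<partial>M)"
    unfolding l1_def by (intro integral_mono integrable_Cc Cc_abs Cc_add assms) auto
  also have "\<dots> = l1 f + l1 g"
    unfolding l1_def by (intro Bochner_Integration.integral_add integrable_Cc Cc_abs assms)
  finally show ?thesis .
qed

lemma l1_triangle_diff:
  assumes "f \<in> Cc" "g \<in> Cc" "h \<in> Cc"
  shows "l1 (\<lambda>x. f x - h x) \<le> l1 (\<lambda>x. f x - g x) + l1 (\<lambda>x. g x - h x)"
  using l1_triangle[OF Cc_minus[OF assms(1,2)] Cc_minus[OF assms(2,3)]] by simp

lemma l1_minus_commute: "l1 (\<lambda>x. f x - g x) = l1 (\<lambda>x. g x - f x)"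
  unfolding l1_def by (simp add: abs_minus_commute)

lemma kernel_Cc:
  assumes h: "h \<in> Cc" and D: "continuous_on UNIV (\<lambda>p. D (fst p) (snd p))"
    and K: "compact K" "\<And>y. y \<notin> K \<Longrightarrow> h y = 0"
    and L: "compact L" "\<And>y w. y \<in> K \<Longrightarrow> w \<notin> L \<Longrightarrow> D y w = 0"
  shows "(\<lambda>w. \<integral>y. h y * D y w \<partial>M) \<in> Cc"
proof (rule CcI[OF _ L(1)])
  have "continuous_on UNIV (\<lambda>p. h (snd p) * D (snd p) (fst p))"
    by (intro continuous_on_mult continuous_on_Cc[OF h] continuous_on_sections(3)[OF D] continuous_on_snd continuous_on_id)
  then show "continuous_on UNIV (\<lambda>w. \<integral>y. h y * D y w \<partial>M)"
    using K by (intro continuous_on_integral[OF _ _ K(1)]) auto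
  show "(\<integral>y. h y * D y w \<partial>M) = 0" if "w \<notin> L" for w
  proof -
    have "(\<lambda>y. h y * D y w) = (\<lambda>y. 0)"
      using K(2) L(2) that by (metis mult_eq_0_iff)
    then show ?thesis by simp
  qed
qed

text \<open>The absolute value moves inside and the two integrals are exchanged. The bound on D y is
  asked only where h y \<noteq> 0, so near invariance has to be known only for translations in the
  support of h.\<close>

lemma Minkowski_kernel:
  assumes h: "h \<in> Cc" and D: "continuous_on UNIV (\<lambda>p. D (fst p) (snd p))"
    and K: "compact K" "\<And>y. y \<notin> K \<Longrightarrow> h y = 0"
    and L: "compact L" "\<And>y w. y \<in> K \<Longrightarrow> w \<notin> L \<Longrightarrow> D y w = 0"
    and bound: "\<And>y. h y \<noteq> 0 \<Longrightarrow> l1 (D y) \<le> e"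
  shows "l1 (\<lambda>w. \<integral>y. h y * D y w \<partial>M) \<le> e * l1 h"
proof -
  define F where "F y w = \<bar>h y * D y w\<bar>" for y w
  have F: "continuous_on UNIV (\<lambda>p. F (fst p) (snd p))"
    unfolding F_def
    by (intro continuous_on_rabs continuous_on_mult continuous_on_Cc[OF h] D continuous_on_fst continuous_on_id)
  have supp: "F y w = 0" if "y \<notin> K \<or> w \<notin> L" for y w
    unfolding F_def using K(2)[of y] L(2)[of y w] that by (cases "y \<in> K") auto
  have "l1 (\<lambda>w. \<integral>y. h y * D y w \<partial>M) \<le> (\<integral>w. (\<integral>y. F y w \<partial>M) \<partial>M)"
    unfolding l1_def
  proof (rule integral_mono)
    show "integrable M (\<lambda>w. \<bar>\<integral>y. h y * D y w \<partial>M\<bar>)"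
      by (intro integrable_Cc Cc_abs kernel_Cc[OF assms(1-6)])
    show "integrable M (\<lambda>w. \<integral>y. F y w \<partial>M)"
    proof (rule integrable_bounded_compact[OF _ L(1)])
      show "continuous_on UNIV (\<lambda>w. \<integral>y. F y w \<partial>M)"
        using supp by (intro continuous_on_integral[OF continuous_on_sections(3)[OF F] _ K(1)]) auto
      show "(\<integral>y. F y w \<partial>M) = 0" if "w \<notin> L" for w using supp that by simp
    qed
    show "\<bar>\<integral>y. h y * D y w \<partial>M\<bar> \<le> (\<integral>y. F y w \<partial>M)" for w
      unfolding F_def using integral_norm_bound[of M "\<lambda>y. h y * D y w"] by simp
  qed
  also have "\<dots> = (\<integral>y. (\<integral>w. F y w \<partial>M) \<partial>M)"
    by (rule Fubini_compact_support[OF F K(1) L(1) supp])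
  also have "\<dots> \<le> (\<integral>y. e * \<bar>h y\<bar> \<partial>M)"
  proof (rule integral_mono)
    show "integrable M (\<lambda>y. \<integral>w. F y w \<partial>M)"
    proof (rule integrable_bounded_compact[OF _ K(1)])
      show "continuous_on UNIV (\<lambda>y. \<integral>w. F y w \<partial>M)"
        using supp by (intro continuous_on_integral[OF F _ L(1)]) auto
      show "(\<integral>w. F y w \<partial>M) = 0" if "y \<notin> K" for y using supp that by simp
    qed
    show "integrable M (\<lambda>y. e * \<bar>h y\<bar>)" by (intro integrable_Cc Cc_scale Cc_abs h)
    show "(\<integral>w. F y w \<partial>M) \<le> e * \<bar>h y\<bar>" for y
    proof (cases "h y = 0")
      case False
      have "(\<integral>w. F y w \<partial>M) = \<bar>h y\<bar> * l1 (D y)" unfolding F_def l1_def by (simp add: abs_mult)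
      then show ?thesis using mult_right_mono[OF bound[OF False], of "\<bar>h y\<bar>"] by (simp add: mult.commute)
    qed (simp add: F_def)
  qed
  also have "\<dots> = e * l1 h" unfolding l1_def by simp
  finally show ?thesis .
qed

text \<open>A common support is - s(K) + C, where C supports f. A general s covers translation by y,
  by - y, and by - y + u with (y, u) in a product.\<close>

lemma translate_support:
  fixes s :: "'t::topological_space \<Rightarrow> 'a" and f :: "'a \<Rightarrow> real"
  assumes f: "f \<in> Cc" and K: "compact K" and s: "continuous_on K s"
  obtains L where "compact L" "\<And>y w. y \<in> K \<Longrightarrow> w \<notin> L \<Longrightarrow> f (s y + w) = 0"
proof -
  obtain C where C: "compact C" "\<forall>x. x \<notin> C \<longrightarrow> f x = 0" using CcD[OF f] by blast
  define L where "L = (\<lambda>p. - s (fst p) + snd p) ` (K \<times> C)"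
  have "continuous_on (K \<times> C) (\<lambda>p. s (fst p))"
    by (rule continuous_on_compose2[OF s continuous_on_fst[OF continuous_on_id]]) auto
  then have "compact L" unfolding L_def using K C(1)
    by (intro compact_continuous_image compact_Times continuous_on_add continuous_on_minus
        continuous_on_snd continuous_on_id)
  moreover have "f (s y + w) = 0" if "y \<in> K" "w \<notin> L" for y w
  proof -
    have "s y + w \<notin> C"
    proof
      assume "s y + w \<in> C"
      then have "- s (fst (y, s y + w)) + snd (y, s y + w) \<in> L"
        unfolding L_def using that(1) by (intro imageI) auto
      with that(2) show False by simp
    qed
    then show ?thesis using C(2) by simp
  qed
  ultimately show ?thesis by (rule that)
qed

text \<open>The functions under the integral are left translates of f and share its
  \<open>l1\<close>, so \<open>Minkowski_kernel\<close> applies with that constant.\<close>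

lemma convolution_Cc:
  assumes h: "h \<in> Cc" and f: "f \<in> Cc" and s: "continuous_on UNIV s"
  shows "(\<lambda>w. \<integral>y. h y * f (s y + w) \<partial>M) \<in> Cc"
    and "l1 (\<lambda>w. \<integral>y. h y * f (s y + w) \<partial>M) \<le> l1 f * l1 h"
proof -
  obtain K where K: "compact K" "\<forall>y. y \<notin> K \<longrightarrow> h y = 0" using CcD[OF h] by blast
  obtain L where L: "compact L" "\<And>y w. y \<in> K \<Longrightarrow> w \<notin> L \<Longrightarrow> f (s y + w) = 0"
    using translate_support[OF f K(1) continuous_on_subset[OF s subset_UNIV]] by metis
  have D: "continuous_on UNIV (\<lambda>p. f (s (fst p) + snd p))"
    by (intro continuous_on_Cc[OF f] continuous_on_add continuous_on_snd continuous_on_id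
        continuous_on_compose2[OF s] continuous_on_fst) auto
  show "(\<lambda>w. \<integral>y. h y * f (s y + w) \<partial>M) \<in> Cc"
    using K(2) by (intro kernel_Cc[OF h D K(1) _ L]) auto
  show "l1 (\<lambda>w. \<integral>y. h y * f (s y + w) \<partial>M) \<le> l1 f * l1 h"
    using K(2) by (intro Minkowski_kernel[OF h D K(1) _ L]) (auto simp: l1_translate[OF f])
qed

section \<open>Small translations, full support and bump functions\<close>

lemma compact_neighbourhood:
  obtains T V where "open T" "compact V" "(0::'a) \<in> T" "T \<subseteq> V"
proof -
  have "\<exists>u v. openin (top_of_set UNIV) u \<and> compact v \<and> (0::'a) \<in> u \<and> u \<subseteq> v \<and> v \<subseteq> UNIV"
    using locally_compact unfolding locally_def by (metis UNIV_I openin_subtopology_self subtopology_UNIV)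
  then obtain u v where "open u" "compact v" "(0::'a) \<in> u" "u \<subseteq> v" by auto
  then show ?thesis by (rule that)
qed

text \<open>For x in T, which lies in a compact set, the integrands have a common compact support.
  So the distance is a continuous function of x on T, with value 0 at x = 0.\<close>

lemma translation_continuous:
  assumes k: "k \<in> Cc" and e: "e > 0"
  obtains U where "open U" "0 \<in> U" "\<And>x. x \<in> U \<Longrightarrow> l1 (\<lambda>y. k (x + y) - k y) < e"
proof -
  obtain T V where TV: "open T" "compact V" "(0::'a) \<in> T" "T \<subseteq> V" by (rule compact_neighbourhood)
  obtain L where L: "compact L" "\<And>y w. y \<in> V \<Longrightarrow> w \<notin> L \<Longrightarrow> k (y + w) = 0"
    using translate_support[OF k TV(2) continuous_on_id] by metis
  obtain K where K: "compact K" "\<forall>y. y \<notin> K \<longrightarrow> k y = 0" using CcD[OF k] by blast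
  define g where "g x = l1 (\<lambda>y. k (x + y) - k y)" for x
  have "continuous_on T g"
    unfolding g_def l1_def
  proof (rule continuous_on_integral[OF _ TV(1)])
    show "continuous_on UNIV (\<lambda>p. \<bar>k (fst p + snd p) - k (snd p)\<bar>)"
      by (intro continuous_on_rabs continuous_on_diff continuous_on_Cc[OF k] continuous_on_add
          continuous_on_fst continuous_on_snd continuous_on_id)
    show "compact (L \<union> K)" using L(1) K(1) by (rule compact_Un)
    show "\<bar>k (t + y) - k y\<bar> = 0" if "t \<in> T" "y \<notin> L \<union> K" for t y
      using L(2)[of t y] K(2) TV(4) that by auto
  qed
  then have "open (T \<inter> g -` {..<e})" by (rule continuous_open_preimage[OF _ TV(1) open_lessThan])
  moreover have "0 \<in> T \<inter> g -` {..<e}" using TV(3) e by (simp add: g_def l1_def)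
  ultimately show ?thesis using that[of "T \<inter> g -` {..<e}"] by (simp add: g_def)
qed

text \<open>Substitute b + y for y. Closeness of two left translates is thus governed by a - b, not
  by - b + a.\<close>

lemma l1_translate_diff:
  assumes k: "k \<in> Cc"
  shows "l1 (\<lambda>y. k (a + y) - k (b + y)) = l1 (\<lambda>y. k (a - b + y) - k y)"
  using l1_translate[OF Cc_minus[OF Cc_translate[OF k, of "a - b"] k], of b]
  by (simp add: add.assoc[symmetric])

text \<open>Translates of a null open set are null, and finitely many of them cover any compact set.
  Inner regularity on UNIV would then make the whole measure zero.\<close>

lemma emeasure_open_pos:
  assumes "open U" "U \<noteq> {}"
  shows "emeasure M U > 0"
proof (rule ccontr)
  assume "\<not> emeasure M U > 0"
  then have U0: "emeasure M U = 0" by simp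
  obtain u where u: "u \<in> U" using assms(2) by blast
  define N where "N x = (\<lambda>y. u - x + y) -` U" for x
  have opN: "open (N x)" for x
    unfolding N_def using assms(1)
    by (intro open_vimage continuous_on_add continuous_on_const continuous_on_id)
  have N0: "emeasure M (N x) = 0" for x
  proof -
    have "emeasure M (N x) = emeasure (distr M M (\<lambda>y. u - x + y)) U"
      unfolding N_def using assms(1) by (subst emeasure_distr[OF measurable_translate]) (auto simp: sets_M)
    then show ?thesis using U0 by (simp add: distr_translate)
  qed
  have "emeasure M K = 0" if K: "compact K" for K
  proof -
    have "K \<subseteq> (\<Union>x\<in>K. N x)" using u by (auto simp: N_def)
    then obtain D where D: "D \<subseteq> K" "finite D" "K \<subseteq> (\<Union>x\<in>D. N x)"
      by (rule compactE_image[OF K opN])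
    have "emeasure M K \<le> emeasure M (\<Union>x\<in>D. N x)"
      using D opN by (intro emeasure_mono) (auto simp: sets_M)
    also have "\<dots> \<le> (\<Sum>x\<in>D. emeasure M (N x))"
      using D opN by (intro emeasure_subadditive_finite) (auto simp: sets_M)
    also have "\<dots> = 0" using N0 by simp
    finally show ?thesis by simp
  qed
  then have "(SUP K\<in>{K. compact K \<and> K \<subseteq> UNIV}. emeasure M K) = 0"
    using compact_empty by (intro SUP_eq_const) auto
  moreover have "emeasure M UNIV = (SUP K\<in>{K. compact K \<and> K \<subseteq> UNIV}. emeasure M K)"
    using haar_unfolded[THEN conjunct2, THEN conjunct2, THEN conjunct2, THEN conjunct2, THEN conjunct2]
      open_UNIV by blast
  ultimately show False using haar_unfolded[THEN conjunct2, THEN conjunct1] by simp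
qed

text \<open>A locally compact Hausdorff space is completely regular, which gives a continuous
  function separating 0 from the complement of U \<inter> T. Intersecting with T makes the support
  compact, and \<open>emeasure_open_pos\<close> makes the integral positive, so that it can be
  normalized.\<close>

lemma exists_bump:
  assumes U: "open U" "0 \<in> U"
  obtains k where "k \<in> Cc" "\<And>x. 0 \<le> k x" "(\<integral>x. k x \<partial>M) = 1" "\<And>x. k x \<noteq> 0 \<Longrightarrow> x \<in> U"
proof -
  obtain T V where TV: "open T" "compact V" "(0::'a) \<in> T" "T \<subseteq> V" by (rule compact_neighbourhood)
  have "locally_compact_space (euclidean :: 'a topology)"
    unfolding locally_compact_space_def
  proof
    fix x :: 'a
    have "open ((\<lambda>y. - x + y) -` T)" using TV(1)
      by (intro open_vimage continuous_on_add continuous_on_const continuous_on_id)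
    moreover have "compact ((\<lambda>y. x + y) ` V)" using TV(2)
      by (intro compact_continuous_image continuous_on_add continuous_on_const continuous_on_id)
    moreover have "(\<lambda>y. - x + y) -` T \<subseteq> (\<lambda>y. x + y) ` V"
    proof
      fix y assume "y \<in> (\<lambda>y. - x + y) -` T"
      then show "y \<in> (\<lambda>y. x + y) ` V" using TV(4) by (intro image_eqI[where x = "- x + y"]) auto
    qed
    ultimately show "\<exists>U K. openin euclidean U \<and> compactin euclidean K \<and> x \<in> U \<and> U \<subseteq> K"
      using TV(3) by (intro exI[of _ "(\<lambda>y. - x + y) -` T"] exI[of _ "(\<lambda>y. x + y) ` V"]) auto
  qed
  moreover have "Hausdorff_space (euclidean :: 'a topology)"
    unfolding Hausdorff_space_def disjnt_def using hausdorff by auto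
  ultimately have "completely_regular_space (euclidean :: 'a topology)"
    using locally_compact_regular_imp_completely_regular_space by blast
  moreover have "open (U \<inter> T)" "0 \<in> U \<inter> T" using U TV by auto
  ultimately have "\<exists>f. continuous_map euclidean euclideanreal f \<and> f (0::'a) = 0 \<and>
      f ` (topspace euclidean - U \<inter> T) \<subseteq> {1}"
    unfolding completely_regular_space_alt' by (metis open_openin)
  then obtain f :: "'a \<Rightarrow> real" where f: "continuous_on UNIV f" "f 0 = 0" "\<And>x. x \<notin> U \<inter> T \<Longrightarrow> f x = 1"
    by (auto simp: image_subset_iff)
  define g where "g x = max 0 (1 - f x)" for x
  have g: "g \<in> Cc"
  proof (rule CcI[OF _ TV(2)])
    show "continuous_on UNIV g" unfolding g_def using f(1)
      by (intro continuous_on_max continuous_on_diff continuous_on_const)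
    show "g x = 0" if "x \<notin> V" for x
    proof -
      have "x \<notin> U \<inter> T" using TV(4) that by auto
      then show ?thesis using f(3) by (simp add: g_def)
    qed
  qed
  have g0: "0 \<le> g x" for x by (simp add: g_def)
  have gU: "x \<in> U" if "g x \<noteq> 0" for x
  proof (rule ccontr)
    assume "x \<notin> U"
    then show False using f(3)[of x] that by (simp add: g_def)
  qed
  define I where "I = (\<integral>x. g x \<partial>M)"
  have "I \<noteq> 0"
  proof
    assume "I = 0"
    then have "AE x in M. g x = 0"
      unfolding I_def using integral_nonneg_eq_0_iff_AE[OF integrable_Cc[OF g]] g0 by simp
    then have "emeasure M {x. g x \<noteq> 0} = 0"
      using AE_iff_measurable[of "{x. g x \<noteq> 0}" M "\<lambda>x. g x = 0"] open_Collect_neq[OF Cc_continuous[OF g]]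
      by (simp add: sets_M)
    moreover have "open {x. g x \<noteq> 0}"
      by (intro open_Collect_neq Cc_continuous[OF g] continuous_on_const)
    moreover have "{x. g x \<noteq> 0} \<noteq> {}" using f(2) by (auto simp: g_def intro!: exI[of _ 0])
    ultimately show False using emeasure_open_pos by fastforce
  qed
  moreover have "I \<ge> 0" unfolding I_def using g0 by simp
  ultimately have I: "I > 0" by simp
  show ?thesis
  proof (rule that[of "\<lambda>x. inverse I * g x"])
    show "(\<lambda>x. inverse I * g x) \<in> Cc" by (rule Cc_scale[OF g])
    show "(\<integral>x. inverse I * g x \<partial>M) = 1" using I unfolding I_def by simp
  qed (use I g0 gU in auto)
qed

end

subsection \<open>Amenability and almost invariant densities\<close>

lemma linear_functional_onD:
  assumes "linear_functional_on W l"
  shows "u \<in> W \<Longrightarrow> v \<in> W \<Longrightarrow> l (\<lambda>x. u x + v x) = l u + l v"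
    "v \<in> W \<Longrightarrow> l (\<lambda>x. a * v x) = a * l v"
  using assms by (auto simp: linear_functional_on_def)

lemma linear_functional_on_sum:
  assumes W: "function_space W" and l: "linear_functional_on W l"
    and "finite A" "\<And>a. a \<in> A \<Longrightarrow> v a \<in> W"
  shows "(\<lambda>x. \<Sum>a\<in>A. v a x) \<in> W \<and> l (\<lambda>x. \<Sum>a\<in>A. v a x) = (\<Sum>a\<in>A. l (v a))"
  using assms(3,4)
proof (induction A rule: finite_induct)
  case empty
  have "l (\<lambda>x. 0 * (0::real)) = 0 * l (\<lambda>_. 0)"
    by (rule linear_functional_onD(2)[OF l function_spaceD(1)[OF W]])
  then show ?case using function_spaceD(1)[OF W] by simp
next
  case (insert a A)
  have *: "v a \<in> W" "(\<lambda>x. \<Sum>a\<in>A. v a x) \<in> W" using insert by auto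
  have "l (\<lambda>x. v a x + (\<Sum>a\<in>A. v a x)) = l (v a) + l (\<lambda>x. \<Sum>a\<in>A. v a x)"
    by (rule linear_functional_onD(1)[OF l *])
  then show ?case using insert function_spaceD(2)[OF W *] by simp
qed

lemma linear_functional_on_diff:
  assumes W: "function_space W" and l: "linear_functional_on W l" and "u \<in> W" "v \<in> W"
  shows "l (\<lambda>x. u x - v x) = l u - l v"
proof -
  have "l (\<lambda>x. u x + (-1) * v x) = l u + l (\<lambda>x. (-1) * v x)"
    by (rule linear_functional_onD(1)[OF l assms(3) function_spaceD(3)[OF W assms(4)]])
  moreover have "l (\<lambda>x. (-1) * v x) = (-1) * l v"
    by (rule linear_functional_onD(2)[OF l assms(4)])
  ultimately show ?thesis by simp
qed

context haar_group
begin

definition prob_density :: "('a \<Rightarrow> real) \<Rightarrow> bool" where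
  "prob_density f \<longleftrightarrow> f \<in> Cc \<and> (\<forall>x. 0 \<le> f x) \<and> (\<integral>x. f x \<partial>M) = 1"

lemma prob_densityD:
  assumes "prob_density f"
  shows "f \<in> Cc" "0 \<le> f x" "(\<integral>x. f x \<partial>M) = 1" "l1 f = 1"
  using assms by (auto simp: prob_density_def l1_def)

text \<open>An element of a finite power of L^1, with coordinates indexed by S, uncurried to a
  single function on pairs. In this form the Hahn-Banach theorem for spaces of real functions
  applies to it.\<close>

definition difference :: "'a set \<Rightarrow> ('a \<Rightarrow> real) \<Rightarrow> 'a \<times> 'a \<Rightarrow> real" where
  "difference S \<theta> = (\<lambda>(s, y). if s \<in> S then \<theta> (s + y) - \<theta> y else 0)"

definition Cc_family :: "('a \<times> 'a \<Rightarrow> real) set" where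
  "Cc_family = {v. \<forall>s. (\<lambda>y. v (s, y)) \<in> Cc}"

lemma sum_l1_triangle:
  assumes "\<And>s. s \<in> S \<Longrightarrow> u s \<in> Cc" "\<And>s. s \<in> S \<Longrightarrow> v s \<in> Cc"
  shows "(\<Sum>s\<in>S. l1 (\<lambda>y. u s y + v s y)) \<le> (\<Sum>s\<in>S. l1 (u s)) + (\<Sum>s\<in>S. l1 (v s))"
  unfolding sum.distrib[symmetric] by (intro sum_mono l1_triangle assms)

text \<open>If no density is nearly invariant, then the convex cone of the vectors \<open>difference S \<theta>\<close> stays
  away from \<open>0\<close>, and separation provides a functional.\<close>

lemma Reiter_separation:
  fixes S :: "'a set"
  assumes e: "e > 0" and S: "finite S"
    and no: "\<And>\<phi>. prob_density \<phi> \<Longrightarrow> \<exists>s\<in>S. l1 (\<lambda>y. \<phi> (s + y) - \<phi> y) > e"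
  obtains l where "function_space Cc_family" "linear_functional_on Cc_family l"
    "\<forall>v\<in>Cc_family. \<bar>l v\<bar> \<le> (\<Sum>s\<in>S. l1 (\<lambda>y. v (s, y)))"
    "\<forall>\<theta>. prob_density \<theta> \<longrightarrow> l (difference S \<theta>) \<ge> e"
proof -
  define p where "p v = (\<Sum>s\<in>S. l1 (\<lambda>y. v (s, y)))" for v :: "'a \<times> 'a \<Rightarrow> real"
  define P where "P = {\<theta> :: 'a \<Rightarrow> real. \<theta> \<in> Cc \<and> (\<forall>x. 0 \<le> \<theta> x)}"
  define I where "I \<theta> = (\<integral>x. \<theta> x \<partial>M)" for \<theta> :: "'a \<Rightarrow> real"
  have zero: "(\<lambda>_. 0) \<in> Cc" by (rule CcI[where K = "{}"]) auto
  have W: "function_space Cc_family"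
    unfolding function_space_def Cc_family_def using zero by (auto intro!: Cc_add Cc_scale)
  have dW: "difference S \<theta> \<in> Cc_family" if "\<theta> \<in> P" for \<theta>
  proof -
    have \<theta>: "\<theta> \<in> Cc" using that by (simp add: P_def)
    have "(\<lambda>y. difference S \<theta> (s, y)) \<in> Cc" for s
      using Cc_minus[OF Cc_translate[OF \<theta>, of s] \<theta>] zero by (cases "s \<in> S") (simp_all add: difference_def)
    then show ?thesis by (simp add: Cc_family_def)
  qed
  have p_add: "p (\<lambda>x. u x + v x) \<le> p u + p v" if "u \<in> Cc_family" "v \<in> Cc_family" for u v
    unfolding p_def using that by (intro sum_l1_triangle) (auto simp: Cc_family_def)
  have p_scale: "p (\<lambda>x. a * v x) = \<bar>a\<bar> * p v" for a v
    unfolding p_def by (simp add: l1_scale sum_distrib_left)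
  have d_add: "difference S (\<lambda>x. \<theta> x + \<eta> x) = (\<lambda>z. difference S \<theta> z + difference S \<eta> z)" for \<theta> \<eta>
    by (auto simp: difference_def)
  have d_scale: "difference S (\<lambda>x. a * \<theta> x) = (\<lambda>z. a * difference S \<theta> z)" for a \<theta>
    by (auto simp: difference_def algebra_simps)
  have P_add: "(\<lambda>x. \<theta> x + \<eta> x) \<in> P" if "\<theta> \<in> P" "\<eta> \<in> P" for \<theta> \<eta>
    using that by (auto simp: P_def intro!: Cc_add)
  have P_scale: "(\<lambda>x. a * \<theta> x) \<in> P" if "\<theta> \<in> P" "a \<ge> 0" for a \<theta>
    using that by (auto simp: P_def intro!: Cc_scale)
  have I_add: "I (\<lambda>x. \<theta> x + \<eta> x) = I \<theta> + I \<eta>" if "\<theta> \<in> P" "\<eta> \<in> P" for \<theta> \<eta>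
    using that integrable_Cc by (simp add: I_def P_def)
  have I_scale: "I (\<lambda>x. a * \<theta> x) = a * I \<theta>" for a \<theta>
    by (simp add: I_def)
  \<comment> \<open>Normalizing \<theta> to integral 1 turns the assumption \<open>no\<close> into a
    homogeneous estimate on the whole cone P.\<close>
  have gap: "p (difference S \<theta>) \<ge> e * I \<theta>" if \<theta>: "\<theta> \<in> P" for \<theta>
  proof (cases "I \<theta> = 0")
    case True
    then show ?thesis by (simp add: p_def l1_nonneg sum_nonneg)
  next
    case False
    moreover have "I \<theta> \<ge> 0" unfolding I_def using \<theta> by (simp add: P_def)
    ultimately have I: "I \<theta> > 0" by simp
    define \<phi> where "\<phi> = (\<lambda>x. inverse (I \<theta>) * \<theta> x)"
    have "prob_density \<phi>"
      using P_scale[OF \<theta>, of "inverse (I \<theta>)"] I_scale[of "inverse (I \<theta>)" \<theta>] I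
      unfolding prob_density_def \<phi>_def by (simp add: P_def I_def)
    then obtain s where s: "s \<in> S" "l1 (\<lambda>y. \<phi> (s + y) - \<phi> y) > e" using no by blast
    have "l1 (\<lambda>y. difference S \<phi> (s, y)) \<le> p (difference S \<phi>)"
      unfolding p_def using s(1) S l1_nonneg by (intro member_le_sum) auto
    then have "e < p (difference S \<phi>)" using s by (simp add: difference_def)
    also have "\<dots> = inverse (I \<theta>) * p (difference S \<theta>)"
      unfolding \<phi>_def d_scale p_scale using I by simp
    finally show ?thesis using I by (simp add: field_simps)
  qed
  \<comment> \<open>The two demands on l, to be at most p and to be at least e * I \<theta> at
    \<open>difference S \<theta>\<close>, are merged into one sublinear bound q. The choice \<theta>
    = 0 gives q \<le> p, and \<open>gap\<close> keeps the infimum above - p v.\<close>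
  define r where "r v \<theta> = p (\<lambda>z. v z + difference S \<theta> z) - e * I \<theta>" for v \<theta>
  define q where "q v = (INF \<theta>\<in>P. r v \<theta>)" for v
  have P0: "(\<lambda>_. 0) \<in> P" using zero by (simp add: P_def)
  have lower: "- p v \<le> r v \<theta>" if v: "v \<in> Cc_family" and \<theta>: "\<theta> \<in> P" for v \<theta>
  proof -
    have "p (\<lambda>z. (v z + difference S \<theta> z) + (-1) * v z) \<le> p (\<lambda>z. v z + difference S \<theta> z) + p (\<lambda>z. (-1) * v z)"
      by (rule p_add[OF function_spaceD(2)[OF W v dW[OF \<theta>]] function_spaceD(3)[OF W v]])
    then show ?thesis using gap[OF \<theta>] p_scale[of "-1" v] by (simp add: r_def)
  qed
  have bdd: "bdd_below (r v ` P)" if "v \<in> Cc_family" for v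
    using lower[OF that] by (intro bdd_belowI2[where m = "- p v"]) auto
  have le: "q v \<le> r v \<theta>" if "v \<in> Cc_family" "\<theta> \<in> P" for v \<theta>
    unfolding q_def using bdd[OF that(1)] that(2) by (rule cINF_lower)
  have ne: "P \<noteq> {}" using P0 by auto
  have q: "sublinear_on Cc_family q"
    unfolding sublinear_on_def
  proof (intro conjI ballI allI impI)
    fix u v assume u: "u \<in> Cc_family" and v: "v \<in> Cc_family"
    have *: "q (\<lambda>z. u z + v z) \<le> r u \<theta> + r v \<eta>" if "\<theta> \<in> P" "\<eta> \<in> P" for \<theta> \<eta>
    proof -
      have "q (\<lambda>z. u z + v z) \<le> r (\<lambda>z. u z + v z) (\<lambda>x. \<theta> x + \<eta> x)"
        by (rule le[OF function_spaceD(2)[OF W u v] P_add[OF that]])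
      also have "\<dots> = p (\<lambda>z. (u z + difference S \<theta> z) + (v z + difference S \<eta> z)) - e * (I \<theta> + I \<eta>)"
        unfolding r_def d_add I_add[OF that] by (simp add: algebra_simps)
      also have "\<dots> \<le> (p (\<lambda>z. u z + difference S \<theta> z) + p (\<lambda>z. v z + difference S \<eta> z)) - e * (I \<theta> + I \<eta>)"
        using p_add[OF function_spaceD(2)[OF W u dW[OF that(1)]] function_spaceD(2)[OF W v dW[OF that(2)]]]
        by simp
      finally show ?thesis by (simp add: r_def algebra_simps)
    qed
    have "q (\<lambda>z. u z + v z) - r u \<theta> \<le> q v" if "\<theta> \<in> P" for \<theta>
      unfolding q_def[of v] using *[OF that] by (intro cINF_greatest[OF ne]) (auto simp: algebra_simps)
    then have "q (\<lambda>z. u z + v z) - q v \<le> r u \<theta>" if "\<theta> \<in> P" for \<theta>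
      using that by (fastforce simp: algebra_simps)
    then have "q (\<lambda>z. u z + v z) - q v \<le> q u"
      unfolding q_def[of u] by (intro cINF_greatest[OF ne]) auto
    then show "q (\<lambda>z. u z + v z) \<le> q u + q v" by simp
  next
    fix a :: real and v assume a: "a > 0" and v: "v \<in> Cc_family"
    have "q (\<lambda>z. a * v z) / a \<le> r v \<theta>" if "\<theta> \<in> P" for \<theta>
    proof -
      have "q (\<lambda>z. a * v z) \<le> r (\<lambda>z. a * v z) (\<lambda>x. a * \<theta> x)"
        using le[OF function_spaceD(3)[OF W v] P_scale[OF that]] a by simp
      also have "\<dots> = p (\<lambda>z. a * (v z + difference S \<theta> z)) - e * (a * I \<theta>)"
        unfolding r_def d_scale I_scale by (simp add: algebra_simps)
      also have "\<dots> = a * r v \<theta>"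
        unfolding p_scale r_def using a by (simp add: algebra_simps)
      finally show ?thesis using a by (simp add: field_simps)
    qed
    then have "q (\<lambda>z. a * v z) / a \<le> q v"
      unfolding q_def[of v] by (intro cINF_greatest[OF ne]) auto
    then show "q (\<lambda>z. a * v z) \<le> a * q v" using a by (simp add: field_simps)
  qed
  obtain l where l: "linear_functional_on Cc_family l" and lq: "\<And>v. v \<in> Cc_family \<Longrightarrow> l v \<le> q v"
    using Hahn_Banach_dominated[OF W q] by metis
  have scale: "l (\<lambda>x. a * v x) = a * l v" if "v \<in> Cc_family" for a v
    by (rule linear_functional_onD(2)[OF l that])
  have lp: "l v \<le> p v" if v: "v \<in> Cc_family" for v
  proof -
    have "difference S (\<lambda>_. 0) = (\<lambda>_. 0)" by (auto simp: difference_def)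
    then have "r v (\<lambda>_. 0) = p v" by (simp add: r_def I_def)
    then show ?thesis using lq[OF v] le[OF v P0] by simp
  qed
  show ?thesis
  proof (rule that[OF W l]; intro ballI allI impI)
    fix v assume v: "v \<in> Cc_family"
    have "l (\<lambda>x. (-1) * v x) \<le> p (\<lambda>x. (-1) * v x)" by (rule lp[OF function_spaceD(3)[OF W v]])
    then have "- l v \<le> p v" using scale[OF v, of "-1"] p_scale[of "-1" v] by simp
    then show "\<bar>l v\<bar> \<le> (\<Sum>s\<in>S. l1 (\<lambda>y. v (s, y)))" using lp[OF v] by (simp add: p_def abs_le_iff)
  next
    fix \<theta> assume \<theta>: "prob_density \<theta>"
    then have P: "\<theta> \<in> P" "I \<theta> = 1" by (auto simp: prob_density_def P_def I_def)
    \<comment> \<open>At this v the competitor \<theta> itself cancels the difference vector and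
      leaves - e.\<close>
    define v where "v = (\<lambda>x. (-1) * difference S \<theta> x)"
    have v: "v \<in> Cc_family" unfolding v_def by (rule function_spaceD(3)[OF W dW[OF P(1)]])
    have "l v \<le> r v \<theta>" using lq[OF v] le[OF v P(1)] by simp
    also have "\<dots> = - e" by (simp add: r_def v_def p_def l1_def P(2))
    finally show "l (difference S \<theta>) \<ge> e" using scale[OF dW[OF P(1)], of "-1"] by (simp add: v_def)
  qed
qed

lemma ess_bounded_of_real:
  assumes "continuous_on UNIV f" "\<And>x. \<bar>f x\<bar> \<le> B"
  shows "(\<lambda>x. complex_of_real (f x)) \<in> ess_bounded M"
proof -
  have "(\<lambda>x. complex_of_real (f x)) \<in> borel_measurable M"
    using measurable_continuous[OF assms(1)] by simp
  moreover have "AE x in M. norm (complex_of_real (f x)) \<le> B" using assms(2) by simp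
  ultimately show ?thesis unfolding ess_bounded_def by blast
qed

text \<open>A left-invariant mean annihilates each difference f s (s + x) - f s x, while a function
  bounded below by e > 0 cannot have mean 0.\<close>

lemma amenable_no_positive_coboundary:
  fixes f :: "'a \<Rightarrow> 'a \<Rightarrow> real"
  assumes am: "amenable M" and S: "finite S" and e: "e > 0"
    and f: "\<And>s. continuous_on UNIV (f s)" "\<And>s x. \<bar>f s x\<bar> \<le> B"
  shows "\<exists>x. (\<Sum>s\<in>S. f s (s + x) - f s x) < e"
proof (rule ccontr)
  assume "\<not> ?thesis"
  then have ge: "e \<le> (\<Sum>s\<in>S. f s (s + x) - f s x)" for x by (simp add: not_less)
  obtain m :: "('a \<Rightarrow> complex) \<Rightarrow> complex" where m:
    "\<forall>f\<in>ess_bounded M. \<forall>g\<in>ess_bounded M. m (\<lambda>x. f x + g x) = m f + m g"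
    "\<forall>c. \<forall>f\<in>ess_bounded M. m (\<lambda>x. c * f x) = c * m f"
    "\<forall>f\<in>ess_bounded M. \<forall>C. (AE x in M. norm (f x) \<le> C) \<longrightarrow> norm (m f) \<le> C"
    "m (\<lambda>x. 1) = 1" "\<forall>a. \<forall>f\<in>ess_bounded M. m (\<lambda>x. f (a + x)) = m f"
    using am unfolding amenable_def by auto
  define D where "D s x = f s (s + x) - f s x" for s x
  have fc: "continuous_on UNIV (\<lambda>x. f s (s + x))" for s
    by (rule continuous_on_compose2[OF f(1)]) (auto intro!: continuous_intros)
  have Dc: "continuous_on UNIV (D s)" for s
    unfolding D_def by (intro continuous_on_diff fc f(1))
  have Db: "\<bar>D s x\<bar> \<le> 2 * B" for s x
    using f(2)[of s "s + x"] f(2)[of s x] by (simp add: D_def abs_le_iff)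
  have mD: "m (\<lambda>x. complex_of_real (D s x)) = 0" for s
  proof -
    have 1: "(\<lambda>x. complex_of_real (f s x)) \<in> ess_bounded M" by (rule ess_bounded_of_real[OF f])
    have 2: "(\<lambda>x. complex_of_real (f s (s + x))) \<in> ess_bounded M"
      by (rule ess_bounded_of_real[OF fc f(2)])
    have 3: "(\<lambda>x. (-1) * complex_of_real (f s x)) \<in> ess_bounded M"
      using ess_bounded_of_real[of "\<lambda>x. - f s x" B] f by (simp add: continuous_on_minus)
    have "m (\<lambda>x. complex_of_real (D s x)) = m (\<lambda>x. complex_of_real (f s (s + x)) + (-1) * complex_of_real (f s x))"
      by (simp add: D_def)
    also have "\<dots> = m (\<lambda>x. complex_of_real (f s (s + x))) + m (\<lambda>x. (-1) * complex_of_real (f s x))"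
      by (rule m(1)[rule_format, OF 2 3])
    also have "\<dots> = m (\<lambda>x. complex_of_real (f s x)) + (-1) * m (\<lambda>x. complex_of_real (f s x))"
      using m(5)[rule_format, OF 1, of s] m(2)[rule_format, OF 1, of "-1"] by simp
    finally show ?thesis by simp
  qed
  have sum: "continuous_on UNIV (\<lambda>x. \<Sum>s\<in>A. D s x)" "\<bar>\<Sum>s\<in>A. D s x\<bar> \<le> card A * (2 * B)" for A x
    using order_trans[OF sum_abs sum_bounded_above[OF Db]] by (auto intro: continuous_on_sum Dc)
  have "m (\<lambda>x. complex_of_real (\<Sum>s\<in>S. D s x)) = 0"
    using S
  proof (induction S rule: finite_induct)
    case empty
    have "m (\<lambda>x. 0 * complex_of_real (D undefined x)) = 0 * m (\<lambda>x. complex_of_real (D undefined x))"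
      by (rule m(2)[rule_format, OF ess_bounded_of_real[OF Dc Db]])
    then show ?case by simp
  next
    case (insert s A)
    have "m (\<lambda>x. complex_of_real (D s x) + complex_of_real (\<Sum>s\<in>A. D s x)) =
        m (\<lambda>x. complex_of_real (D s x)) + m (\<lambda>x. complex_of_real (\<Sum>s\<in>A. D s x))"
      by (rule m(1)[rule_format, OF ess_bounded_of_real[OF Dc Db] ess_bounded_of_real[OF sum]])
    then show ?case using insert mD by simp
  qed
  \<comment> \<open>\<open>amenable\<close> states a norm bound rather than positivity. The sum lies
    between e and R, so subtracting R leaves a function of norm at most R - e whose mean would be -
    R.\<close>
  define R where "R = card S * (2 * B)"
  have one: "(\<lambda>x. 1) \<in> ess_bounded M" using ess_bounded_of_real[of "\<lambda>x. 1" 1] by simp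
  have R: "(\<lambda>x. - complex_of_real R) \<in> ess_bounded M"
    using ess_bounded_of_real[of "\<lambda>x. - R" "\<bar>R\<bar>"] by simp
  have "m (\<lambda>x. - complex_of_real R * 1) = - complex_of_real R * m (\<lambda>x. 1)" by (rule m(2)[rule_format, OF one])
  then have mR: "m (\<lambda>x. - complex_of_real R) = - complex_of_real R" using m(4) by simp
  have "m (\<lambda>x. complex_of_real (\<Sum>s\<in>S. D s x) + - complex_of_real R) = - complex_of_real R"
    using m(1)[rule_format, OF ess_bounded_of_real[OF sum] R, of S] mR
      \<open>m (\<lambda>x. complex_of_real (\<Sum>s\<in>S. D s x)) = 0\<close> by (simp del: of_real_sum)
  moreover have "norm (m (\<lambda>x. complex_of_real (\<Sum>s\<in>S. D s x) + - complex_of_real R)) \<le> R - e"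
  proof -
    have "(\<lambda>x. complex_of_real ((\<Sum>s\<in>S. D s x) - R)) \<in> ess_bounded M"
    proof (rule ess_bounded_of_real)
      show "continuous_on UNIV (\<lambda>x. (\<Sum>s\<in>S. D s x) - R)"
        by (intro continuous_on_diff sum continuous_on_const)
      show "\<bar>(\<Sum>s\<in>S. D s x) - R\<bar> \<le> R + \<bar>R\<bar>" for x
        using sum(2)[where A = S and x = x] unfolding R_def by linarith
    qed
    moreover have "norm (complex_of_real ((\<Sum>s\<in>S. D s x) - R)) \<le> R - e" for x
      using sum(2)[where A = S and x = x] ge[of x] unfolding norm_of_real R_def D_def by linarith
    ultimately show ?thesis
      using m(3)[rule_format, of "\<lambda>x. complex_of_real ((\<Sum>s\<in>S. D s x) - R)" "R - e"] by (simp del: of_real_sum)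
  qed
  ultimately have "\<bar>R\<bar> \<le> R - e" by simp
  then show False using e by linarith
qed

lemma prob_density_translate:
  assumes "prob_density \<phi>"
  shows "prob_density (\<lambda>y. \<phi> (a + y))"
  using prob_densityD[OF assms] integral_translate[of \<phi> a] integrable_Cc[of \<phi>]
  by (auto simp: prob_density_def Cc_translate)

text \<open>If no density worked, the functional l of \<open>Reiter_separation\<close> would produce
  a coboundary bounded below by e, made of the values of l on translates of one bump. Amenability
  excludes this.\<close>

lemma Reiter_finite:
  assumes am: "amenable M" and S: "finite S" and e: "e > 0"
  obtains \<phi> where "prob_density \<phi>" "\<And>s. s \<in> S \<Longrightarrow> l1 (\<lambda>y. \<phi> (s + y) - \<phi> y) \<le> e"
proof (rule ccontr)
  assume "\<not> thesis"
  then have no: "\<exists>s\<in>S. l1 (\<lambda>y. \<phi> (s + y) - \<phi> y) > e" if "prob_density \<phi>" for \<phi>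
    using that \<open>\<And>\<phi>. prob_density \<phi> \<Longrightarrow> (\<And>s. s \<in> S \<Longrightarrow> l1 (\<lambda>y. \<phi> (s + y) - \<phi> y) \<le> e) \<Longrightarrow> thesis\<close>
    by (meson not_less)
  obtain l where W: "function_space Cc_family" and l: "linear_functional_on Cc_family l"
    and bound': "\<forall>v\<in>Cc_family. \<bar>l v\<bar> \<le> (\<Sum>s\<in>S. l1 (\<lambda>y. v (s, y)))"
    and ge': "\<forall>\<theta>. prob_density \<theta> \<longrightarrow> l (difference S \<theta>) \<ge> e"
    by (rule Reiter_separation[OF e S no])
  note bound = bound'[rule_format] and ge = ge'[rule_format]
  obtain k where "k \<in> Cc" "\<And>x. 0 \<le> k x" "(\<integral>x. k x \<partial>M) = 1"
    using exists_bump[OF open_UNIV UNIV_I] by metis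
  then have kd: "prob_density k" by (simp add: prob_density_def)
  have k: "k \<in> Cc" using prob_densityD(1)[OF kd] .
  have zero: "(\<lambda>_. 0) \<in> Cc" by (rule CcI[where K = "{}"]) auto
  \<comment> \<open>The translate of k by x, placed in coordinate s. As x varies, l of it is bounded
    by 1 and continuous, because translation of k is continuous in L^1.\<close>
  define E where "E s x = (\<lambda>(t, y). if t = s then k (- x + y) else 0)" for s x :: 'a
  have EW: "E s x \<in> Cc_family" for s x
  proof -
    have "(\<lambda>y. E s x (t, y)) \<in> Cc" for t
      using Cc_translate[OF k] zero by (cases "t = s") (simp_all add: E_def)
    then show ?thesis by (simp add: Cc_family_def)
  qed
  have bd: "\<bar>l (E s x) - l (E s x')\<bar> \<le> l1 (\<lambda>y. k (- x + y) - k (- x' + y))" if "s \<in> S" for s x x'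
  proof -
    have "\<bar>l (E s x) - l (E s x')\<bar> \<le> (\<Sum>t\<in>S. l1 (\<lambda>y. E s x (t, y) - E s x' (t, y)))"
      using bound[OF function_spaceD(5)[OF W EW EW]] linear_functional_on_diff[OF W l EW EW] by metis
    also have "\<dots> = (\<Sum>t\<in>S. if t = s then l1 (\<lambda>y. k (- x + y) - k (- x' + y)) else 0)"
      by (intro sum.cong refl) (simp add: E_def l1_def)
    finally show ?thesis using S that by simp
  qed
  have cont: "continuous_on UNIV (\<lambda>x. l (E s x))" if "s \<in> S" for s
    unfolding continuous_on_def
  proof
    fix x0
    show "((\<lambda>x. l (E s x)) \<longlongrightarrow> l (E s x0)) (at x0 within UNIV)"
    proof (rule tendstoI)
      fix d :: real assume "d > 0"
      then obtain U where U: "open U" "0 \<in> U" "\<And>x. x \<in> U \<Longrightarrow> l1 (\<lambda>y. k (x + y) - k y) < d"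
        using translation_continuous[OF k] by metis
      have "open ((\<lambda>x. - x + x0) -` U)" using U(1)
        by (intro open_vimage continuous_on_add continuous_on_minus continuous_on_const continuous_on_id)
      moreover have "dist (l (E s x)) (l (E s x0)) < d" if "x \<in> (\<lambda>x. - x + x0) -` U" for x
      proof -
        have "dist (l (E s x)) (l (E s x0)) \<le> l1 (\<lambda>y. k (- x + x0 + y) - k y)"
          using bd[OF \<open>s \<in> S\<close>, of x x0] l1_translate_diff[OF k, of "- x" "- x0"] by (simp add: dist_real_def)
        then show ?thesis using U(3)[of "- x + x0"] that by simp
      qed
      ultimately show "eventually (\<lambda>x. dist (l (E s x)) (l (E s x0)) < d) (at x0 within UNIV)"
        unfolding eventually_at_topological using U(2) by (intro exI[of _ "(\<lambda>x. - x + x0) -` U"]) auto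
    qed
  qed
  have bounded: "\<bar>l (E s x)\<bar> \<le> 1" if "s \<in> S" for s x
  proof -
    have "\<bar>l (E s x)\<bar> \<le> (\<Sum>t\<in>S. l1 (\<lambda>y. E s x (t, y)))" by (rule bound[OF EW])
    also have "\<dots> = (\<Sum>t\<in>S. if t = s then l1 (\<lambda>y. k (- x + y)) else 0)"
      by (intro sum.cong refl) (simp add: E_def l1_def)
    finally show ?thesis using S that prob_densityD(4)[OF kd] by (simp add: l1_translate[OF k])
  qed
  \<comment> \<open>The sign change comes from
    \<open>k (- x + (s + y)) = k (- (- s + x) + y)\<close>: translating the bump by s in y replaces
    x by - s + x.\<close>
  define f where "f s x = (if - s \<in> S then l (E (- s) x) else 0)" for s x
  have f_cont: "continuous_on UNIV (f s)" and f_bounded: "\<bar>f s x\<bar> \<le> 1" for s x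
    using cont[of "- s"] bounded[of "- s"] by (cases "- s \<in> S"; simp add: f_def[abs_def])+
  obtain x where x: "(\<Sum>s\<in>uminus ` S. f s (s + x) - f s x) < e"
    using amenable_no_positive_coboundary[where f = f, OF am finite_imageI[OF S] e f_cont f_bounded] by blast
  have "(\<Sum>s\<in>uminus ` S. f s (s + x) - f s x) = (\<Sum>s\<in>S. f (- s) (- s + x) - f (- s) x)"
    by (subst sum.reindex) auto
  also have "\<dots> = (\<Sum>s\<in>S. l (\<lambda>z. E s (- s + x) z - E s x z))"
    using linear_functional_on_diff[OF W l EW EW] by (simp add: f_def)
  also have "\<dots> = l (\<lambda>z. \<Sum>s\<in>S. E s (- s + x) z - E s x z)"
    using linear_functional_on_sum[OF W l S function_spaceD(5)[OF W EW EW]] by simp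
  also have "(\<lambda>z. \<Sum>s\<in>S. E s (- s + x) z - E s x z) = difference S (\<lambda>y. k (- x + y))"
  proof
    fix z :: "'a \<times> 'a"
    obtain t y where z: "z = (t, y)" by (cases z)
    have "(\<Sum>s\<in>S. E s (- s + x) z - E s x z) =
        (\<Sum>s\<in>S. if s = t then k (- x + (t + y)) - k (- x + y) else 0)"
      by (intro sum.cong refl) (auto simp: E_def z minus_add add.assoc)
    then show "(\<Sum>s\<in>S. E s (- s + x) z - E s x z) = difference S (\<lambda>y. k (- x + y)) z"
      using S by (simp add: difference_def z)
  qed
  finally show False using x ge[OF prob_density_translate[OF kd, of "- x"]] by simp
qed


section \<open>Averages over small left translations\<close>

definition smoothed :: "('a \<Rightarrow> real) \<Rightarrow> ('a \<Rightarrow> real) \<Rightarrow> 'a \<Rightarrow> 'a \<Rightarrow> real" where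
  "smoothed k \<phi> y w = (\<integral>u. k u * \<phi> (- y + u + w) \<partial>M)"

text \<open>Substituting y + u for u moves y from \<phi> to k. The dependence on y is then
  controlled by translation of k alone, uniformly in all densities \<phi>.\<close>

lemma smoothed_translate:
  assumes "k \<in> Cc" "\<phi> \<in> Cc"
  shows "smoothed k \<phi> y w = (\<integral>u. k (y + u) * \<phi> (u + w) \<partial>M)"
proof -
  have "(\<lambda>u. k u * \<phi> (- y + u + w)) \<in> borel_measurable M"
    by (intro measurable_continuous continuous_on_mult Cc_continuous assms continuous_on_Cc[OF assms(2)]
        continuous_on_add continuous_on_const continuous_on_id)
  from integral_translate[OF this, of y] show ?thesis
    unfolding smoothed_def by simp
qed

lemma continuous_smoothed:
  assumes k: "k \<in> Cc" and \<phi>: "\<phi> \<in> Cc"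
  shows "continuous_on UNIV (\<lambda>p. smoothed k \<phi> (fst p) (snd p))"
proof -
  obtain K where K: "compact K" "\<forall>y. y \<notin> K \<longrightarrow> k y = 0" using CcD[OF k] by blast
  show ?thesis
    unfolding smoothed_def
  proof (rule continuous_on_integral[OF _ open_UNIV K(1)])
    show "continuous_on UNIV (\<lambda>q. k (snd q) * \<phi> (- fst (fst q) + snd q + snd (fst q)))"
      by (intro continuous_on_mult continuous_on_Cc[OF k] continuous_on_Cc[OF \<phi>] continuous_on_add
          continuous_on_minus continuous_on_fst continuous_on_snd continuous_on_id)
    show "k u * \<phi> (- fst p + u + snd p) = 0" if "u \<notin> K" for p u using K(2) that by simp
  qed
qed

lemma smoothed_support:
  assumes k: "k \<in> Cc" and \<phi>: "\<phi> \<in> Cc" and Y: "compact Y"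
  obtains L where "compact L" "\<forall>y w. y \<in> Y \<longrightarrow> w \<notin> L \<longrightarrow> smoothed k \<phi> y w = 0"
proof -
  obtain K where K: "compact K" "\<forall>y. y \<notin> K \<longrightarrow> k y = 0" using CcD[OF k] by blast
  have s: "continuous_on (Y \<times> K) (\<lambda>p. - fst p + snd p)"
    by (intro continuous_on_add continuous_on_minus continuous_on_fst continuous_on_snd continuous_on_id)
  obtain L where L: "compact L" "\<And>p w. p \<in> Y \<times> K \<Longrightarrow> w \<notin> L \<Longrightarrow> \<phi> (- fst p + snd p + w) = 0"
    using translate_support[OF \<phi> compact_Times[OF Y K(1)] s] by metis
  have "smoothed k \<phi> y w = 0" if "y \<in> Y" "w \<notin> L" for y w
  proof -
    have 0: "k u * \<phi> (- y + u + w) = 0" for u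
      using L(2)[of "(y, u)" w] K(2) that by (cases "u \<in> K") auto
    show ?thesis unfolding smoothed_def 0 by simp
  qed
  then show ?thesis using that[OF L(1)] by simp
qed

lemma smoothed_Cc:
  assumes "k \<in> Cc" "\<phi> \<in> Cc"
  shows "smoothed k \<phi> y \<in> Cc"
proof -
  obtain L where L: "compact L" "\<forall>z w. z \<in> {y} \<longrightarrow> w \<notin> L \<longrightarrow> smoothed k \<phi> z w = 0"
    by (rule smoothed_support[OF assms compact_sing])
  show ?thesis
    using L(2) by (intro CcI[OF continuous_on_sections(1)[OF continuous_smoothed[OF assms]] L(1)]) auto
qed

text \<open>The point z separates two causes: y and z are compared through translates of k, z and 0
  through near invariance of \<phi> under - z. When z is taken from a finite net, invariance of
  \<phi> under finitely many translations suffices.\<close>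

lemma smoothed_almost_invariant:
  assumes k: "prob_density k" and \<phi>: "prob_density \<phi>"
    and yz: "l1 (\<lambda>u. k (y + u) - k (z + u)) \<le> d" and z: "l1 (\<lambda>w. \<phi> (- z + w) - \<phi> w) \<le> d"
  shows "l1 (\<lambda>w. smoothed k \<phi> y w - smoothed k \<phi> 0 w) \<le> 2 * d"
proof -
  note kC = prob_densityD(1)[OF k] and pC = prob_densityD(1)[OF \<phi>]
  have int: "integrable M (\<lambda>u. g u * f (u + w))" if g: "g \<in> Cc" and f: "f \<in> Cc" for f g w
  proof -
    obtain K where K: "compact K" "\<forall>y. y \<notin> K \<longrightarrow> g y = 0" using CcD[OF g] by blast
    show ?thesis
      using K(2) by (intro integrable_bounded_compact[OF _ K(1)] continuous_on_mult Cc_continuous[OF g]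
          continuous_on_Cc[OF f] continuous_on_add continuous_on_const continuous_on_id) auto
  qed
  have "l1 (\<lambda>w. smoothed k \<phi> y w - smoothed k \<phi> z w) =
      l1 (\<lambda>w. \<integral>u. (k (y + u) - k (z + u)) * \<phi> (u + w) \<partial>M)"
    unfolding smoothed_translate[OF kC pC]
    using int[OF Cc_translate[OF kC] pC] by (simp add: algebra_simps)
  also have "\<dots> \<le> l1 \<phi> * l1 (\<lambda>u. k (y + u) - k (z + u))"
    using convolution_Cc(2)[OF Cc_minus[OF Cc_translate[OF kC] Cc_translate[OF kC]] pC continuous_on_id] .
  finally have 1: "l1 (\<lambda>w. smoothed k \<phi> y w - smoothed k \<phi> z w) \<le> d"
    using yz by (simp add: prob_densityD(4)[OF \<phi>])
  have zC: "(\<lambda>w. \<phi> (- z + w)) \<in> Cc" by (rule Cc_translate[OF pC])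
  have "l1 (\<lambda>w. smoothed k \<phi> z w - smoothed k \<phi> 0 w) =
      l1 (\<lambda>w. \<integral>u. k u * ((\<lambda>v. \<phi> (- z + v) - \<phi> v) (u + w)) \<partial>M)"
    unfolding smoothed_def
    using int[OF kC zC] int[OF kC pC] by (simp add: algebra_simps)
  also have "\<dots> \<le> l1 (\<lambda>v. \<phi> (- z + v) - \<phi> v) * l1 k"
    by (rule convolution_Cc(2)[OF kC Cc_minus[OF zC pC] continuous_on_id])
  finally have 2: "l1 (\<lambda>w. smoothed k \<phi> z w - smoothed k \<phi> 0 w) \<le> d"
    using z by (simp add: prob_densityD(4)[OF k])
  show ?thesis
    using l1_triangle_diff[OF smoothed_Cc[OF kC pC, of y] smoothed_Cc[OF kC pC, of z] smoothed_Cc[OF kC pC, of 0]]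
      1 2 by linarith
qed

text \<open>The comparison function \<open>smoothed k \<phi> 0\<close> does not involve H, so all
  translates of one h used as H give results close to each other. Inserting a k-average into the
  convolution costs d, since translations in the support of k hardly change H. Exchanging integrals
  turns it into the H-average of \<open>smoothed k \<phi> y\<close>, which costs another 2 *
  d.\<close>

lemma convolution_near_smoothed:
  assumes H: "prob_density H" and k: "prob_density k" and \<phi>: "prob_density \<phi>"
    and Hu: "\<And>u. k u \<noteq> 0 \<Longrightarrow> l1 (\<lambda>y. H (u + y) - H y) \<le> d"
    and Dy: "\<And>y. H y \<noteq> 0 \<Longrightarrow> l1 (\<lambda>w. smoothed k \<phi> y w - smoothed k \<phi> 0 w) \<le> 2 * d"
  shows "l1 (\<lambda>w. (\<integral>y. H y * \<phi> (- y + w) \<partial>M) - smoothed k \<phi> 0 w) \<le> 3 * d"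
proof -
  note HC = prob_densityD(1)[OF H] and kC = prob_densityD(1)[OF k] and pC = prob_densityD(1)[OF \<phi>]
  obtain K where K: "compact K" "\<forall>y. y \<notin> K \<longrightarrow> k y = 0" using CcD[OF kC] by blast
  obtain Y where Y: "compact Y" "\<forall>y. y \<notin> Y \<longrightarrow> H y = 0" using CcD[OF HC] by blast
  define A where "A w = (\<integral>y. H y * \<phi> (- y + w) \<partial>M)" for w
  define B where "B w = (\<integral>u. k u * A (u + w) \<partial>M)" for w
  have minus: "continuous_on UNIV (uminus :: 'a \<Rightarrow> 'a)" by (intro continuous_on_minus continuous_on_id)
  have AC: "A \<in> Cc" unfolding A_def by (rule convolution_Cc(1)[OF HC pC minus])
  have BC: "B \<in> Cc" unfolding B_def by (rule convolution_Cc(1)[OF kC AC continuous_on_id])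
  have intk: "integrable M (\<lambda>u. k u * f u)" if "continuous_on UNIV f" for f
    using K(2) by (intro integrable_bounded_compact[OF _ K(1)] continuous_on_mult Cc_continuous[OF kC] that) auto
  have intH: "integrable M (\<lambda>u. h u * f u)" if h: "h \<in> Cc" and f: "continuous_on UNIV f" for h f
  proof -
    obtain Z where Z: "compact Z" "\<forall>y. y \<notin> Z \<longrightarrow> h y = 0" using CcD[OF h] by blast
    show ?thesis
      using Z(2) by (intro integrable_bounded_compact[OF _ Z(1)] continuous_on_mult Cc_continuous[OF h] f) auto
  qed
  have p1: "continuous_on UNIV (\<lambda>y. \<phi> (- y + w))" for w
    by (intro continuous_on_Cc[OF pC] continuous_on_add continuous_on_minus continuous_on_const continuous_on_id)
  \<comment> \<open>Left invariance carries the shift in the argument of A over to H.\<close>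
  have A_shift: "A w - A (u + w) = (\<integral>y. (H y - H (u + y)) * \<phi> (- y + w) \<partial>M)" for u w
  proof -
    have "(\<lambda>y. H y * \<phi> (- y + (u + w))) \<in> borel_measurable M"
      by (intro measurable_continuous continuous_on_mult Cc_continuous[OF HC] p1)
    from integral_translate[OF this, of u] have "A (u + w) = (\<integral>y. H (u + y) * \<phi> (- y + w) \<partial>M)"
      unfolding A_def by (simp add: minus_add add.assoc del: add_uminus_conv_diff)
    then show ?thesis
      unfolding A_def using intH[OF HC p1] intH[OF Cc_translate[OF HC] p1] by (simp add: algebra_simps)
  qed
  have shift_bound: "l1 (\<lambda>w. A w - A (u + w)) \<le> d" if "k u \<noteq> 0" for u
  proof -
    have "l1 (\<lambda>w. A w - A (u + w)) \<le> l1 \<phi> * l1 (\<lambda>y. H y - H (u + y))"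
      unfolding A_shift by (rule convolution_Cc(2)[OF Cc_minus[OF HC Cc_translate[OF HC]] pC minus])
    then show ?thesis
      using Hu[OF that] by (simp add: prob_densityD(4)[OF \<phi>] l1_minus_commute[of H])
  qed
  have 1: "l1 (\<lambda>w. A w - B w) \<le> d"
  proof -
    have "A w - B w = (\<integral>u. k u * (A w - A (u + w)) \<partial>M)" for w
    proof -
      have "(\<integral>u. k u * (A w - A (u + w)) \<partial>M) = (\<integral>u. k u * A w - k u * A (u + w) \<partial>M)"
        by (simp add: right_diff_distrib)
      also have "\<dots> = (\<integral>u. k u * A w \<partial>M) - B w"
        unfolding B_def
        by (intro Bochner_Integration.integral_diff intk continuous_on_const continuous_on_Cc[OF AC]
            continuous_on_add continuous_on_id)
      finally show ?thesis by (simp add: prob_densityD(3)[OF k])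
    qed
    moreover have "l1 (\<lambda>w. \<integral>u. k u * (A w - A (u + w)) \<partial>M) \<le> d * l1 k"
    proof -
      obtain L where L: "compact L" "\<And>u w. u \<in> K \<Longrightarrow> w \<notin> L \<Longrightarrow> A (u + w) = 0"
        using translate_support[OF AC K(1) continuous_on_id] by metis
      obtain L' where L': "compact L'" "\<forall>w. w \<notin> L' \<longrightarrow> A w = 0" using CcD[OF AC] by blast
      show ?thesis
      proof (rule Minkowski_kernel[OF kC _ K(1) _ compact_Un[OF L(1) L'(1)]])
        show "continuous_on UNIV (\<lambda>p. A (snd p) - A (fst p + snd p))"
          by (intro continuous_on_diff continuous_on_Cc[OF AC] continuous_on_add continuous_on_fst
              continuous_on_snd continuous_on_id)
        show "k u = 0" if "u \<notin> K" for u using K(2) that by simp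
        show "A w - A (u + w) = 0" if "u \<in> K" "w \<notin> L \<union> L'" for u w
          using L(2)[of u w] L'(2) that by simp
      qed (rule shift_bound)
    qed
    ultimately show ?thesis by (simp add: prob_densityD(4)[OF k])
  qed
  have B_eq: "B w = (\<integral>y. H y * smoothed k \<phi> y w \<partial>M)" for w
  proof -
    define F where "F y u = k u * (H y * \<phi> (- y + u + w))" for y u
    have F: "continuous_on UNIV (\<lambda>p. F (fst p) (snd p))"
      unfolding F_def
      by (intro continuous_on_mult continuous_on_Cc[OF kC] continuous_on_Cc[OF HC] continuous_on_Cc[OF pC]
          continuous_on_add continuous_on_minus continuous_on_fst continuous_on_snd continuous_on_const
          continuous_on_id)
    have "B w = (\<integral>u. (\<integral>y. F y u \<partial>M) \<partial>M)"
      unfolding B_def A_def F_def by (simp add: add.assoc)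
    also have "\<dots> = (\<integral>y. (\<integral>u. F y u \<partial>M) \<partial>M)"
      using K(2) Y(2) by (intro Fubini_compact_support[OF F Y(1) K(1)]) (auto simp: F_def)
    also have "\<dots> = (\<integral>y. H y * smoothed k \<phi> y w \<partial>M)"
      unfolding F_def smoothed_def
      by (simp only: mult.left_commute[of "k _" "H _"] integral_mult_right_zero)
    finally show ?thesis .
  qed
  have 2: "l1 (\<lambda>w. B w - smoothed k \<phi> 0 w) \<le> 2 * d"
  proof -
    have "B w - smoothed k \<phi> 0 w = (\<integral>y. H y * (smoothed k \<phi> y w - smoothed k \<phi> 0 w) \<partial>M)" for w
    proof -
      have "(\<integral>y. H y * (smoothed k \<phi> y w - smoothed k \<phi> 0 w) \<partial>M) =
          (\<integral>y. H y * smoothed k \<phi> y w - H y * smoothed k \<phi> 0 w \<partial>M)"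
        by (simp add: right_diff_distrib)
      also have "\<dots> = B w - (\<integral>y. H y * smoothed k \<phi> 0 w \<partial>M)"
        unfolding B_eq
        by (intro Bochner_Integration.integral_diff intH[OF HC] continuous_on_const
            continuous_on_sections(2)[OF continuous_smoothed[OF kC pC]])
      finally show ?thesis by (simp add: prob_densityD(3)[OF H])
    qed
    moreover have "l1 (\<lambda>w. \<integral>y. H y * (smoothed k \<phi> y w - smoothed k \<phi> 0 w) \<partial>M) \<le> (2 * d) * l1 H"
    proof -
      obtain L where L: "compact L" "\<forall>y w. y \<in> insert 0 Y \<longrightarrow> w \<notin> L \<longrightarrow> smoothed k \<phi> y w = 0"
        by (rule smoothed_support[OF kC pC compact_insert[OF Y(1)]])
      show ?thesis
      proof (rule Minkowski_kernel[OF HC _ Y(1) _ L(1)])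
        show "continuous_on UNIV (\<lambda>p. smoothed k \<phi> (fst p) (snd p) - smoothed k \<phi> 0 (snd p))"
          by (intro continuous_on_diff continuous_smoothed[OF kC pC] continuous_on_snd continuous_on_id
              continuous_on_Cc[OF smoothed_Cc[OF kC pC]])
        show "H y = 0" if "y \<notin> Y" for y using Y(2) that by simp
        show "smoothed k \<phi> y w - smoothed k \<phi> 0 w = 0" if "y \<in> Y" "w \<notin> L" for y w
          using L(2) that by simp
      qed (rule Dy)
    qed
    ultimately show ?thesis by (simp add: prob_densityD(4)[OF H])
  qed
  show ?thesis
    using l1_triangle_diff[OF AC BC smoothed_Cc[OF kC pC, of 0]] 1 2 unfolding A_def by linarith
qed

lemma convolution_density:
  assumes h: "prob_density h" and \<phi>: "prob_density \<phi>"
  shows "prob_density (\<lambda>w. \<integral>y. h y * \<phi> (- y + w) \<partial>M)"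
proof -
  note hC = prob_densityD(1)[OF h] and pC = prob_densityD(1)[OF \<phi>]
  obtain Y where Y: "compact Y" "\<forall>y. y \<notin> Y \<longrightarrow> h y = 0" using CcD[OF hC] by blast
  have minus: "continuous_on UNIV (uminus :: 'a \<Rightarrow> 'a)" by (intro continuous_on_minus continuous_on_id)
  obtain L where L: "compact L" "\<And>y w. y \<in> Y \<Longrightarrow> w \<notin> L \<Longrightarrow> \<phi> (- y + w) = 0"
    using translate_support[OF pC Y(1) continuous_on_subset[OF minus subset_UNIV]] by metis
  define F where "F y w = h y * \<phi> (- y + w)" for y w
  have F: "continuous_on UNIV (\<lambda>p. F (fst p) (snd p))"
    unfolding F_def
    by (intro continuous_on_mult continuous_on_Cc[OF hC] continuous_on_Cc[OF pC]
        continuous_on_add continuous_on_minus continuous_on_fst continuous_on_snd continuous_on_id)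
  have "(\<integral>w. (\<integral>y. F y w \<partial>M) \<partial>M) = (\<integral>y. (\<integral>w. F y w \<partial>M) \<partial>M)"
  proof (rule Fubini_compact_support[OF F Y(1) L(1)])
    show "F y w = 0" if "y \<notin> Y \<or> w \<notin> L" for y w
      using Y(2) L(2)[of y w] that by (cases "y \<in> Y") (auto simp: F_def)
  qed
  also have "\<dots> = (\<integral>y. h y \<partial>M)"
  proof -
    have "(\<integral>w. F y w \<partial>M) = h y" for y
      unfolding F_def using prob_densityD(3)[OF prob_density_translate[OF \<phi>, of "- y"]] by simp
    then show ?thesis by simp
  qed
  finally show ?thesis
    unfolding prob_density_def
    using convolution_Cc(1)[OF hC pC minus] prob_densityD(2)[OF h] prob_densityD(2)[OF \<phi>] prob_densityD(3)[OF h]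
    by (simp add: F_def)
qed

text \<open>Invariance under finitely many translations is upgraded to a compact set \<open>L\<close> by smoothing on
  the left with a fixed density \<open>h\<close>: up to small errors each \<open>L\<close>-translate of \<open>h\<close> can be replaced by
  its average over a small set of left translations, and averages \<open>smoothed k \<phi> y\<close> depend continuously
  on \<open>y\<close>, so that a finite net of points \<open>y\<close> suffices. This avoids the modular function.\<close>

lemma Reiter_compact:
  assumes am: "amenable M" and L: "compact L" and e: "e > 0"
  obtains \<psi> where "prob_density \<psi>" "\<forall>x\<in>L. l1 (\<lambda>w. \<psi> (- x + w) - \<psi> w) \<le> e"
proof -
  \<comment> \<open>The budget is 3 * d for the translate by x and 3 * d for \<psi> itself. The
    latter is the case x = 0, for which 0 is added to L.\<close>
  define d where "d = e / 6"
  have d: "d > 0" using e by (simp add: d_def)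
  define L0 where "L0 = insert 0 L"
  have L0: "compact L0" unfolding L0_def using L by (rule compact_insert)
  obtain h where "h \<in> Cc" "\<And>x. 0 \<le> h x" "(\<integral>x. h x \<partial>M) = 1"
    using exists_bump[OF open_UNIV UNIV_I] by metis
  then have h: "prob_density h" by (simp add: prob_density_def)
  note hC = prob_densityD(1)[OF h]
  obtain K where K: "compact K" "\<forall>y. y \<notin> K \<longrightarrow> h y = 0" using CcD[OF hC] by blast
  define Y where "Y = (\<lambda>(x, y). x + y) ` (L0 \<times> K)"
  have Y: "compact Y" unfolding Y_def using L0 K(1) by (rule compact_plus)
  obtain U0 where U0: "open U0" "0 \<in> U0" "\<And>x. x \<in> U0 \<Longrightarrow> l1 (\<lambda>y. h (x + y) - h y) < d"
    using translation_continuous[OF hC d] by metis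
  \<comment> \<open>Shifting \<open>h (- x + y)\<close> by u amounts to shifting h by the conjugate
    - x + u + x. The tube lemma yields one U that remains small under conjugation by every x in
    \<open>L0\<close>.\<close>
  define W where "W = (\<lambda>p. - snd p + fst p + snd p) -` U0"
  have "open W" unfolding W_def using U0(1)
    by (intro open_vimage continuous_on_add continuous_on_minus continuous_on_fst continuous_on_snd continuous_on_id)
  moreover have "{0} \<times> L0 \<subseteq> W" using U0(2) by (auto simp: W_def)
  ultimately obtain U where U: "0 \<in> U" "open U" "U \<times> L0 \<subseteq> W"
    using Elementary_Topology.tube_lemma[OF L0, of W 0] by blast
  obtain k where kk: "k \<in> Cc" "\<And>x. 0 \<le> k x" "(\<integral>x. k x \<partial>M) = 1" and kU: "\<And>x. k x \<noteq> 0 \<Longrightarrow> x \<in> U"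
    using exists_bump[OF U(2,1)] by metis
  have k: "prob_density k" using kk by (simp add: prob_density_def)
  note kC = prob_densityD(1)[OF k]
  obtain U1 where U1: "open U1" "0 \<in> U1" "\<And>x. x \<in> U1 \<Longrightarrow> l1 (\<lambda>y. k (x + y) - k y) < d"
    using translation_continuous[OF kC d] by metis
  define N where "N z = (\<lambda>y. y + - z) -` U1" for z
  have opN: "open (N z)" for z
    unfolding N_def using U1(1)
    by (intro open_vimage continuous_on_add continuous_on_const continuous_on_id)
  have "Y \<subseteq> (\<Union>z\<in>Y. N z)" using U1(2) by (auto simp: N_def)
  then obtain Z where Z: "Z \<subseteq> Y" "finite Z" "Y \<subseteq> (\<Union>z\<in>Z. N z)"
    by (rule compactE_image[OF Y opN])
  \<comment> \<open>The density \<phi> is chosen last. Since h, U, k and the finite net Z are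
    already fixed, near invariance under - z for z in Z is a finite demand.\<close>
  obtain \<phi> where \<phi>: "prob_density \<phi>" and inv: "\<And>s. s \<in> uminus ` Z \<Longrightarrow> l1 (\<lambda>y. \<phi> (s + y) - \<phi> y) \<le> d"
    using Reiter_finite[OF am finite_imageI[OF Z(2), of uminus] d] by metis
  note pC = prob_densityD(1)[OF \<phi>]
  define \<psi> where "\<psi> w = (\<integral>y. h y * \<phi> (- y + w) \<partial>M)" for w
  have \<psi>: "prob_density \<psi>" unfolding \<psi>_def by (rule convolution_density[OF h \<phi>])
  have near: "l1 (\<lambda>w. \<psi> (- x + w) - smoothed k \<phi> 0 w) \<le> 3 * d" if x: "x \<in> L0" for x
  proof -
    define H where "H y = h (- x + y)" for y
    have H: "prob_density H" unfolding H_def by (rule prob_density_translate[OF h])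
    have "\<psi> (- x + w) = (\<integral>y. H y * \<phi> (- y + w) \<partial>M)" for w
    proof -
      have "(\<lambda>y. h y * \<phi> (- y + (- x + w))) \<in> borel_measurable M"
        by (intro measurable_continuous continuous_on_mult Cc_continuous[OF hC] continuous_on_Cc[OF pC]
            continuous_on_add continuous_on_minus continuous_on_const continuous_on_id)
      from integral_translate[OF this, of "- x"] show ?thesis
        unfolding \<psi>_def H_def by (simp add: minus_add add.assoc)
    qed
    moreover have "l1 (\<lambda>w. (\<integral>y. H y * \<phi> (- y + w) \<partial>M) - smoothed k \<phi> 0 w) \<le> 3 * d"
    proof (rule convolution_near_smoothed[OF H k \<phi>])
      fix u assume "k u \<noteq> 0"
      then have "(u, x) \<in> W" using kU U(3) x by blast
      then have "- x + u + x \<in> U0" by (simp add: W_def)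
      then have "l1 (\<lambda>y. h (- x + u + x + y) - h y) < d" by (rule U0(3))
      moreover have "l1 (\<lambda>y. H (u + y) - H y) = l1 (\<lambda>y. h (- x + u + x + y) - h y)"
        using l1_translate_diff[OF hC, of "- x + u" "- x"] by (simp add: H_def add.assoc)
      ultimately show "l1 (\<lambda>y. H (u + y) - H y) \<le> d" by simp
    next
      fix y assume "H y \<noteq> 0"
      then have "- x + y \<in> K" using K(2) by (auto simp: H_def)
      then have "(\<lambda>(x, y). x + y) (x, - x + y) \<in> Y" unfolding Y_def using x by (intro imageI) simp
      then have "y \<in> Y" by simp
      then obtain z where z: "z \<in> Z" "y \<in> N z" using Z(3) by blast
      have "l1 (\<lambda>u. k (y - z + u) - k u) < d" using U1(3)[of "y - z"] z(2) by (simp add: N_def)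
      then have "l1 (\<lambda>u. k (y + u) - k (z + u)) \<le> d" using l1_translate_diff[OF kC, of y z] by simp
      then show "l1 (\<lambda>w. smoothed k \<phi> y w - smoothed k \<phi> 0 w) \<le> 2 * d"
        using inv[of "- z"] z(1) by (intro smoothed_almost_invariant[OF k \<phi>]) auto
    qed
    ultimately show ?thesis by simp
  qed
  have "l1 (\<lambda>w. \<psi> (- x + w) - \<psi> w) \<le> e" if "x \<in> L" for x
  proof -
    have "l1 (\<lambda>w. \<psi> (- x + w) - \<psi> w) \<le>
        l1 (\<lambda>w. \<psi> (- x + w) - smoothed k \<phi> 0 w) + l1 (\<lambda>w. smoothed k \<phi> 0 w - \<psi> w)"
      by (rule l1_triangle_diff[OF Cc_translate[OF prob_densityD(1)[OF \<psi>]] smoothed_Cc[OF kC pC]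
            prob_densityD(1)[OF \<psi>]])
    also have "\<dots> \<le> 3 * d + 3 * d"
      using near[of x] near[of 0] that l1_minus_commute[of "smoothed k \<phi> 0" \<psi>] by (simp add: L0_def)
    finally show ?thesis by (simp add: d_def)
  qed
  then show ?thesis using that[OF \<psi>] by simp
qed

end

subsection \<open>Orlicz norms\<close>

lemma N_functionD:
  assumes "N_function \<Phi>"
  shows "convex_on UNIV \<Phi>" "\<Phi> (- x) = \<Phi> x" "0 \<le> \<Phi> x" "\<Phi> x = 0 \<longleftrightarrow> x = 0"
    "filterlim (\<lambda>x. \<Phi> x / x) at_top at_top"
  using assms by (auto simp: N_function_def)

lemma N_function_scale:
  assumes "N_function \<Phi>" "0 \<le> u" "u \<le> 1"
  shows "\<Phi> (u * t) \<le> u * \<Phi> t"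
  using convex_onD[OF N_functionD(1)[OF assms(1)], of u 0 t] assms N_functionD(4)[OF assms(1), of 0]
  by simp

lemma N_function_mono:
  assumes N: "N_function \<Phi>" and st: "0 \<le> s" "s \<le> t"
  shows "\<Phi> s \<le> \<Phi> t"
proof (cases "t = 0")
  case False
  then have "\<Phi> (s / t * t) \<le> s / t * \<Phi> t" using st by (intro N_function_scale[OF N]) auto
  also have "\<dots> \<le> 1 * \<Phi> t" using st False N_functionD(3)[OF N] by (intro mult_right_mono) auto
  finally show ?thesis using False by simp
qed (use st in auto)

lemma N_function_continuous: "N_function \<Phi> \<Longrightarrow> continuous_on UNIV \<Phi>"
  using convex_on_continuous[OF open_UNIV N_functionD(1)] by blast

lemma N_function_eventually_ge:
  assumes "N_function \<Phi>"
  obtains X where "X > 0" "\<forall>x\<ge>X. c * x \<le> \<Phi> x"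
proof -
  have "eventually (\<lambda>x. c \<le> \<Phi> x / x) at_top"
    using N_functionD(5)[OF assms] by (simp add: filterlim_at_top)
  then obtain X where X: "\<And>x. x \<ge> X \<Longrightarrow> c \<le> \<Phi> x / x" by (auto simp: eventually_at_top_linorder)
  have "c * x \<le> \<Phi> x" if "x \<ge> max X 1" for x
    using X[of x] that by (simp add: field_simps)
  then show ?thesis using that[of "max X 1"] by auto
qed

lemma N_function_surj:
  assumes N: "N_function \<Phi>" and c: "c > 0"
  obtains a where "a > 0" "\<Phi> a = c"
proof -
  obtain X where X: "X > 0" "\<forall>x\<ge>X. 1 * x \<le> \<Phi> x" by (rule N_function_eventually_ge[OF N])
  have "\<exists>a\<ge>0. a \<le> max X c \<and> \<Phi> a = c"
  proof (rule IVT')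
    show "\<Phi> 0 \<le> c" using N_functionD(4)[OF N, of 0] c by simp
    show "c \<le> \<Phi> (max X c)" using X(2)[rule_format, of "max X c"] by simp
    show "continuous_on {0..max X c} \<Phi>"
      by (rule continuous_on_subset[OF N_function_continuous[OF N]]) simp
  qed (use c in simp)
  then obtain a where "a \<ge> 0" "\<Phi> a = c" by blast
  moreover then have "a \<noteq> 0" using N_functionD(4)[OF N, of a] c by auto
  ultimately show ?thesis using that[of a] by simp
qed

text \<open>For t > a this says that \<Phi> t / t is at least \<Phi> a / a, by convexity and \<Phi>
  0 = 0. It plays the part of Young's inequality in \<open>orlicz_norm_bounded\<close>.\<close>

lemma N_function_le:
  assumes N: "N_function \<Phi>" and a: "a > 0" and t: "t \<ge> 0"
  shows "t \<le> a + a * (\<Phi> t / \<Phi> a)"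
proof -
  have pos: "\<Phi> a > 0" using N_functionD(3,4)[OF N, of a] a by (simp add: less_le)
  show ?thesis
  proof (cases "t \<le> a")
    case True
    moreover have "0 \<le> a * (\<Phi> t / \<Phi> a)" using a pos N_functionD(3)[OF N, of t] by simp
    ultimately show ?thesis by linarith
  next
    case False
    then have "\<Phi> (a / t * t) \<le> a / t * \<Phi> t" using a by (intro N_function_scale[OF N]) auto
    then have "t * \<Phi> a \<le> a * \<Phi> t" using False a by (simp add: field_simps)
    then have "t \<le> a * (\<Phi> t / \<Phi> a)" using pos by (simp add: field_simps)
    then show ?thesis using a by linarith
  qed
qed

lemma complementary_bdd_above:
  assumes N: "N_function \<Phi>"
  shows "bdd_above ((\<lambda>x. x * \<bar>y\<bar> - \<Phi> x) ` {0..})"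
proof -
  obtain X where X: "X > 0" "\<forall>x\<ge>X. \<bar>y\<bar> * x \<le> \<Phi> x" by (rule N_function_eventually_ge[OF N])
  have "x * \<bar>y\<bar> - \<Phi> x \<le> X * \<bar>y\<bar>" if "x \<ge> 0" for x
  proof (cases "x \<ge> X")
    case True
    then have "x * \<bar>y\<bar> - \<Phi> x \<le> 0" using X(2) by (simp add: mult.commute)
    then show ?thesis using X(1) by (smt (verit) abs_ge_zero mult_nonneg_nonneg)
  next
    case False
    then have "x * \<bar>y\<bar> \<le> X * \<bar>y\<bar>" by (intro mult_right_mono) auto
    then show ?thesis using N_functionD(3)[OF N, of x] by linarith
  qed
  then show ?thesis by (intro bdd_aboveI2[where M = "X * \<bar>y\<bar>"]) auto
qed

lemma complementary_mono:
  assumes N: "N_function \<Phi>" and "0 \<le> s" "s \<le> t"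
  shows "complementary \<Phi> s \<le> complementary \<Phi> t"
  unfolding complementary_def
  using assms by (intro cSUP_subset_mono complementary_bdd_above[OF N]) (auto intro: mult_left_mono)

lemma complementary_zero:
  assumes N: "N_function \<Phi>"
  shows "complementary \<Phi> 0 = 0"
proof -
  have "(SUP x\<in>{0..}. x * \<bar>0\<bar> - \<Phi> x) = 0"
  proof (rule cSup_eq_maximum)
    show "0 \<in> (\<lambda>x. x * \<bar>0\<bar> - \<Phi> x) ` {0..}"
      using N_functionD(4)[OF N, of 0] by (intro image_eqI[of _ _ 0]) auto
    show "x \<le> 0" if "x \<in> (\<lambda>x. x * \<bar>0\<bar> - \<Phi> x) ` {0..}" for x
      using that N_functionD(3)[OF N] by auto
  qed
  then show ?thesis unfolding complementary_def .
qed

text \<open>Only monotonicity and the value at 0 are asked of \<theta>, so that it can be \<Phi> as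
  well as \<open>complementary \<Phi>\<close>.\<close>

lemma bounded_in_M_space:
  fixes f :: "'a \<Rightarrow> complex"
  assumes \<theta>: "\<And>s t. 0 \<le> s \<Longrightarrow> s \<le> t \<Longrightarrow> \<theta> s \<le> \<theta> t" "\<theta> 0 = 0"
    and f: "f \<in> borel_measurable M" and E: "E \<in> sets M" "emeasure M E < \<infinity>"
    and bound: "\<And>x. norm (f x) \<le> c" "\<And>x. x \<notin> E \<Longrightarrow> f x = 0"
  shows "f \<in> M_space M \<theta>"
proof -
  have "modular M \<theta> (\<lambda>x. complex_of_real a * f x) < \<infinity>" if a: "a > 0" for a
  proof -
    have "modular M \<theta> (\<lambda>x. complex_of_real a * f x) \<le> (\<integral>\<^sup>+x. ennreal (\<theta> (a * c)) * indicator E x \<partial>M)"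
      unfolding modular_def
    proof (rule nn_integral_mono)
      fix x
      have "\<theta> (norm (complex_of_real a * f x)) \<le> \<theta> (a * c)"
        using a bound(1) by (intro \<theta>(1)) (auto simp: norm_mult)
      then show "ennreal (\<theta> (norm (complex_of_real a * f x))) \<le> ennreal (\<theta> (a * c)) * indicator E x"
        using bound(2)[of x] \<theta>(2) by (cases "x \<in> E") (auto intro: ennreal_leI)
    qed
    also have "\<dots> = ennreal (\<theta> (a * c)) * emeasure M E" by (rule nn_integral_cmult_indicator[OF E(1)])
    also have "\<dots> < \<infinity>" using E(2) by (simp add: ennreal_mult_less_top)
    finally show ?thesis .
  qed
  then show ?thesis unfolding M_space_def using f by blast
qed

section \<open>Norms of bounded functions and Hoelder's inequality\<close>

lemma luxemburg_norm_le:
  assumes "0 \<le> b" "\<And>k. b < k \<Longrightarrow> modular M \<Phi> (\<lambda>x. f x / complex_of_real k) \<le> 1"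
  shows "luxemburg_norm M \<Phi> f \<le> ennreal b"
proof (rule ennreal_le_epsilon)
  fix e :: real assume e: "0 < e"
  have "luxemburg_norm M \<Phi> f \<le> ennreal (b + e)"
    unfolding luxemburg_norm_def using assms(1) assms(2)[of "b + e"] e by (intro INF_lower) auto
  then show "luxemburg_norm M \<Phi> f \<le> ennreal b + ennreal e" using assms(1) e by (simp add: ennreal_plus)
qed

lemma borel_measurable_N_function:
  assumes "N_function \<Phi>" "f \<in> borel_measurable M"
  shows "(\<lambda>x. \<Phi> (norm (f x :: complex))) \<in> borel_measurable M"
  by (rule borel_measurable_continuous_on[OF N_function_continuous[OF assms(1)] measurable_compose[OF assms(2) borel_measurable_norm]])

text \<open>For k > c / a the values of f / k are at most a in modulus, and \<Phi> a is chosen so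
  that its integral over E is 1.\<close>

lemma luxemburg_norm_bounded:
  fixes f :: "'a \<Rightarrow> complex"
  assumes N: "N_function \<Phi>" and E: "E \<in> sets M" "emeasure M E < \<infinity>" "measure M E > 0"
    and a: "a > 0" "\<Phi> a = 1 / measure M E"
    and bound: "\<And>x. norm (f x) \<le> c" "\<And>x. x \<notin> E \<Longrightarrow> f x = 0" and c: "c \<ge> 0"
  shows "luxemburg_norm M \<Phi> f \<le> ennreal (c / a)"
proof (rule luxemburg_norm_le)
  show "0 \<le> c / a" using c a by simp
  fix k assume k: "c / a < k"
  then have k0: "k > 0" using \<open>0 \<le> c / a\<close> by linarith
  have "modular M \<Phi> (\<lambda>x. f x / complex_of_real k) \<le> (\<integral>\<^sup>+x. ennreal (1 / measure M E) * indicator E x \<partial>M)"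
    unfolding modular_def
  proof (rule nn_integral_mono)
    fix x
    have "norm (f x) / k \<le> a" using bound(1)[of x] k k0 a(1) by (simp add: field_simps)
    then have "\<Phi> (norm (f x / complex_of_real k)) \<le> 1 / measure M E"
      unfolding a(2)[symmetric] using k0 by (intro N_function_mono[OF N]) (auto simp: norm_divide)
    then show "ennreal (\<Phi> (norm (f x / complex_of_real k))) \<le> ennreal (1 / measure M E) * indicator E x"
      using bound(2)[of x] N_functionD(4)[OF N, of 0] by (cases "x \<in> E") (auto intro: ennreal_leI)
  qed
  also have "\<dots> = ennreal (1 / measure M E) * emeasure M E" by (rule nn_integral_cmult_indicator[OF E(1)])
  also have "\<dots> = 1"
    using E(2,3) by (simp add: emeasure_eq_ennreal_measure ennreal_mult[symmetric])
  finally show "modular M \<Phi> (\<lambda>x. f x / complex_of_real k) \<le> 1" .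
qed

text \<open>Integrating \<open>N_function_le\<close> over E gives a * measure M E from each of its
  two summands, because the modular is at most 1 and \<Phi> a = 1 / measure M E. The other factor 2
  comes from k < 2.\<close>

lemma orlicz_norm_bounded:
  fixes g :: "'a \<Rightarrow> complex"
  assumes N: "N_function \<Phi>" and E: "E \<in> sets M" "emeasure M E < \<infinity>" "measure M E > 0"
    and a: "a > 0" "\<Phi> a = 1 / measure M E"
    and bound: "\<And>x. norm (g x) \<le> d" "\<And>x. x \<notin> E \<Longrightarrow> g x = 0" and d: "d \<ge> 0"
  shows "orlicz_norm M \<Phi> g \<le> ennreal (4 * d * a * measure M E)"
  unfolding orlicz_norm_def
proof (rule SUP_least)
  fix h assume h: "h \<in> {h \<in> borel_measurable M. luxemburg_norm M \<Phi> h \<le> 1}"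
  define m where "m = measure M E"
  have m: "m > 0" "emeasure M E = ennreal m" using E by (auto simp: m_def emeasure_eq_ennreal_measure)
  \<comment> \<open>Norm at most 1 provides admissible k below any number greater than 1; that
    number is taken to be 2.\<close>
  have "luxemburg_norm M \<Phi> h < ennreal 2" using h by (auto intro: le_less_trans)
  then obtain k where k: "0 < k" "modular M \<Phi> (\<lambda>x. h x / complex_of_real k) \<le> 1" "ennreal k < ennreal 2"
    unfolding luxemburg_norm_def by (auto simp: INF_less_iff)
  have k2: "k < 2" using k(1,3) by (simp add: ennreal_less_iff)
  have meas: "(\<lambda>x. \<Phi> (norm (h x / complex_of_real k))) \<in> borel_measurable M"
    using h by (intro borel_measurable_N_function[OF N]) auto
  have "(\<integral>\<^sup>+x. ennreal (norm (h x * g x)) \<partial>M) \<le>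
      (\<integral>\<^sup>+x. ennreal (2 * d * a) * indicator E x +
        ennreal (2 * d * a * m) * ennreal (\<Phi> (norm (h x / complex_of_real k))) \<partial>M)"
  proof (rule nn_integral_mono)
    fix x
    define t where "t = norm (h x / complex_of_real k)"
    have t: "norm (h x) = k * t" "t \<ge> 0" using k(1) by (auto simp: t_def norm_divide)
    show "ennreal (norm (h x * g x)) \<le> ennreal (2 * d * a) * indicator E x +
        ennreal (2 * d * a * m) * ennreal (\<Phi> (norm (h x / complex_of_real k)))"
    proof (cases "x \<in> E")
      case True
      have "norm (h x * g x) \<le> (k * t) * d"
        unfolding norm_mult t(1) using bound(1)[of x] k(1) t(2) by (intro mult_left_mono) auto
      also have "\<dots> \<le> (2 * t) * d" using k2 t(2) d by (intro mult_right_mono) auto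
      also have "\<dots> \<le> (2 * (a + a * (\<Phi> t / \<Phi> a))) * d"
        using N_function_le[OF N a(1) t(2)] d by (intro mult_right_mono mult_left_mono) auto
      also have "\<dots> = 2 * d * a + 2 * d * a * m * \<Phi> t"
        using m a(2) by (simp add: m_def algebra_simps)
      finally have "ennreal (norm (h x * g x)) \<le> ennreal (2 * d * a + 2 * d * a * m * \<Phi> t)"
        by (rule ennreal_leI)
      also have "\<dots> = ennreal (2 * d * a) + ennreal (2 * d * a * m) * ennreal (\<Phi> t)"
        using d a(1) m(1) N_functionD(3)[OF N, of t] by (simp add: ennreal_plus ennreal_mult)
      finally show ?thesis using True by (simp add: t_def)
    qed (simp add: bound(2))
  qed
  also have "\<dots> = (\<integral>\<^sup>+x. ennreal (2 * d * a) * indicator E x \<partial>M) +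
      (\<integral>\<^sup>+x. ennreal (2 * d * a * m) * ennreal (\<Phi> (norm (h x / complex_of_real k))) \<partial>M)"
    using E(1) meas by (intro nn_integral_add) auto
  also have "(\<integral>\<^sup>+x. ennreal (2 * d * a) * indicator E x \<partial>M) = ennreal (2 * d * a) * ennreal m"
    unfolding m(2)[symmetric] by (rule nn_integral_cmult_indicator[OF E(1)])
  also have "(\<integral>\<^sup>+x. ennreal (2 * d * a * m) * ennreal (\<Phi> (norm (h x / complex_of_real k))) \<partial>M) =
      ennreal (2 * d * a * m) * modular M \<Phi> (\<lambda>x. h x / complex_of_real k)"
    unfolding modular_def using meas by (intro nn_integral_cmult) auto
  also have "ennreal (2 * d * a) * ennreal m + ennreal (2 * d * a * m) * modular M \<Phi> (\<lambda>x. h x / complex_of_real k)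
      \<le> ennreal (2 * d * a) * ennreal m + ennreal (2 * d * a * m) * 1"
    using k(2) by (intro add_left_mono mult_left_mono) auto
  also have "\<dots> = ennreal (4 * d * a * m)"
    using d a(1) m(1) by (simp add: ennreal_mult[symmetric] ennreal_plus[symmetric] del: ennreal_plus)
  finally show "(\<integral>\<^sup>+x. ennreal (norm (h x * g x)) \<partial>M) \<le> ennreal (4 * d * a * measure M E)"
    unfolding m_def .
qed

text \<open>The auxiliary a, which depends on \<Phi>, cancels between the two bounds. For a null set
  E no such a exists, but then the Luxemburg norm is 0.\<close>

lemma luxemburg_orlicz_bounded:
  fixes f g :: "'a \<Rightarrow> complex"
  assumes N: "N_function \<Phi>" and E: "E \<in> sets M" "emeasure M E < \<infinity>"
    and f: "\<And>x. norm (f x) \<le> c" "\<And>x. x \<notin> E \<Longrightarrow> f x = 0" and c: "c \<ge> 0"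
    and g: "\<And>x. norm (g x) \<le> d" "\<And>x. x \<notin> E \<Longrightarrow> g x = 0" and d: "d \<ge> 0"
  shows "luxemburg_norm M \<Phi> f * orlicz_norm M \<Phi> g \<le> ennreal (4 * c * d * measure M E)"
proof (cases "measure M E > 0")
  case True
  then obtain a where a: "a > 0" "\<Phi> a = 1 / measure M E"
    using N_function_surj[OF N, of "1 / measure M E"] by auto
  have "luxemburg_norm M \<Phi> f * orlicz_norm M \<Phi> g \<le> ennreal (c / a) * ennreal (4 * d * a * measure M E)"
    by (intro mult_mono luxemburg_norm_bounded[OF N E True a f c] orlicz_norm_bounded[OF N E True a g d]) auto
  also have "\<dots> = ennreal (4 * c * d * measure M E)"
    using a c d True by (simp add: ennreal_mult[symmetric])
  finally show ?thesis .
next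
  case False
  then have "emeasure M E = 0" using E(2) measure_nonneg[of M E] by (simp add: emeasure_eq_ennreal_measure)
  then have "AE x in M. x \<notin> E" using E(1) by (intro AE_not_in) (simp add: null_sets_def)
  then have "luxemburg_norm M \<Phi> f \<le> ennreal 0"
  proof (intro luxemburg_norm_le)
    fix k :: real
    have "modular M \<Phi> (\<lambda>x. f x / complex_of_real k) = (\<integral>\<^sup>+x. 0 \<partial>M)"
      unfolding modular_def using \<open>AE x in M. x \<notin> E\<close> f(2) N_functionD(4)[OF N, of 0]
      by (intro nn_integral_cong_AE) (auto elim!: AE_mp)
    then show "modular M \<Phi> (\<lambda>x. f x / complex_of_real k) \<le> 1" by simp
  qed simp
  then show ?thesis by simp
qed

text \<open>For admissible k < 1, convexity bounds the modular of f by k times that of f / k, hence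
  by k, and k can be arbitrarily small.\<close>

lemma luxemburg_norm_zero_AE:
  assumes N: "N_function \<Phi>" and f: "f \<in> borel_measurable M" and 0: "luxemburg_norm M \<Phi> f = 0"
  shows "AE x in M. f x = 0"
proof -
  have small: "modular M \<Phi> f \<le> 0 + ennreal e" if e: "e > 0" for e
  proof -
    have "luxemburg_norm M \<Phi> f < ennreal (min e 1)" using 0 e by simp
    then obtain k where k: "0 < k" "modular M \<Phi> (\<lambda>x. f x / complex_of_real k) \<le> 1" "ennreal k < ennreal (min e 1)"
      unfolding luxemburg_norm_def INF_less_iff by blast
    have k1: "k < e" "k < 1" using k(1,3) by (auto simp: ennreal_less_iff)
    have "modular M \<Phi> f \<le> (\<integral>\<^sup>+x. ennreal k * ennreal (\<Phi> (norm (f x / complex_of_real k))) \<partial>M)"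
      unfolding modular_def
    proof (rule nn_integral_mono)
      fix x
      have "\<Phi> (k * norm (f x / complex_of_real k)) \<le> k * \<Phi> (norm (f x / complex_of_real k))"
        using k(1) k1 by (intro N_function_scale[OF N]) auto
      then show "ennreal (\<Phi> (norm (f x))) \<le> ennreal k * ennreal (\<Phi> (norm (f x / complex_of_real k)))"
        using k(1) N_functionD(3)[OF N] by (simp add: norm_divide ennreal_mult[symmetric] ennreal_leI)
    qed
    also have "\<dots> = ennreal k * modular M \<Phi> (\<lambda>x. f x / complex_of_real k)"
      unfolding modular_def using f
      by (intro nn_integral_cmult measurable_compose[OF borel_measurable_N_function[OF N] measurable_ennreal]) auto
    also have "\<dots> \<le> ennreal k * 1" using k(2) by (intro mult_left_mono) auto
    also have "\<dots> \<le> ennreal e" using k1 by (simp add: ennreal_leI)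
    finally show ?thesis by simp
  qed
  have "modular M \<Phi> f \<le> 0" by (rule ennreal_le_epsilon, rule small)
  then have "(\<integral>\<^sup>+x. ennreal (\<Phi> (norm (f x))) \<partial>M) = 0" by (simp add: modular_def)
  moreover have "(\<lambda>x. ennreal (\<Phi> (norm (f x)))) \<in> borel_measurable M"
    by (rule measurable_compose[OF borel_measurable_N_function[OF N f] measurable_ennreal])
  ultimately have "AE x in M. ennreal (\<Phi> (norm (f x))) = 0" by (simp only: nn_integral_0_iff_AE)
  then show ?thesis
  proof (rule AE_mp, intro AE_I2 impI)
    fix x assume "ennreal (\<Phi> (norm (f x))) = 0"
    then have "\<Phi> (norm (f x)) = 0" using N_functionD(3)[OF N, of "norm (f x)"] by (simp add: ennreal_eq_0_iff)
    then show "f x = 0" using N_functionD(4)[OF N] by simp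
  qed
qed

lemma luxemburg_norm_finite:
  assumes N: "N_function \<Phi>" and f: "f \<in> M_space M \<Phi>"
  shows "luxemburg_norm M \<Phi> f < \<infinity>"
proof -
  have "modular M \<Phi> (\<lambda>x. complex_of_real 1 * f x) < \<infinity>"
    using f zero_less_one unfolding M_space_def by blast
  then have fin: "modular M \<Phi> f < \<infinity>" by simp
  define k where "k = max 1 (enn2real (modular M \<Phi> f))"
  have "ennreal (enn2real (modular M \<Phi> f)) \<le> ennreal k" by (intro ennreal_leI) (simp add: k_def)
  then have k: "k \<ge> 1" "modular M \<Phi> f \<le> ennreal k" using fin by (simp_all add: k_def[symmetric]) (simp add: k_def)
  have "modular M \<Phi> (\<lambda>x. f x / complex_of_real k) \<le> (\<integral>\<^sup>+x. ennreal (inverse k) * ennreal (\<Phi> (norm (f x))) \<partial>M)"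
    unfolding modular_def
  proof (rule nn_integral_mono)
    fix x
    have "\<Phi> (inverse k * norm (f x)) \<le> inverse k * \<Phi> (norm (f x))"
      using k(1) by (intro N_function_scale[OF N]) (auto simp: inverse_le_1_iff)
    moreover have "norm (f x / complex_of_real k) = inverse k * norm (f x)"
      using k(1) by (simp add: norm_divide field_simps)
    ultimately show "ennreal (\<Phi> (norm (f x / complex_of_real k))) \<le> ennreal (inverse k) * ennreal (\<Phi> (norm (f x)))"
      using k(1) N_functionD(3)[OF N] by (simp add: ennreal_mult[symmetric] ennreal_leI)
  qed
  also have "\<dots> = ennreal (inverse k) * modular M \<Phi> f"
    unfolding modular_def using f unfolding M_space_def
    by (intro nn_integral_cmult measurable_compose[OF borel_measurable_N_function[OF N] measurable_ennreal]) auto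
  also have "\<dots> \<le> ennreal (inverse k) * ennreal k" using k(2) by (intro mult_left_mono) auto
  also have "\<dots> = 1" using k(1) by (simp add: ennreal_mult[symmetric])
  finally have "luxemburg_norm M \<Phi> f \<le> ennreal k"
    unfolding luxemburg_norm_def using k(1) by (intro INF_lower) auto
  then show ?thesis by (simp add: le_less_trans)
qed

text \<open>For an admissible k the function f / k competes in the supremum defining
  \<open>orlicz_norm\<close>; then k approaches the infimum. Luxemburg norm 0 is treated apart: the
  right side is 0 in ennreal even if the Orlicz norm is infinite, and f vanishes almost
  everywhere.\<close>

lemma Orlicz_Hoelder:
  fixes f g :: "'a \<Rightarrow> complex"
  assumes N: "N_function \<Phi>" and f: "f \<in> M_space M \<Phi>" and g: "g \<in> borel_measurable M"
  shows "(\<integral>\<^sup>+x. ennreal (norm (f x * g x)) \<partial>M) \<le> luxemburg_norm M \<Phi> f * orlicz_norm M \<Phi> g"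
proof (cases "luxemburg_norm M \<Phi> f = 0")
  case True
  have "f \<in> borel_measurable M" using f by (simp add: M_space_def)
  then have "AE x in M. f x = 0" using True by (intro luxemburg_norm_zero_AE[OF N])
  then have "(\<integral>\<^sup>+x. ennreal (norm (f x * g x)) \<partial>M) = (\<integral>\<^sup>+x. 0 \<partial>M)"
    by (intro nn_integral_cong_AE) (auto elim!: AE_mp)
  then show ?thesis by simp
next
  case False
  have fm: "f \<in> borel_measurable M" using f by (simp add: M_space_def)
  have fin: "luxemburg_norm M \<Phi> f < \<infinity>" by (rule luxemburg_norm_finite[OF N f])
  define c where "c = orlicz_norm M \<Phi> g"
  have *: "(\<integral>\<^sup>+x. ennreal (norm (f x * g x)) \<partial>M) \<le> ennreal k * c"
    if k: "0 < k" "modular M \<Phi> (\<lambda>x. f x / complex_of_real k) \<le> 1" for k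
  proof -
    have "luxemburg_norm M \<Phi> (\<lambda>x. f x / complex_of_real k) \<le> ennreal 1"
      unfolding luxemburg_norm_def using k(2) by (intro INF_lower) auto
    then have "(\<integral>\<^sup>+x. ennreal (norm (f x / complex_of_real k * g x)) \<partial>M) \<le> c"
      unfolding c_def orlicz_norm_def using fm by (intro SUP_upper) auto
    then have "ennreal k * (\<integral>\<^sup>+x. ennreal (norm (f x / complex_of_real k * g x)) \<partial>M) \<le> ennreal k * c"
      by (intro mult_left_mono) auto
    also have "ennreal k * (\<integral>\<^sup>+x. ennreal (norm (f x / complex_of_real k * g x)) \<partial>M) =
        (\<integral>\<^sup>+x. ennreal k * ennreal (norm (f x / complex_of_real k * g x)) \<partial>M)"
      using fm g by (intro nn_integral_cmult[symmetric]) auto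
    also have "\<dots> = (\<integral>\<^sup>+x. ennreal (norm (f x * g x)) \<partial>M)"
      using k(1) by (intro nn_integral_cong) (simp add: ennreal_mult[symmetric] norm_mult norm_divide)
    finally show ?thesis .
  qed
  show ?thesis
  proof (cases "c = \<infinity>")
    case True
    then show ?thesis using False unfolding c_def by (simp add: ennreal_mult_eq_top_iff)
  next
    case False
    then obtain r where r: "c = ennreal r" "r \<ge> 0" by (cases c) auto
    have "(\<integral>\<^sup>+x. ennreal (norm (f x * g x)) \<partial>M) \<le> luxemburg_norm M \<Phi> f * c"
    proof (rule ennreal_le_epsilon)
      fix e :: real assume e: "0 < e"
      define \<delta> where "\<delta> = e / (r + 1)"
      have \<delta>: "\<delta> > 0" "\<delta> * r \<le> e" using e r(2) by (auto simp: \<delta>_def field_simps)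
      have "luxemburg_norm M \<Phi> f < luxemburg_norm M \<Phi> f + ennreal \<delta>"
        using fin \<delta>(1) by (cases "luxemburg_norm M \<Phi> f")
          (auto simp: ennreal_plus[symmetric] ennreal_less_iff simp del: ennreal_plus)
      then obtain k where k: "0 < k" "modular M \<Phi> (\<lambda>x. f x / complex_of_real k) \<le> 1"
          "ennreal k < luxemburg_norm M \<Phi> f + ennreal \<delta>"
        unfolding luxemburg_norm_def INF_less_iff by blast
      have "(\<integral>\<^sup>+x. ennreal (norm (f x * g x)) \<partial>M) \<le> ennreal k * c" by (rule *[OF k(1,2)])
      also have "\<dots> \<le> (luxemburg_norm M \<Phi> f + ennreal \<delta>) * c" using k(3) by (intro mult_right_mono) auto
      also have "\<dots> = luxemburg_norm M \<Phi> f * c + ennreal (\<delta> * r)"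
        using r \<delta>(1) by (simp add: distrib_right ennreal_mult)
      also have "\<dots> \<le> luxemburg_norm M \<Phi> f * c + ennreal e" using \<delta>(2) by (intro add_left_mono ennreal_leI)
      finally show "(\<integral>\<^sup>+x. ennreal (norm (f x * g x)) \<partial>M) \<le> luxemburg_norm M \<Phi> f * c + ennreal e" .
    qed
    then show ?thesis unfolding c_def .
  qed
qed

subsection \<open>Compact groups\<close>

lemma C0_add:
  assumes "u \<in> C0_space" "v \<in> C0_space"
  shows "(\<lambda>x. u x + v x) \<in> C0_space"
proof -
  have "\<exists>K. compact K \<and> (\<forall>x. x \<notin> K \<longrightarrow> norm (u x + v x) < e)" if e: "e > 0" for e :: real
  proof -
    obtain K where K: "compact K" "\<forall>x. x \<notin> K \<longrightarrow> norm (u x) < e / 2"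
      using assms(1) half_gt_zero[OF e] unfolding C0_space_def by blast
    obtain L where L: "compact L" "\<forall>x. x \<notin> L \<longrightarrow> norm (v x) < e / 2"
      using assms(2) half_gt_zero[OF e] unfolding C0_space_def by blast
    have "norm (u x + v x) < e" if "x \<notin> K \<union> L" for x
      using K(2)[rule_format, of x] L(2)[rule_format, of x] norm_triangle_ineq[of "u x" "v x"] that by auto
    then show ?thesis using compact_Un[OF K(1) L(1)] by blast
  qed
  then show ?thesis
    using assms by (auto simp: C0_space_def intro!: continuous_on_add)
qed

lemma C0_sum:
  fixes F :: "nat \<Rightarrow> 'a::topological_space \<Rightarrow> complex"
  assumes "\<And>n. F n \<in> C0_space"
  shows "(\<lambda>x. \<Sum>n<N. F n x) \<in> C0_space"
proof (induction N)
  case 0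
  show ?case unfolding C0_space_def using compact_empty by auto
next
  case (Suc N)
  then show ?case using C0_add[OF Suc assms[of N]] by simp
qed

lemma C0_suminf:
  fixes F :: "nat \<Rightarrow> 'a::topological_space \<Rightarrow> complex"
  assumes F: "\<And>n. F n \<in> C0_space" and bound: "\<And>n x. norm (F n x) \<le> c n" and c: "summable c"
  shows "(\<lambda>x. \<Sum>n. F n x) \<in> C0_space"
proof -
  have ul: "uniform_limit UNIV (\<lambda>N x. \<Sum>n<N. F n x) (\<lambda>x. \<Sum>n. F n x) sequentially"
    using bound c by (intro Weierstrass_m_test) auto
  have S: "(\<lambda>x. \<Sum>n<N. F n x) \<in> C0_space" for N by (rule C0_sum[OF F])
  then have "continuous_on UNIV (\<lambda>x. \<Sum>n. F n x)"
    by (intro uniform_limit_theorem[OF _ ul]) (auto simp: C0_space_def)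
  moreover have "\<exists>K. compact K \<and> (\<forall>x. x \<notin> K \<longrightarrow> norm (\<Sum>n. F n x) < e)" if e: "e > 0" for e :: real
  proof -
    obtain N where N: "\<And>x. dist (\<Sum>n<N. F n x) (\<Sum>n. F n x) < e / 2"
      using uniform_limitD[OF ul half_gt_zero[OF e]] by (auto simp: eventually_sequentially)
    obtain K where K: "compact K" "\<forall>x. x \<notin> K \<longrightarrow> norm (\<Sum>n<N. F n x) < e / 2"
      using S[of N] half_gt_zero[OF e] unfolding C0_space_def by blast
    have "norm (\<Sum>n. F n x) < e" if "x \<notin> K" for x
      using N[of x] K(2)[rule_format, OF that] norm_triangle_ineq3[of "\<Sum>n. F n x" "\<Sum>n<N. F n x"]
      by (simp add: dist_norm norm_minus_commute)
    then show ?thesis using K(1) by blast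
  qed
  ultimately show ?thesis unfolding C0_space_def by blast
qed

context haar_group
begin

section \<open>Matrix coefficients and series representing elements of A_\<Phi>\<close>

lemma conv_check: "conv M f (check g) x = (\<integral>y. f y * g (- x + y) \<partial>M)"
  by (simp add: conv_def check_def minus_add)

lemma modular_translate:
  assumes N: "N_function \<Phi>" and f: "f \<in> borel_measurable M"
  shows "modular M \<Phi> (\<lambda>y. f (a + y)) = modular M \<Phi> f"
  unfolding modular_def
  by (rule nn_integral_translate[of "\<lambda>y. ennreal (\<Phi> (norm (f y)))"])
    (rule measurable_compose[OF borel_measurable_N_function[OF N f] measurable_ennreal])

lemma luxemburg_norm_translate:
  assumes N: "N_function \<Phi>" and f: "f \<in> borel_measurable M"
  shows "luxemburg_norm M \<Phi> (\<lambda>y. f (a + y)) = luxemburg_norm M \<Phi> f"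
proof -
  have "modular M \<Phi> (\<lambda>y. f (a + y) / complex_of_real k) = modular M \<Phi> (\<lambda>y. f y / complex_of_real k)" for k
    using f by (intro modular_translate[OF N, of "\<lambda>y. f y / complex_of_real k"]) auto
  then show ?thesis by (simp add: luxemburg_norm_def)
qed

lemma M_space_translate:
  assumes N: "N_function \<Phi>" and f: "f \<in> M_space M \<Phi>"
  shows "(\<lambda>y. f (a + y)) \<in> M_space M \<Phi>"
proof -
  have fm: "f \<in> borel_measurable M" using f by (simp add: M_space_def)
  have "modular M \<Phi> (\<lambda>y. complex_of_real c * f (a + y)) = modular M \<Phi> (\<lambda>y. complex_of_real c * f y)" for c
    using fm by (intro modular_translate[OF N, of "\<lambda>y. complex_of_real c * f y"]) auto
  then show ?thesis
    using f measurable_compose[OF measurable_translate[of a] fm] by (simp add: M_space_def)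
qed

text \<open>Left translation moves the shift by x from g to f, whose Luxemburg norm is translation
  invariant, and then \<open>Orlicz_Hoelder\<close> applies. If the integrand is not integrable, the
  integral is 0 by convention.\<close>

lemma norm_conv_check_le:
  assumes N: "N_function \<Phi>" and f: "f \<in> M_space M \<Phi>" and g: "g \<in> borel_measurable M"
  shows "ennreal (norm (conv M f (check g) x)) \<le> luxemburg_norm M \<Phi> f * orlicz_norm M \<Phi> g"
proof (cases "integrable M (\<lambda>y. f y * g (- x + y))")
  case True
  have fm: "f \<in> borel_measurable M" using f by (simp add: M_space_def)
  have "(\<lambda>y. ennreal (norm (f y * g (- x + y)))) \<in> borel_measurable M"
    using fm measurable_compose[OF measurable_translate[of "- x"] g] by auto
  from nn_integral_translate[OF this, of x]
  have "(\<integral>\<^sup>+y. ennreal (norm (f y * g (- x + y))) \<partial>M) = (\<integral>\<^sup>+y. ennreal (norm (f (x + y) * g y)) \<partial>M)"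
    by simp
  also have "\<dots> \<le> luxemburg_norm M \<Phi> f * orlicz_norm M \<Phi> g"
    using Orlicz_Hoelder[OF N M_space_translate[OF N f, of x] g] luxemburg_norm_translate[OF N fm, of x]
    by simp
  finally show ?thesis
    unfolding conv_check using integral_norm_bound_ennreal[OF True] by (rule order_trans[rotated])
next
  case False
  then show ?thesis by (simp add: conv_check not_integrable_integral_eq)
qed

text \<open>Taking the infimum over representations bounds the supremum norm by
  \<open>A_norm\<close>. On a compact group this converts bounds on u * v by suprema into bounds by
  A-norms.\<close>

lemma A_representation_bound:
  assumes N: "N_function \<Phi>" and rep: "A_representation M \<Phi> u f g"
  shows "ennreal (norm (u x)) \<le> (\<Sum>n. luxemburg_norm M \<Phi> (f n) * orlicz_norm M \<Phi> (g n))"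
proof -
  define c where "c n = luxemburg_norm M \<Phi> (f n) * orlicz_norm M \<Phi> (g n)" for n
  have fin: "(\<Sum>n. c n) < \<infinity>" and sums: "(\<lambda>n. conv M (f n) (check (g n)) x) sums u x"
    using rep unfolding A_representation_def c_def by auto
  have bnd: "ennreal (norm (conv M (f n) (check (g n)) x)) \<le> c n" for n
    unfolding c_def using rep
    by (intro norm_conv_check_le[OF N]) (auto simp: A_representation_def M_space_def)
  have "norm (\<Sum>n<m. conv M (f n) (check (g n)) x) \<le> enn2real (\<Sum>n. c n)" for m
  proof -
    have "ennreal (norm (\<Sum>n<m. conv M (f n) (check (g n)) x)) \<le>
        ennreal (\<Sum>n<m. norm (conv M (f n) (check (g n)) x))"
      by (intro ennreal_leI norm_sum)
    also have "\<dots> = (\<Sum>n<m. ennreal (norm (conv M (f n) (check (g n)) x)))" by simp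
    also have "\<dots> \<le> (\<Sum>n<m. c n)" by (intro sum_mono bnd)
    also have "\<dots> \<le> (\<Sum>n. c n)" by (intro sum_le_suminf) auto
    also have "\<dots> = ennreal (enn2real (\<Sum>n. c n))" using fin by simp
    finally show ?thesis by (simp only: ennreal_le_iff[OF enn2real_nonneg])
  qed
  then have "norm (u x) \<le> enn2real (\<Sum>n. c n)"
    using sums unfolding sums_def by (intro LIMSEQ_le_const2[OF tendsto_norm]) auto
  then have "ennreal (norm (u x)) \<le> ennreal (enn2real (\<Sum>n. c n))" by (rule ennreal_leI)
  also have "\<dots> = (\<Sum>n. c n)" using fin by simp
  finally show ?thesis unfolding c_def .
qed

text \<open>The costs of the terms also bound them uniformly, so the series converges uniformly and
  its sum stays in \<open>C0_space\<close>.\<close>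

lemma A_space_suminf:
  assumes N: "N_function \<Phi>" and f: "\<And>n. f n \<in> M_space M \<Phi>"
    and g: "\<And>n. g n \<in> M_space M (complementary \<Phi>)"
    and fin: "(\<Sum>n. luxemburg_norm M \<Phi> (f n) * orlicz_norm M \<Phi> (g n)) < \<infinity>"
    and C0: "\<And>n. conv M (f n) (check (g n)) \<in> C0_space"
  shows "(\<lambda>x. \<Sum>n. conv M (f n) (check (g n)) x) \<in> A_space M \<Phi>"
    and "summable (\<lambda>n. conv M (f n) (check (g n)) x)"
proof -
  define c where "c n = luxemburg_norm M \<Phi> (f n) * orlicz_norm M \<Phi> (g n)" for n
  have cfin: "c n < \<infinity>" for n using ennreal_suminf_lessD[OF fin] unfolding c_def .
  then have ce: "ennreal (enn2real (c n)) = c n" for n by simp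
  have summ: "summable (\<lambda>n. enn2real (c n))"
    using fin unfolding c_def[symmetric] by (intro summable_suminf_not_top) (auto simp: ce)
  have bound: "norm (conv M (f n) (check (g n)) x) \<le> enn2real (c n)" for n x
  proof -
    have "ennreal (norm (conv M (f n) (check (g n)) x)) \<le> ennreal (enn2real (c n))"
      unfolding ce unfolding c_def using g by (intro norm_conv_check_le[OF N f]) (auto simp: M_space_def)
    then show ?thesis by (simp add: ennreal_le_iff)
  qed
  show 1: "summable (\<lambda>n. conv M (f n) (check (g n)) x)" for x
    by (rule summable_comparison_test'[OF summ bound])
  show "(\<lambda>x. \<Sum>n. conv M (f n) (check (g n)) x) \<in> A_space M \<Phi>"
    unfolding A_space_def
  proof (intro CollectI conjI exI)
    show "(\<lambda>x. \<Sum>n. conv M (f n) (check (g n)) x) \<in> C0_space"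
      by (rule C0_suminf[OF C0 bound summ])
    show "A_representation M \<Phi> (\<lambda>x. \<Sum>n. conv M (f n) (check (g n)) x) f g"
      unfolding A_representation_def using f g fin 1 by (auto intro: summable_sums)
  qed
qed

lemma bounded_in_M_spaces:
  fixes f :: "'a \<Rightarrow> complex"
  assumes N: "N_function \<Phi>" and f: "f \<in> borel_measurable M"
    and K: "compact K" and bound: "\<And>x. norm (f x) \<le> c" "\<And>x. x \<notin> K \<Longrightarrow> f x = 0"
  shows "f \<in> M_space M \<Phi>" "f \<in> M_space M (complementary \<Phi>)"
proof -
  show "f \<in> M_space M \<Phi>"
    using N_function_mono[OF N] N_functionD(4)[OF N, of 0]
    by (intro bounded_in_M_space[OF _ _ f compact_sets[OF K] emeasure_compact[OF K] bound]) auto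
  show "f \<in> M_space M (complementary \<Phi>)"
    using complementary_mono[OF N] complementary_zero[OF N]
    by (intro bounded_in_M_space[OF _ _ f compact_sets[OF K] emeasure_compact[OF K] bound]) auto
qed

text \<open>On a compact group \<open>u * v = u * (v\<^sup>\<or>)\<^sup>\<or>\<close> is itself a one-term representation, since bounded
  functions lie in both Morse-Transue spaces.\<close>

lemma conv_representation_compact:
  assumes cpt: "compact (UNIV :: 'a set)" and N: "N_function \<Phi>"
    and u: "continuous_on UNIV u" "\<And>x. norm (u x) \<le> c" "c \<ge> 0"
    and v: "continuous_on UNIV v" "\<And>x. norm (v x) \<le> d" "d \<ge> 0"
  shows "\<exists>f g. A_representation M \<Phi> (conv M u v) f g \<and>
    (\<Sum>n. luxemburg_norm M \<Phi> (f n) * orlicz_norm M \<Phi> (g n)) \<le> ennreal (4 * c * d * measure M UNIV)"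
proof -
  \<comment> \<open>A representation is an infinite sequence, so the single term is padded with
    zeros.\<close>
  define f :: "nat \<Rightarrow> 'a \<Rightarrow> complex" where "f n = (if n = 0 then u else (\<lambda>_. 0))" for n
  define g :: "nat \<Rightarrow> 'a \<Rightarrow> complex" where "g n = (if n = 0 then check v else (\<lambda>_. 0))" for n
  have cv: "continuous_on UNIV (check v)"
    unfolding check_def by (rule continuous_on_compose2[OF v(1)]) (auto intro: continuous_on_minus continuous_on_id)
  have z: "continuous_on UNIV (\<lambda>_ :: 'a. 0 :: complex)" by (rule continuous_on_const)
  have fM: "f n \<in> M_space M \<Phi>" for n
    using bounded_in_M_spaces(1)[OF N measurable_continuous[OF u(1)] cpt u(2)]
      bounded_in_M_spaces(1)[OF N measurable_continuous[OF z] cpt, of 0] by (simp add: f_def)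
  have gM: "g n \<in> M_space M (complementary \<Phi>)" for n
    using bounded_in_M_spaces(2)[OF N measurable_continuous[OF cv] cpt, of d] v(2)
      bounded_in_M_spaces(2)[OF N measurable_continuous[OF z] cpt, of 0] by (simp add: g_def check_def)
  have zero: "luxemburg_norm M \<Phi> (f n) * orlicz_norm M \<Phi> (g n) = 0" if "n \<notin> {0}" for n
  proof -
    have "orlicz_norm M \<Phi> (g n) \<le> 0" unfolding orlicz_norm_def using that by (intro SUP_least) (simp add: g_def)
    then show ?thesis by simp
  qed
  have "(\<Sum>n. luxemburg_norm M \<Phi> (f n) * orlicz_norm M \<Phi> (g n)) =
      (\<Sum>n\<in>{0}. luxemburg_norm M \<Phi> (f n) * orlicz_norm M \<Phi> (g n))"
    by (rule suminf_finite[OF _ zero]) auto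
  also have "\<dots> \<le> ennreal (4 * c * d * measure M UNIV)"
    using v(2) luxemburg_orlicz_bounded[where f = u and g = "check v" and d = d,
        OF N compact_sets[OF cpt] emeasure_compact[OF cpt] u(2) _ u(3)] v(3)
    by (simp add: f_def g_def check_def)
  finally have cost: "(\<Sum>n. luxemburg_norm M \<Phi> (f n) * orlicz_norm M \<Phi> (g n)) \<le> ennreal (4 * c * d * measure M UNIV)" .
  have "(\<lambda>n. conv M (f n) (check (g n)) x) sums conv M u v x" for x
  proof -
    have "(\<lambda>n. conv M (f n) (check (g n)) x) sums (\<Sum>n\<in>{0}. conv M (f n) (check (g n)) x)"
      by (intro sums_finite) (auto simp: f_def conv_def)
    moreover have "check (check v) = v" by (simp add: check_def fun_eq_iff)
    ultimately show ?thesis by (simp add: f_def g_def)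
  qed
  moreover have "(\<Sum>n. luxemburg_norm M \<Phi> (f n) * orlicz_norm M \<Phi> (g n)) < \<infinity>"
    using cost by (rule le_less_trans) simp
  ultimately have "A_representation M \<Phi> (conv M u v) f g"
    unfolding A_representation_def using fM gM by blast
  then show ?thesis using cost by blast
qed

text \<open>The set of disagreement is open and null, hence empty by
  \<open>emeasure_open_pos\<close>. This identifies the w in \<open>conv_banach_algebra\<close> with
  \<open>conv M u v\<close> itself.\<close>

lemma continuous_eq_AE:
  fixes u v :: "'a \<Rightarrow> complex"
  assumes "continuous_on UNIV u" "continuous_on UNIV v" "AE x in M. u x = v x"
  shows "u x = v x"
proof (rule ccontr)
  assume ne: "u x \<noteq> v x"
  have op: "open {x. u x \<noteq> v x}" by (rule open_Collect_neq[OF assms(1,2)])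
  then have "emeasure M {x. u x \<noteq> v x} = 0"
    using AE_iff_measurable[of "{x. u x \<noteq> v x}" M "\<lambda>x. u x = v x"] assms(3) by (simp add: sets_M)
  then show False using emeasure_open_pos[OF op] ne by auto
qed

lemma compact_imp_Banach_algebra:
  assumes cpt: "compact (UNIV :: 'a set)" and N: "N_function \<Phi>"
  shows "conv_banach_algebra M \<Phi>"
proof -
  have cont: "continuous_on UNIV u" if "u \<in> A_space M \<Phi>" for u
    using that by (simp add: A_space_def C0_space_def)
  have cc: "continuous_on UNIV (conv M u v)"
    if u: "continuous_on UNIV u" and v: "continuous_on UNIV v" for u v
    unfolding conv_def
  proof (rule continuous_on_integral[OF _ open_UNIV cpt])
    show "continuous_on UNIV (\<lambda>p. u (snd p) * v (- snd p + fst p))"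
      by (intro continuous_on_mult continuous_on_compose2[OF u] continuous_on_compose2[OF v]
          continuous_on_add continuous_on_minus continuous_on_fst continuous_on_snd continuous_on_id) auto
  qed simp
  have ex: "conv_exists M u v" if "u \<in> A_space M \<Phi>" "v \<in> A_space M \<Phi>" for u v
  proof -
    have "integrable M (\<lambda>y. u y * v (- y + x))" for x
      by (intro integrable_bounded_compact[OF _ cpt] continuous_on_mult cont[OF that(1)]
          continuous_on_compose2[OF cont[OF that(2)]] continuous_on_add continuous_on_minus continuous_on_const
          continuous_on_id) auto
    then show ?thesis by (simp add: conv_exists_def)
  qed
  \<comment> \<open>On a compact group the modulus of u attains its maximum. This maximum is a real
    bound lying below the extended real \<open>A_norm\<close>, as
    \<open>conv_representation_compact\<close> needs.\<close>
  have sup: "\<exists>c\<ge>0. (\<forall>x. norm (u x) \<le> c) \<and> ennreal c \<le> A_norm M \<Phi> u" if u: "u \<in> A_space M \<Phi>" for u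
  proof -
    have "\<exists>z\<in>UNIV. \<forall>y\<in>UNIV. norm (u y) \<le> norm (u z)"
      by (intro continuous_attains_sup[OF cpt] continuous_on_norm cont[OF u]) auto
    then obtain z where z: "\<And>y. norm (u y) \<le> norm (u z)" by auto
    have "ennreal (norm (u z)) \<le> A_norm M \<Phi> u"
      unfolding A_norm_def using A_representation_bound[OF N] by (intro INF_greatest) auto
    then show ?thesis using z by (intro exI[of _ "norm (u z)"]) auto
  qed
  have C0: "w \<in> C0_space" if "continuous_on UNIV w" for w :: "'a \<Rightarrow> complex"
    using that cpt unfolding C0_space_def by auto
  have main: "conv M u v \<in> A_space M \<Phi> \<and>
      A_norm M \<Phi> (conv M u v) \<le> ennreal (4 * measure M UNIV) * A_norm M \<Phi> u * A_norm M \<Phi> v"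
    if u: "u \<in> A_space M \<Phi>" and v: "v \<in> A_space M \<Phi>" for u v
  proof -
    obtain c where c: "c \<ge> 0" "\<forall>x. norm (u x) \<le> c" "ennreal c \<le> A_norm M \<Phi> u" using sup[OF u] by blast
    obtain d where d: "d \<ge> 0" "\<forall>x. norm (v x) \<le> d" "ennreal d \<le> A_norm M \<Phi> v" using sup[OF v] by blast
    obtain f g where rep: "A_representation M \<Phi> (conv M u v) f g"
      and cost: "(\<Sum>n. luxemburg_norm M \<Phi> (f n) * orlicz_norm M \<Phi> (g n)) \<le> ennreal (4 * c * d * measure M UNIV)"
      using conv_representation_compact[OF cpt N cont[OF u] c(2)[rule_format] c(1) cont[OF v] d(2)[rule_format] d(1)]
      by blast
    have "A_norm M \<Phi> (conv M u v) \<le> (\<Sum>n. luxemburg_norm M \<Phi> (f n) * orlicz_norm M \<Phi> (g n))"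
      unfolding A_norm_def using rep by (intro INF_lower2[of "(f, g)"]) auto
    also have "\<dots> \<le> ennreal (4 * c * d * measure M UNIV)" by (rule cost)
    also have "\<dots> = ennreal (4 * measure M UNIV) * ennreal c * ennreal d"
      using c(1) d(1) by (simp add: ennreal_mult[symmetric] mult_ac)
    also have "\<dots> \<le> ennreal (4 * measure M UNIV) * A_norm M \<Phi> u * A_norm M \<Phi> v"
      using c(3) d(3) by (intro mult_mono) auto
    finally have "A_norm M \<Phi> (conv M u v) \<le> ennreal (4 * measure M UNIV) * A_norm M \<Phi> u * A_norm M \<Phi> v" .
    moreover have "conv M u v \<in> A_space M \<Phi>"
      unfolding A_space_def using rep C0[OF cc[OF cont[OF u] cont[OF v]]] by blast
    ultimately show ?thesis by blast
  qed
  have "measure M UNIV > 0"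
    using emeasure_open_pos[OF open_UNIV UNIV_not_empty] emeasure_compact[OF cpt]
    by (simp add: emeasure_eq_ennreal_measure)
  moreover have "A_norm M \<Phi> w \<le> ennreal (4 * measure M UNIV) * A_norm M \<Phi> u * A_norm M \<Phi> v"
    if u: "u \<in> A_space M \<Phi>" and v: "v \<in> A_space M \<Phi>" and w: "w \<in> A_space M \<Phi>"
      and AE: "AE x in M. conv M u v x = w x" for u v w
  proof -
    have "conv M u v = w"
      using continuous_eq_AE[OF cc[OF cont[OF u] cont[OF v]] cont[OF w] AE] by (rule ext)
    then show ?thesis using main[OF u v] by simp
  qed
  ultimately show ?thesis
    unfolding conv_banach_algebra_def using ex main
    by (intro conjI ballI exI[of _ "4 * measure M UNIV"] impI) auto
qed

end

subsection \<open>Noncompact groups\<close>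

definition clamp01 :: "real \<Rightarrow> real" where
  "clamp01 t = min 1 (max 0 t)"

lemma clamp01_bounds: "0 \<le> clamp01 t" "clamp01 t \<le> 1"
  by (auto simp: clamp01_def)

lemma clamp01_eq_0: "t \<le> 0 \<Longrightarrow> clamp01 t = 0"
  by (auto simp: clamp01_def)

lemma continuous_on_clamp01: "continuous_on S f \<Longrightarrow> continuous_on S (\<lambda>x. clamp01 (f x))"
  unfolding clamp01_def by (intro continuous_on_min continuous_on_max continuous_on_const)

text \<open>The j-th summand is the part of t between the heights j and j + 1.\<close>

lemma sum_clamp01: "(\<Sum>j<N. clamp01 (t - real j)) = max 0 (min t (real N))"
proof (induction N)
  case (Suc N)
  then show ?case by (auto simp: clamp01_def min_def max_def)
qed simp

text \<open>Wherever t - 1 exceeds j both factors equal 1, so the products dominate the layers of t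
  - 1. The incomplete top layers account for the loss of 1.\<close>

lemma sum_clamp01_mult_ge:
  assumes t: "0 \<le> t" "t \<le> real N" and ab: "t \<le> a" "t \<le> b"
  shows "t - 1 \<le> (\<Sum>j<N. clamp01 (a - real j) * clamp01 (b - real j))"
proof -
  have "clamp01 (t - 1 - real j) \<le> clamp01 (a - real j) * clamp01 (b - real j)" for j
  proof (cases "t - 1 - real j \<le> 0")
    case True
    then show ?thesis by (simp add: clamp01_eq_0 clamp01_bounds)
  next
    case False
    then have "clamp01 (a - real j) = 1" "clamp01 (b - real j) = 1" using ab by (auto simp: clamp01_def)
    then show ?thesis by (simp add: clamp01_bounds)
  qed
  then have "(\<Sum>j<N. clamp01 (t - 1 - real j)) \<le> (\<Sum>j<N. clamp01 (a - real j) * clamp01 (b - real j))"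
    by (intro sum_mono)
  then show ?thesis using t unfolding sum_clamp01 by auto
qed

text \<open>Raising t by 1 fills every layer that t merely touches.\<close>

lemma sum_of_bool_le:
  assumes "0 \<le> t"
  shows "(\<Sum>j<N. of_bool (real j < t)) \<le> t + 1"
proof -
  have "(\<Sum>j<N. of_bool (real j < t)) \<le> (\<Sum>j<N. clamp01 (t + 1 - real j))"
    by (intro sum_mono) (auto simp: clamp01_def)
  then show ?thesis using assms unfolding sum_clamp01 by auto
qed

context haar_group
begin

text \<open>Cutting a nearly invariant density into layers of height \<open>1 / n\<close> turns near invariance into
  matrix coefficients of the kind that occur in \<open>A_representation\<close>. Up to a bounded factor
  the cost of each layer is its mass, whatever the N-function is.\<close>

lemma Folner_representation:
  assumes am: "amenable M" and N: "N_function \<Phi>" and L: "compact L" and s: "s > 0"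
  shows "\<exists>f g. (\<forall>j. f j \<in> M_space M \<Phi> \<and> g j \<in> M_space M (complementary \<Phi>) \<and>
      conv M (f j) (check (g j)) \<in> C0_space \<and> (\<forall>x. 0 \<le> Re (conv M (f j) (check (g j)) x))) \<and>
    (\<Sum>j. luxemburg_norm M \<Phi> (f j) * orlicz_norm M \<Phi> (g j)) \<le> ennreal (5 * s) \<and>
    (\<exists>m::nat. \<forall>x\<in>L. s / 2 \<le> (\<Sum>j<m. Re (conv M (f j) (check (g j)) x)))"
proof -
  obtain \<psi> where \<psi>: "prob_density \<psi>" and inv: "\<forall>x\<in>L. l1 (\<lambda>w. \<psi> (- x + w) - \<psi> w) \<le> 1 / 2"
    using Reiter_compact[OF am L, of "1 / 2"] by auto
  note pC = prob_densityD(1)[OF \<psi>] and p0 = prob_densityD(2)[OF \<psi>]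
  obtain K where K: "compact K" "\<forall>y. y \<notin> K \<longrightarrow> \<psi> y = 0" using CcD[OF pC] by blast
  define m where "m = measure M K"
  have Kfin: "emeasure M K < \<infinity>" and Ks: "K \<in> sets M"
    using emeasure_compact[OF K(1)] compact_sets[OF K(1)] by auto
  \<comment> \<open>Rounding to layers loses at most 1 at each point of K, thus at most m after
    integration. With 4 * m < n this is less than a quarter of n, the total mass of n *
    \<psi>.\<close>
  obtain n :: nat where n: "4 * m < real n" using reals_Archimedean2 by blast
  have n0: "real n > 0" using n measure_nonneg[of M K] unfolding m_def by linarith
  have "bounded (\<psi> ` K)"
    by (intro compact_imp_bounded compact_continuous_image K(1) continuous_on_subset[OF Cc_continuous[OF pC]]) auto
  then obtain B where B: "\<And>y. y \<in> K \<Longrightarrow> norm (\<psi> y) \<le> B" unfolding bounded_iff by blast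
  obtain m0 :: nat where m0: "real n * B < real m0" using reals_Archimedean2 by blast
  have top: "real n * \<psi> y \<le> real m0" for y
  proof (cases "y \<in> K")
    case True
    then have "real n * \<psi> y \<le> real n * B" using B[OF True] n0 by (intro mult_left_mono) auto
    then show ?thesis using m0 by linarith
  qed (simp add: K(2))
  define cl where "cl j y = clamp01 (real n * \<psi> y - real j)" for j :: nat and y
  have clC: "cl j \<in> Cc" for j
  proof (rule CcI[OF _ K(1)])
    show "continuous_on UNIV (cl j)"
      unfolding cl_def
      by (intro continuous_on_clamp01 continuous_on_diff continuous_on_mult continuous_on_const Cc_continuous[OF pC])
    show "cl j y = 0" if "y \<notin> K" for y using K(2) that by (simp add: cl_def clamp01_eq_0)
  qed
  have clK: "cl j y = 0" if "y \<notin> K" for j y using K(2) that by (simp add: cl_def clamp01_eq_0)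
  have cl01: "0 \<le> cl j y" "cl j y \<le> 1" for j y by (auto simp: cl_def clamp01_bounds)
  \<comment> \<open>The whole weight sits on f, while g keeps values between 0 and 1. The factor 1 /
    n undoes the scaling of \<psi>.\<close>
  define f where "f j y = complex_of_real (s / real n * cl j y)" for j y
  define g where "g j y = complex_of_real (cl j y)" for j y
  define r where "r j x = (\<integral>y. cl j y * cl j (- x + y) \<partial>M)" for j x
  have cont_of_real: "continuous_on UNIV (\<lambda>y. complex_of_real (h y))" if "h \<in> Cc" for h :: "'a \<Rightarrow> real"
    using Cc_continuous[OF that] by (rule continuous_on_of_real)
  have fm: "f j \<in> borel_measurable M" for j
    unfolding f_def by (intro measurable_continuous cont_of_real Cc_scale clC)
  have gm: "g j \<in> borel_measurable M" for j
    unfolding g_def by (intro measurable_continuous cont_of_real clC)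
  have fb: "norm (f j y) \<le> s / real n" for j y
    using mult_left_mono[OF cl01(2)[of j y], of "s / real n"] cl01(1)[of j y] s n0
    unfolding f_def norm_of_real by (simp add: abs_mult)
  have gb: "norm (g j y) \<le> 1" for j y
    using cl01[of j y] unfolding g_def norm_of_real by simp
  have fM: "f j \<in> M_space M \<Phi>" for j
    by (rule bounded_in_M_spaces(1)[OF N fm K(1) fb]) (simp add: f_def clK)
  have gM: "g j \<in> M_space M (complementary \<Phi>)" for j
    by (rule bounded_in_M_spaces(2)[OF N gm K(1) gb]) (simp add: g_def clK)
  have conv_eq: "conv M (f j) (check (g j)) x = complex_of_real (s / real n * r j x)" for j x
  proof -
    have "conv M (f j) (check (g j)) x = (\<integral>y. complex_of_real (s / real n * (cl j y * cl j (- x + y))) \<partial>M)"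
      unfolding conv_check f_def g_def by (simp add: mult.assoc)
    then show ?thesis unfolding r_def by (simp only: integral_complex_of_real integral_mult_right_zero)
  qed
  have r0: "0 \<le> r j x" for j x unfolding r_def using cl01(1) by simp
  have rC: "r j \<in> Cc" for j
  proof (rule CcI)
    show "continuous_on UNIV (r j)"
      unfolding r_def
    proof (rule continuous_on_integral[OF _ open_UNIV K(1)])
      show "continuous_on UNIV (\<lambda>p. cl j (snd p) * cl j (- fst p + snd p))"
        by (intro continuous_on_mult continuous_on_Cc[OF clC] continuous_on_add continuous_on_minus
            continuous_on_fst continuous_on_snd continuous_on_id)
    qed (simp add: clK)
    show "compact ((\<lambda>(x, y). x + y) ` (K \<times> uminus ` K))"
      by (intro compact_plus compact_uminus K(1))
    show "r j x = 0" if x: "x \<notin> (\<lambda>(x, y). x + y) ` (K \<times> uminus ` K)" for x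
    proof -
      have 0: "cl j y * cl j (- x + y) = 0" for y
      proof (rule ccontr)
        assume "cl j y * cl j (- x + y) \<noteq> 0"
        then have "y \<in> K" "- x + y \<in> K" using clK by fastforce+
        then have "(\<lambda>(x, y). x + y) (y, - (- x + y)) \<in> (\<lambda>(x, y). x + y) ` (K \<times> uminus ` K)"
          by (intro imageI) auto
        then show False using x by (simp add: minus_add add.assoc[symmetric] del: add_uminus_conv_diff)
      qed
      show ?thesis unfolding r_def 0 by simp
    qed
  qed
  have C0: "conv M (f j) (check (g j)) \<in> C0_space" for j
  proof -
    obtain Z where Z: "compact Z" "\<forall>x. x \<notin> Z \<longrightarrow> r j x = 0" using CcD[OF rC] by blast
    have "continuous_on UNIV (conv M (f j) (check (g j)))"
      unfolding conv_eq by (intro cont_of_real Cc_scale rC)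
    then show ?thesis unfolding C0_space_def using Z by (auto simp: conv_eq)
  qed
  \<comment> \<open>Using the superlevel set instead of K in \<open>luxemburg_orlicz_bounded\<close>
    is what keeps the cost bounded: the measures of the E j add up to at most n + m, and 4 * (n + m)
    is at most 5 * n.\<close>
  define E where "E j = {y. real j < real n * \<psi> y}" for j :: nat
  have EK: "E j \<subseteq> K" for j
  proof
    fix y assume "y \<in> E j"
    then have "\<psi> y \<noteq> 0" by (auto simp: E_def)
    then show "y \<in> K" using K(2) by blast
  qed
  have Es: "E j \<in> sets M" for j
    unfolding E_def sets_M
    by (intro borel_open open_Collect_less continuous_on_const continuous_on_mult Cc_continuous[OF pC])
  have Efin: "emeasure M (E j) < \<infinity>" for j
    using emeasure_mono[OF EK Ks, of j] Kfin by (rule le_less_trans)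
  have clE: "cl j y = 0" if "y \<notin> E j" for j y
    using that by (simp add: cl_def E_def clamp01_eq_0)
  have cost: "luxemburg_norm M \<Phi> (f j) * orlicz_norm M \<Phi> (g j) \<le> ennreal (4 * (s / real n) * 1 * measure M (E j))" for j
    by (rule luxemburg_orlicz_bounded[OF N Es Efin fb _ _ gb]) (use s n0 in \<open>auto simp: f_def g_def clE\<close>)
  have Eempty: "E j = {}" if "j \<ge> m0" for j
  proof -
    have "y \<notin> E j" for y using top[of y] that by (simp add: E_def)
    then show ?thesis by blast
  qed
  have intE: "integrable M (\<lambda>y. indicat_real (E j) y)" for j
    using Es Efin by simp
  have intK: "integrable M (\<lambda>y. indicat_real K y)" using Ks Kfin by simp
  have "(\<Sum>j<m0. measure M (E j)) = (\<integral>y. (\<Sum>j<m0. indicat_real (E j) y) \<partial>M)"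
    using intE Es by (simp add: Bochner_Integration.integral_sum)
  also have "\<dots> \<le> (\<integral>y. real n * \<psi> y + indicat_real K y \<partial>M)"
  proof (rule integral_mono)
    show "integrable M (\<lambda>y. \<Sum>j<m0. indicat_real (E j) y)" using intE by simp
    show "integrable M (\<lambda>y. real n * \<psi> y + indicat_real K y)" using intK integrable_Cc[OF pC] by simp
    show "(\<Sum>j<m0. indicat_real (E j) y) \<le> real n * \<psi> y + indicat_real K y" for y
    proof (cases "y \<in> K")
      case True
      then show ?thesis
        using sum_of_bool_le[of "real n * \<psi> y" m0] p0[of y] by (simp add: indicator_def E_def)
    next
      case False
      then have "y \<notin> E j" for j using EK[of j] by blast
      then have "indicat_real (E j) y = 0" for j by (simp add: indicator_def)
      then show ?thesis using False p0[of y] by simp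
    qed
  qed
  also have "\<dots> = real n + m"
    using intK integrable_Cc[OF pC] prob_densityD(3)[OF \<psi>] Ks by (simp add: m_def)
  finally have Esum: "(\<Sum>j<m0. measure M (E j)) \<le> real n + m" .
  have "(\<Sum>j. luxemburg_norm M \<Phi> (f j) * orlicz_norm M \<Phi> (g j)) =
      (\<Sum>j<m0. luxemburg_norm M \<Phi> (f j) * orlicz_norm M \<Phi> (g j))"
  proof (rule suminf_finite)
    show "luxemburg_norm M \<Phi> (f j) * orlicz_norm M \<Phi> (g j) = 0" if "j \<notin> {..<m0}" for j
      using cost[of j] Eempty[of j] that by simp
  qed simp
  also have "\<dots> \<le> (\<Sum>j<m0. ennreal (4 * (s / real n) * 1 * measure M (E j)))"
    by (intro sum_mono cost)
  also have "\<dots> = ennreal (4 * s / real n * (\<Sum>j<m0. measure M (E j)))"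
    using s n0 by (simp add: sum_ennreal sum_distrib_left)
  also have "\<dots> \<le> ennreal (5 * s)"
  proof (rule ennreal_leI)
    have "4 * s / real n * (\<Sum>j<m0. measure M (E j)) \<le> 4 * s / real n * (real n + m)"
      using Esum s n0 by (intro mult_left_mono) auto
    also have "\<dots> = 4 * s + s * (4 * m) / real n" using n0 by (simp add: field_simps)
    also have "s * (4 * m) / real n \<le> s * real n / real n"
      using n s n0 by (intro divide_right_mono mult_left_mono) auto
    finally show "4 * s / real n * (\<Sum>j<m0. measure M (E j)) \<le> 5 * s" using n0 by simp
  qed
  finally have total: "(\<Sum>j. luxemburg_norm M \<Phi> (f j) * orlicz_norm M \<Phi> (g j)) \<le> ennreal (5 * s)" .
  have lower: "s / 2 \<le> (\<Sum>j<m0. Re (conv M (f j) (check (g j)) x))" if x: "x \<in> L" for x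
  proof -
    \<comment> \<open>The layers of \<psi> and of its translate both reach those of their minimum.
      The integral of the minimum is 1 minus half the L^1 distance, hence at least 3/4, and 3/4 * n
      - m is at least n / 2.\<close>
    define \<theta> where "\<theta> y = min (\<psi> y) (\<psi> (- x + y))" for y
    have \<theta>_eq: "\<theta> y = (\<psi> y + \<psi> (- x + y) - \<bar>\<psi> (- x + y) - \<psi> y\<bar>) / 2" for y
      by (auto simp: \<theta>_def min_def)
    note pxC = Cc_translate[OF pC, of "- x"]
    have int: "integrable M \<theta>"
      unfolding \<theta>_eq using integrable_Cc[OF pC] integrable_Cc[OF pxC] by simp
    have "(\<integral>y. \<theta> y \<partial>M) = ((\<integral>y. \<psi> y \<partial>M) + (\<integral>y. \<psi> (- x + y) \<partial>M) - l1 (\<lambda>y. \<psi> (- x + y) - \<psi> y)) / 2"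
      unfolding \<theta>_eq l1_def using integrable_Cc[OF pC] integrable_Cc[OF pxC] by simp
    also have "\<dots> = (2 - l1 (\<lambda>y. \<psi> (- x + y) - \<psi> y)) / 2"
      using prob_densityD(3)[OF \<psi>] prob_densityD(3)[OF prob_density_translate[OF \<psi>, of "- x"]] by simp
    finally have I: "3 / 4 \<le> (\<integral>y. \<theta> y \<partial>M)" using inv x by auto
    have clint: "integrable M (\<lambda>y. cl j y * cl j (- x + y))" for j
      by (rule integrable_bounded_compact[OF _ K(1)])
        (auto simp: clK intro!: continuous_on_mult Cc_continuous[OF clC] Cc_continuous[OF Cc_translate[OF clC]])
    have "real n * (1 / 2) \<le> real n * (3 / 4) - m" using n by linarith
    also have "\<dots> \<le> real n * (\<integral>y. \<theta> y \<partial>M) - m" using I n0 by simp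
    also have "\<dots> = (\<integral>y. real n * \<theta> y - indicat_real K y \<partial>M)"
      using int intK Ks by (simp add: m_def)
    also have "\<dots> \<le> (\<integral>y. (\<Sum>j<m0. cl j y * cl j (- x + y)) \<partial>M)"
    proof (rule integral_mono)
      show "integrable M (\<lambda>y. real n * \<theta> y - indicat_real K y)" using int intK by simp
      show "integrable M (\<lambda>y. \<Sum>j<m0. cl j y * cl j (- x + y))" using clint by simp
      fix y
      show "real n * \<theta> y - indicat_real K y \<le> (\<Sum>j<m0. cl j y * cl j (- x + y))"
      proof (cases "y \<in> K")
        case True
        have "real n * \<theta> y - 1 \<le> (\<Sum>j<m0. cl j y * cl j (- x + y))"
          unfolding cl_def
        proof (rule sum_clamp01_mult_ge)
          show "0 \<le> real n * \<theta> y" using p0 by (simp add: \<theta>_def)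
          show "real n * \<theta> y \<le> real n * \<psi> y" "real n * \<theta> y \<le> real n * \<psi> (- x + y)"
            using n0 by (auto simp: \<theta>_def)
          then show "real n * \<theta> y \<le> real m0" using top[of y] by linarith
        qed
        then show ?thesis using True by simp
      next
        case False
        then have "\<theta> y = 0" using K(2) p0 by (simp add: \<theta>_def)
        then show ?thesis using False cl01(1) by (simp add: sum_nonneg)
      qed
    qed
    also have "\<dots> = (\<Sum>j<m0. r j x)" unfolding r_def using clint by simp
    finally have "s / real n * (real n * (1 / 2)) \<le> s / real n * (\<Sum>j<m0. r j x)"
      using s n0 by (intro mult_left_mono) auto
    then show ?thesis unfolding conv_eq using n0 by (simp add: sum_distrib_left)
  qed
  have pos: "0 \<le> Re (conv M (f j) (check (g j)) x)" for j x
    unfolding conv_eq using s n0 r0 by simp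
  show ?thesis using fM gM C0 pos total lower by blast
qed

section \<open>Infinite Haar measure and divergence of the convolution\<close>

text \<open>Outside the compact set K - V there is some z, and then z + T is disjoint from K, so
  each step adds the fixed positive measure of T. The set z + V is adjoined in place of z + T to
  remain compact.\<close>

lemma noncompact_infinite_measure:
  assumes nc: "\<not> compact (UNIV :: 'a set)"
  obtains K where "compact K" "emeasure M K \<ge> ennreal c"
proof -
  obtain T V where TV: "open T" "compact V" "(0::'a) \<in> T" "T \<subseteq> V" by (rule compact_neighbourhood)
  have Vs: "T \<in> sets borel" using TV(1) by simp
  have pos: "emeasure M T > 0" using emeasure_open_pos[OF TV(1)] TV(3) by blast
  have fin: "emeasure M T < \<infinity>"
    using emeasure_mono[OF TV(4) compact_sets[OF TV(2)]] emeasure_compact[OF TV(2)] by (rule le_less_trans)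
  define \<mu> where "\<mu> = measure M T"
  have \<mu>: "\<mu> > 0" "emeasure M T = ennreal \<mu>"
    using pos fin by (auto simp: \<mu>_def emeasure_eq_ennreal_measure)
  have "\<exists>K. compact K \<and> ennreal (real n * \<mu>) \<le> emeasure M K" for n
  proof (induction n)
    case 0
    show ?case using compact_empty by auto
  next
    case (Suc n)
    then obtain K where K: "compact K" "ennreal (real n * \<mu>) \<le> emeasure M K" by blast
    define C where "C = (\<lambda>(x, y). x + y) ` (K \<times> uminus ` V)"
    have "compact C" unfolding C_def by (intro compact_plus compact_uminus K(1) TV(2))
    then have "C \<noteq> UNIV" using nc by auto
    then obtain z where z: "z \<notin> C" by blast
    define zT where "zT = (\<lambda>t. z + t) ` T"
    define zV where "zV = (\<lambda>t. z + t) ` V"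
    have zV: "compact zV" unfolding zV_def using TV(2)
      by (intro compact_continuous_image continuous_on_add continuous_on_const continuous_on_id)
    have "zT = (\<lambda>y. - z + y) -` T"
    proof
      show "(\<lambda>y. - z + y) -` T \<subseteq> zT"
      proof
        fix y assume "y \<in> (\<lambda>y. - z + y) -` T"
        then show "y \<in> zT" unfolding zT_def by (intro image_eqI[where x = "- z + y"]) auto
      qed
    qed (auto simp: zT_def)
    then have "open zT" using TV(1)
      by (auto intro!: open_vimage continuous_on_add continuous_on_const continuous_on_id)
    then have zTs: "zT \<in> sets M" by (simp add: sets_M)
    have disj: "K \<inter> zT = {}"
    proof (rule ccontr)
      assume "K \<inter> zT \<noteq> {}"
      then obtain t where t: "t \<in> T" "z + t \<in> K" unfolding zT_def by blast
      then have "(\<lambda>(x, y). x + y) (z + t, - t) \<in> C" unfolding C_def using TV(4) by (intro imageI) auto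
      then show False using z by (simp add: add.assoc)
    qed
    have "ennreal (real (Suc n) * \<mu>) = ennreal (real n * \<mu>) + ennreal \<mu>"
      using \<mu>(1) by (simp add: ennreal_plus[symmetric] algebra_simps del: ennreal_plus)
    also have "\<dots> \<le> emeasure M K + emeasure M zT"
      unfolding zT_def emeasure_translate[OF Vs] \<mu>(2) using K(2) by (rule add_right_mono)
    also have "\<dots> = emeasure M (K \<union> zT)"
      by (rule plus_emeasure[OF compact_sets[OF K(1)] zTs disj])
    also have "\<dots> \<le> emeasure M (K \<union> zV)"
      using TV(4) by (intro emeasure_mono compact_sets compact_Un K(1) zV) (auto simp: zT_def zV_def)
    finally show ?case using compact_Un[OF K(1) zV] by blast
  qed
  moreover obtain n :: nat where "c / \<mu> < real n" using reals_Archimedean2 by blast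
  moreover then have "ennreal c \<le> ennreal (real n * \<mu>)" using \<mu>(1) by (intro ennreal_leI) (simp add: field_simps)
  ultimately show ?thesis using that by (meson order_trans)
qed

lemma noncompact_imp_no_convolution:
  assumes nc: "\<not> compact (UNIV :: 'a set)" and am: "amenable M" and N: "N_function \<Phi>"
  shows "\<exists>u\<in>A_space M \<Phi>. \<not> conv_exists M u u"
proof -
  obtain T V where TV: "open T" "compact V" "(0::'a) \<in> T" "T \<subseteq> V" by (rule compact_neighbourhood)
  have "\<exists>K. compact K \<and> ennreal (16 ^ n) \<le> emeasure M K" for n :: nat
    using noncompact_infinite_measure[OF nc, of "16 ^ n"] by metis
  then obtain K where K: "\<And>n. compact (K n)" "\<And>n. ennreal (16 ^ n) \<le> emeasure M (K n)" by metis
  \<comment> \<open>Both factors u y and u (- y + x) have to be bounded below for y in K n and x in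
    V.\<close>
  define L where "L n = K n \<union> (\<lambda>(x, y). x + y) ` (uminus ` K n \<times> V)" for n
  have L: "compact (L n)" for n
    unfolding L_def by (intro compact_Un compact_plus compact_uminus K(1) TV(2))
  define P where "P n f g m \<longleftrightarrow> (\<forall>j. f j \<in> M_space M \<Phi> \<and> g j \<in> M_space M (complementary \<Phi>) \<and>
      conv M (f j) (check (g j)) \<in> C0_space \<and> (\<forall>x. 0 \<le> Re (conv M (f j) (check (g j)) x))) \<and>
    (\<Sum>j. luxemburg_norm M \<Phi> (f j) * orlicz_norm M \<Phi> (g j)) \<le> ennreal (5 * (1 / 2) ^ n) \<and>
    (\<forall>x\<in>L n. (1 / 2) ^ n / 2 \<le> (\<Sum>j<m. Re (conv M (f j) (check (g j)) x)))" for n and f g :: "nat \<Rightarrow> 'a \<Rightarrow> complex" and m :: nat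
  have "\<exists>f g m. P n f g m" for n
    unfolding P_def using Folner_representation[OF am N L[of n], of "(1 / 2) ^ n"] by auto
  then obtain f g m where P: "\<And>n. P n (f n) (g n) (m n)" by metis
  have fM: "f n j \<in> M_space M \<Phi>" and gM: "g n j \<in> M_space M (complementary \<Phi>)"
    and C0: "conv M (f n j) (check (g n j)) \<in> C0_space"
    and pos: "0 \<le> Re (conv M (f n j) (check (g n j)) x)" for n j x
    using P[of n] unfolding P_def by auto
  have cost: "(\<Sum>j. luxemburg_norm M \<Phi> (f n j) * orlicz_norm M \<Phi> (g n j)) \<le> ennreal (5 * (1 / 2) ^ n)" for n
    using P[of n] unfolding P_def by blast
  have low: "(1 / 2) ^ n / 2 \<le> (\<Sum>j<m n. Re (conv M (f n j) (check (g n j)) x))" if "x \<in> L n" for n x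
    using P[of n] that unfolding P_def by blast
  \<comment> \<open>A representation is a single sequence, so the double family is enumerated along
    pairs; the total cost, a sum in ennreal, is not affected by the order.\<close>
  define F where "F i = (case prod_decode i of (n, j) \<Rightarrow> f n j)" for i
  define G where "G i = (case prod_decode i of (n, j) \<Rightarrow> g n j)" for i
  define h where "h i = conv M (F i) (check (G i))" for i
  have FG: "F i \<in> M_space M \<Phi>" "G i \<in> M_space M (complementary \<Phi>)" "h i \<in> C0_space" "0 \<le> Re (h i x)" for i x
    unfolding h_def F_def G_def using fM gM C0 pos by (auto split: prod.split)
  have "(\<Sum>i. luxemburg_norm M \<Phi> (F i) * orlicz_norm M \<Phi> (G i)) =
      (\<Sum>i. (\<lambda>(n, j). luxemburg_norm M \<Phi> (f n j) * orlicz_norm M \<Phi> (g n j)) (prod_decode i))"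
    unfolding F_def G_def by (intro suminf_cong) (simp add: case_prod_beta)
  also have "\<dots> = (\<Sum>n. \<Sum>j. luxemburg_norm M \<Phi> (f n j) * orlicz_norm M \<Phi> (g n j))"
    by (rule suminf_ennreal_2dimen) simp
  also have "\<dots> \<le> (\<Sum>n. ennreal (5 * (1 / 2) ^ n))" by (intro suminf_le cost) auto
  also have "\<dots> = ennreal (\<Sum>n. 5 * (1 / 2) ^ n)"
    by (intro suminf_ennreal2) (auto intro!: summable_mult summable_geometric)
  also have "\<dots> < \<infinity>" by simp
  finally have fin: "(\<Sum>i. luxemburg_norm M \<Phi> (F i) * orlicz_norm M \<Phi> (G i)) < \<infinity>" .
  define u where "u x = (\<Sum>i. h i x)" for x
  have uA: "u \<in> A_space M \<Phi>" and summ: "summable (\<lambda>i. h i x)" for x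
    unfolding u_def h_def
    using A_space_suminf[where f = F and g = G, OF N FG(1,2) fin FG(3)[unfolded h_def]] by auto
  \<comment> \<open>All terms have nonnegative real part, so finitely many terms of the n-th block
    bound the whole sum from below.\<close>
  have big: "(1 / 2) ^ n / 2 \<le> norm (u x)" if x: "x \<in> L n" for n x
  proof -
    have "(1 / 2) ^ n / 2 \<le> (\<Sum>j<m n. Re (h (prod_encode (n, j)) x))"
      using low[OF x] by (simp add: h_def F_def G_def)
    also have "\<dots> = (\<Sum>i\<in>(\<lambda>j. prod_encode (n, j)) ` {..<m n}. Re (h i x))"
      by (subst sum.reindex) (auto simp: inj_on_def)
    also have "\<dots> \<le> (\<Sum>i. Re (h i x))"
      using FG(4) summ by (intro sum_le_suminf summable_Re) auto
    also have "\<dots> = Re (u x)" unfolding u_def by (rule Re_suminf[OF summ, symmetric])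
    also have "\<dots> \<le> norm (u x)" by (rule complex_Re_le_cmod)
    finally show ?thesis .
  qed
  have div: "\<not> integrable M (\<lambda>y. u y * u (- y + x))" if x: "x \<in> T" for x
  proof
    assume int: "integrable M (\<lambda>y. u y * u (- y + x))"
    have ge: "ennreal (4 ^ n / 4) \<le> (\<integral>\<^sup>+y. ennreal (norm (u y * u (- y + x))) \<partial>M)" for n :: nat
    proof -
      have "ennreal (4 ^ n / 4) = ennreal ((1 / 4) ^ n / 4) * ennreal (16 ^ n)"
        by (simp add: ennreal_mult[symmetric] power_mult_distrib[symmetric])
      also have "\<dots> \<le> ennreal ((1 / 4) ^ n / 4) * emeasure M (K n)" by (intro mult_left_mono K(2)) auto
      also have "\<dots> = (\<integral>\<^sup>+y. ennreal ((1 / 4) ^ n / 4) * indicator (K n) y \<partial>M)"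
        by (rule nn_integral_cmult_indicator[OF compact_sets[OF K(1)], symmetric])
      also have "\<dots> \<le> (\<integral>\<^sup>+y. ennreal (norm (u y * u (- y + x))) \<partial>M)"
      proof (rule nn_integral_mono)
        fix y
        show "ennreal ((1 / 4) ^ n / 4) * indicator (K n) y \<le> ennreal (norm (u y * u (- y + x)))"
        proof (cases "y \<in> K n")
          case True
          have "(\<lambda>(x, y). x + y) (- y, x) \<in> (\<lambda>(x, y). x + y) ` (uminus ` K n \<times> V)"
            using True x TV(4) by (intro imageI) auto
          then have "- y + x \<in> L n" by (simp add: L_def)
          moreover have "y \<in> L n" using True by (simp add: L_def)
          ultimately have "(1 / 2) ^ n / 2 * ((1 / 2) ^ n / 2) \<le> norm (u y) * norm (u (- y + x))"
            by (intro mult_mono big) auto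
          moreover have "(1 / 2) ^ n / 2 * ((1 / 2) ^ n / 2) = ((1 / 4) ^ n / 4 :: real)"
            by (simp add: power_mult_distrib[symmetric])
          ultimately show ?thesis using True by (simp add: norm_mult ennreal_leI)
        qed simp
      qed
      finally show ?thesis .
    qed
    have "(\<integral>\<^sup>+y. ennreal (norm (u y * u (- y + x))) \<partial>M) < \<infinity>"
      using int unfolding integrable_iff_bounded by blast
    then obtain r where r: "(\<integral>\<^sup>+y. ennreal (norm (u y * u (- y + x))) \<partial>M) = ennreal r" "r \<ge> 0"
      by (cases "\<integral>\<^sup>+y. ennreal (norm (u y * u (- y + x))) \<partial>M") auto
    obtain n where n: "4 * r < 4 ^ n" using real_arch_pow[of 4 "4 * r"] by auto
    have "4 ^ n / 4 \<le> r" using ge[of n] unfolding r(1) using r(2) by (simp add: ennreal_le_iff)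
    then show False using n by simp
  qed
  \<comment> \<open>Integrability fails at every point of the open set T, which has positive
    measure.\<close>
  have "\<not> conv_exists M u u"
  proof
    assume "conv_exists M u u"
    then have "AE x in M. x \<notin> T"
      unfolding conv_exists_def by (rule AE_mp) (use div in auto)
    then have "emeasure M T = 0"
      using AE_iff_measurable[of T M "\<lambda>x. x \<notin> T"] TV(1) by (simp add: sets_M)
    then show False using emeasure_open_pos[OF TV(1)] TV(3) by auto
  qed
  then show ?thesis using uA by blast
qed

end

theorem corollary3p4:
  fixes M :: "'a::{topological_group_add, t2_space} measure"
    and \<Phi> :: "real \<Rightarrow> real"
  assumes "locally compact (UNIV :: 'a set)"
    and "left_haar_measure M"
    and "amenable M"
    and "N_function \<Phi>"
  shows "((\<forall>f\<in>A_space M \<Phi>. \<forall>g\<in>A_space M \<Phi>. conv_exists M f g) \<longleftrightarrow> compact (UNIV :: 'a set)) \<and>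
         (conv_banach_algebra M \<Phi> \<longleftrightarrow> compact (UNIV :: 'a set))"
proof -
  interpret haar_group M using assms(1,2) by unfold_locales
  have "compact (UNIV :: 'a set)" if "\<forall>f\<in>A_space M \<Phi>. \<forall>g\<in>A_space M \<Phi>. conv_exists M f g"
    using noncompact_imp_no_convolution[OF _ assms(3,4)] that by blast
  moreover have "\<forall>f\<in>A_space M \<Phi>. \<forall>g\<in>A_space M \<Phi>. conv_exists M f g" if "conv_banach_algebra M \<Phi>"
    using that unfolding conv_banach_algebra_def by blast
  moreover have "conv_banach_algebra M \<Phi>" if "compact (UNIV :: 'a set)"
    by (rule compact_imp_Banach_algebra[OF that assms(4)])
  ultimately show ?thesis by blast
qed

end
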